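(* Let $\bar A=(A_0,A_1)$ be a compatible couple of (quasi-)Banach spaces with $A_0\cap A_1\neq\{0\}$. Let $0<q_1,r_1\le\infty$ and $a_1,b_1\in SV$ be such that $\left\|s^{-1/r_1}b_1(s)\|u^{-1/q_1}a_1(u)\|_{q_1,(s,1)}\right\|_{r_1,(0,1)}<\infty$, and put $$\chi_1(t)=\left\|s^{-1/r_1}b_1(s)\|u^{-1/q_1}a_1(u)\|_{q_1,(s,t)}\right\|_{r_1,(0,t)}.$$ Let $0<\theta_0<1$, $0<r,r_0,q_0\le\infty$, $a,a_0,b_0\in SV$, and $\|s^{-1/r_0}b_0(s)\|_{r_0,(1,\infty)}<\infty$. Put $\chi_0(t)=a_0(t)\|s^{-1/r_0}b_0(s)\|_{r_0,(t,\infty)}$ and $\rho(t)=t^{1-\theta_0}\frac{\chi_0(t)}{\chi_1(t)}$. For given $0\le\theta\le1$ denote $a^{\#}=\chi_0^{1-\theta}\chi_1^{\theta}\,(a\circ\rho)$ and $\eta=(1-\theta)\theta_0+\theta$. (i) If $0<\theta<1$, then $\left(\bar A^{\mathcal L}_{\theta_0,r_0,b_0,q_0,a_0},\bar A^{\mathcal R}_{1,r_1,b_1,q_1,a_1}\right)_{\theta,r,a}=\bar A_{\eta,r,a^{\#}}$. (ii) If $\|s^{-1/r}a(s)\|_{r,(1,\infty)}<\infty$, then $$\left(\bar A^{\mathcal L}_{\theta_0,r_0,b_0,q_0,a_0},\bar A^{\mathcal R}_{1,r_1,b_1,q_1,a_1}\right)_{0,r,a}=\bar A^{\mathcal L}_{\theta_0,r,B_0,q_0,a_0}\cap\bar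 A^{\mathcal L,\mathcal L}_{\theta_0,r,a\circ\rho,r_0,b_0,q_0,a_0},$$ where $B_0(t)=\|s^{-1/r_0}b_0(s)\|_{r_0,(t,\infty)}\,a(\rho(t))$. (iii) If $\|s^{-1/r}a(s)\|_{r,(0,1)}<\infty$, then, with $\theta=1$ (i.e. $a^{\#}=\chi_1\,(a\circ\rho)$), $$\left(\bar A^{\mathcal L}_{\theta_0,r_0,b_0,q_0,a_0},\bar A^{\mathcal R}_{1,r_1,b_1,q_1,a_1}\right)_{1,r,a}=\bar A_{1,r,a^{\#}}\cap\bar A^{\mathcal R}_{1,r,B_1,q_1,a_1}\cap\bar A^{\mathcal R,\mathcal R}_{1,r,a\circ\rho,r_1,b_1,q_1,a_1},$$ where $B_1(t)=\|s^{-1/r_1}b_1(s)\|_{r_1,(0,t)}\,a(\rho(t))$.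
   Context: Conventions: $1/\infty=0$; $\|\cdot\|_{q,(a,b)}$ is the usual (quasi-)norm of $L_q$ on the interval $(a,b)$, $0<q\le\infty$. Two positive functions satisfy $f\approx g$ (are equivalent) if $C^{-1}g\le f\le Cg$ for some constant $C>0$ independent of all significant quantities. $b\in SV$ (slowly varying) means that $b$ is a positive Lebesgue measurable function on $(0,\infty)$ such that for each $\varepsilon>0$ the function $t^{\varepsilon}b(t)$ is equivalent to an increasing function and $t^{-\varepsilon}b(t)$ is equivalent to a decreasing function. For a compatible couple $(X_0,X_1)$ of (quasi-)normed spaces, $K(t,f;X_0,X_1)=\inf\{\|f_0\|_{X_0}+t\|f_1\|_{X_1}: f=f_0+f_1,\ f_i\in X_i\}$ for $f\in X_0+X_1$, $t>0$; $K(t,f):=K(t,f;A_0,A_1)$. For $0\le\theta\le1$, $0<q\le\infty$, $b\in SV$, $(X_0,X_1)_{\theta,q,b}$ is the space of all $f\in X_0+X_1$ with finite (quasi-)norm $\|u^{-\theta-1/q}b(u)K(u,f;X_0,X_1)\|_{q,(0,\infty)}$, and $\bar A_{\theta,q,b}:=(A_0,A_1)_{\theta,q,b}$. For $0<p,r,q\le\infty$ and $a,b,c\in SV$, the following are the spaces of all $f\in A_0+A_1$ with finite (quasi-)norm: - $\bar A^{\mathcal L}_{\theta,r,b,q,a}$: $\left\|t^{-1/r}b(t)\|u^{-\theta-1/q}a(u)K(u,f)\|_{q,(0,t)}\right\|_{r,(0,\infty)}$; - $\bar A^{\mathcal R}_{\theta,r,b,q,a}$: $\left\|t^{-1/r}b(t)\|u^{-\theta-1/q}a(u)K(u,f)\|_{q,(t,\infty)}\right\|_{r,(0,\infty)}$;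 - $\bar A^{\mathcal L,\mathcal L}_{\theta,p,c,r,b,q,a}$: $\left\|t^{-1/p}c(t)\left\|u^{-1/r}b(u)\|v^{-\theta-1/q}a(v)K(v,f)\|_{q,(0,u)}\right\|_{r,(0,t)}\right\|_{p,(0,\infty)}$; - $\bar A^{\mathcal R,\mathcal R}_{\theta,p,c,r,b,q,a}$: $\left\|t^{-1/p}c(t)\left\|u^{-1/r}b(u)\|v^{-\theta-1/q}a(v)K(v,f)\|_{q,(u,\infty)}\right\|_{r,(t,\infty)}\right\|_{p,(0,\infty)}$. Equality of (quasi-)normed spaces means that each is continuously embedded in the other; intersections carry the maximum (equivalently, the sum) of the (quasi-)norms. Standing assumption: none of the spaces under consideration is $\{0\}$. *)

theory Defs
  imports "HOL-Analysis.Analysis"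
begin

text \<open>
  Exponents range over (0, infinity] and are represented in \<^typ>\<open>ennreal\<close>; weights are
  functions \<^typ>\<open>real \<Rightarrow> real\<close> of which only the values at positive arguments matter.
\<close>

definition recip :: "ennreal \<Rightarrow> real" where
  "recip q = enn2real (1 / q)"

lemma recip_top: "recip top = 0"
  by (simp add: recip_def)

text \<open>The power of an extended nonnegative number to a positive real exponent.\<close>

definition ennpow :: "ennreal \<Rightarrow> real \<Rightarrow> ennreal" where
  "ennpow x p = (if x = top then top else ennreal (enn2real x powr p))"

text \<open>
  For measurable \<open>f\<close> and \<open>q\<close> infinite this is the usual essential supremum. The constant esssup of
  HOL-Probability is not used because it is infinite on every non-measurable function: a Lebesgue
  measurable weight composed with a Lebesgue measurable function, such as \<open>a \<circ> \<rho>\<close> in the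
  reiteration theorem, need not be measurable, although it is always equivalent to a measurable
  function.
\<close>

definition Lq_norm :: "ennreal \<Rightarrow> real set \<Rightarrow> (real \<Rightarrow> ennreal) \<Rightarrow> ennreal" where
  "Lq_norm q S f =
     (if q = top then Inf {c. AE x in lebesgue_on S. f x \<le> c}
      else ennpow (\<integral>\<^sup>+ x. ennpow (f x) (enn2real q) \<partial>lebesgue_on S) (recip q))"

definition wnorm :: "real \<Rightarrow> ennreal \<Rightarrow> (real \<Rightarrow> real) \<Rightarrow> real set \<Rightarrow> (real \<Rightarrow> ennreal) \<Rightarrow> ennreal" where
  "wnorm \<theta> q b S g = Lq_norm q S (\<lambda>u. ennreal (u powr (- \<theta> - recip q) * b u) * g u)"

definition equivalent_fun :: "(real \<Rightarrow> real) \<Rightarrow> (real \<Rightarrow> real) \<Rightarrow> bool" where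
  "equivalent_fun f g \<longleftrightarrow> (\<exists>C>0. \<forall>t>0. inverse C * g t \<le> f t \<and> f t \<le> C * g t)"

definition slowly_varying :: "(real \<Rightarrow> real) \<Rightarrow> bool" where
  "slowly_varying b \<longleftrightarrow>
     b \<in> borel_measurable (lebesgue_on {0<..}) \<and> (\<forall>t>0. 0 < b t) \<and>
     (\<forall>\<epsilon>>0.
        (\<exists>g. (\<forall>t>0. 0 < g t) \<and> mono_on {0<..} g \<and> equivalent_fun (\<lambda>t. t powr \<epsilon> * b t) g) \<and>
        (\<exists>g. (\<forall>t>0. 0 < g t) \<and> antimono_on {0<..} g \<and> equivalent_fun (\<lambda>t. t powr (- \<epsilon>) * b t) g))"

text \<open>
  Spaces are subspaces of an ambient real vector space \<open>'v\<close>, together with a function that is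
  meaningful on the carrier only. Complex spaces are covered by restriction of scalars, which
  affects neither the K-functional nor the (quasi-)norms.
\<close>

record 'v qspace =
  carrier :: "'v set"
  qnorm :: "'v \<Rightarrow> real"

definition quasi_normed :: "'v::real_vector qspace \<Rightarrow> bool" where
  "quasi_normed X \<longleftrightarrow>
     subspace (carrier X) \<and>
     (\<forall>x\<in>carrier X. 0 \<le> qnorm X x \<and> (qnorm X x = 0 \<longleftrightarrow> x = 0)) \<and>
     (\<forall>c. \<forall>x\<in>carrier X. qnorm X (c *\<^sub>R x) = \<bar>c\<bar> * qnorm X x) \<and>
     (\<exists>C. \<forall>x\<in>carrier X. \<forall>y\<in>carrier X. qnorm X (x + y) \<le> C * (qnorm X x + qnorm X y))"

definition quasi_banach :: "'v::real_vector qspace \<Rightarrow> bool" where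
  "quasi_banach X \<longleftrightarrow>
     quasi_normed X \<and>
     (\<forall>\<sigma> :: nat \<Rightarrow> 'v. range \<sigma> \<subseteq> carrier X \<longrightarrow>
        (\<forall>e>0. \<exists>N. \<forall>m\<ge>N. \<forall>n\<ge>N. qnorm X (\<sigma> m - \<sigma> n) < e) \<longrightarrow>
        (\<exists>x\<in>carrier X. (\<lambda>n. qnorm X (\<sigma> n - x)) \<longlonglongrightarrow> 0))"

definition hausdorff_tvs :: "'v::real_vector topology \<Rightarrow> bool" where
  "hausdorff_tvs T \<longleftrightarrow>
     topspace T = UNIV \<and> Hausdorff_space T \<and>
     continuous_map (prod_topology T T) T (\<lambda>(x, y). x + y) \<and>
     continuous_map (prod_topology euclideanreal T) T (\<lambda>(c, x). c *\<^sub>R x)"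

definition embeds_in_topology :: "'v::real_vector qspace \<Rightarrow> 'v topology \<Rightarrow> bool" where
  "embeds_in_topology X T \<longleftrightarrow>
     (\<forall>x\<in>carrier X. \<forall>U. openin T U \<and> x \<in> U \<longrightarrow>
        (\<exists>\<delta>>0. \<forall>y\<in>carrier X. qnorm X (y - x) < \<delta> \<longrightarrow> y \<in> U))"

definition compatible_couple :: "'v::real_vector qspace \<Rightarrow> 'v qspace \<Rightarrow> bool" where
  "compatible_couple X0 X1 \<longleftrightarrow>
     (\<exists>T. hausdorff_tvs T \<and> embeds_in_topology X0 T \<and> embeds_in_topology X1 T)"

definition sum_carrier :: "'v::real_vector qspace \<Rightarrow> 'v qspace \<Rightarrow> 'v set" where
  "sum_carrier X0 X1 = {f0 + f1 | f0 f1. f0 \<in> carrier X0 \<and> f1 \<in> carrier X1}"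

definition K_functional :: "'v::real_vector qspace \<Rightarrow> 'v qspace \<Rightarrow> real \<Rightarrow> 'v \<Rightarrow> ennreal" where
  "K_functional X0 X1 t f =
     Inf {ennreal (qnorm X0 f0 + t * qnorm X1 f1) | f0 f1.
            f0 \<in> carrier X0 \<and> f1 \<in> carrier X1 \<and> f = f0 + f1}"

definition finite_norm_space ::
    "'v::real_vector qspace \<Rightarrow> 'v qspace \<Rightarrow> ('v \<Rightarrow> ennreal) \<Rightarrow> 'v qspace" where
  "finite_norm_space X0 X1 N =
     \<lparr>carrier = {f \<in> sum_carrier X0 X1. N f < top}, qnorm = (\<lambda>f. enn2real (N f))\<rparr>"

definition interp ::
    "'v::real_vector qspace \<Rightarrow> 'v qspace \<Rightarrow> real \<Rightarrow> ennreal \<Rightarrow> (real \<Rightarrow> real) \<Rightarrow> 'v qspace" where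
  "interp X0 X1 \<theta> q b = finite_norm_space X0 X1
     (\<lambda>f. wnorm \<theta> q b {0<..} (\<lambda>u. K_functional X0 X1 u f))"

definition interp_L ::
    "'v::real_vector qspace \<Rightarrow> 'v qspace \<Rightarrow> real \<Rightarrow> ennreal \<Rightarrow> (real \<Rightarrow> real) \<Rightarrow>
     ennreal \<Rightarrow> (real \<Rightarrow> real) \<Rightarrow> 'v qspace" where
  "interp_L A0 A1 \<theta> r b q a = finite_norm_space A0 A1
     (\<lambda>f. wnorm 0 r b {0<..}
        (\<lambda>t. wnorm \<theta> q a {0<..<t} (\<lambda>u. K_functional A0 A1 u f)))"

definition interp_R ::
    "'v::real_vector qspace \<Rightarrow> 'v qspace \<Rightarrow> real \<Rightarrow> ennreal \<Rightarrow> (real \<Rightarrow> real) \<Rightarrow>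
     ennreal \<Rightarrow> (real \<Rightarrow> real) \<Rightarrow> 'v qspace" where
  "interp_R A0 A1 \<theta> r b q a = finite_norm_space A0 A1
     (\<lambda>f. wnorm 0 r b {0<..}
        (\<lambda>t. wnorm \<theta> q a {t<..} (\<lambda>u. K_functional A0 A1 u f)))"

definition interp_LL ::
    "'v::real_vector qspace \<Rightarrow> 'v qspace \<Rightarrow> real \<Rightarrow> ennreal \<Rightarrow> (real \<Rightarrow> real) \<Rightarrow>
     ennreal \<Rightarrow> (real \<Rightarrow> real) \<Rightarrow> ennreal \<Rightarrow> (real \<Rightarrow> real) \<Rightarrow> 'v qspace" where
  "interp_LL A0 A1 \<theta> p c r b q a = finite_norm_space A0 A1
     (\<lambda>f. wnorm 0 p c {0<..}
        (\<lambda>t. wnorm 0 r b {0<..<t}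
           (\<lambda>u. wnorm \<theta> q a {0<..<u} (\<lambda>v. K_functional A0 A1 v f))))"

definition interp_RR ::
    "'v::real_vector qspace \<Rightarrow> 'v qspace \<Rightarrow> real \<Rightarrow> ennreal \<Rightarrow> (real \<Rightarrow> real) \<Rightarrow>
     ennreal \<Rightarrow> (real \<Rightarrow> real) \<Rightarrow> ennreal \<Rightarrow> (real \<Rightarrow> real) \<Rightarrow> 'v qspace" where
  "interp_RR A0 A1 \<theta> p c r b q a = finite_norm_space A0 A1
     (\<lambda>f. wnorm 0 p c {0<..}
        (\<lambda>t. wnorm 0 r b {t<..}
           (\<lambda>u. wnorm \<theta> q a {u<..} (\<lambda>v. K_functional A0 A1 v f))))"

definition inter_space :: "'v qspace \<Rightarrow> 'v qspace \<Rightarrow> 'v qspace" where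
  "inter_space X Y =
     \<lparr>carrier = carrier X \<inter> carrier Y, qnorm = (\<lambda>f. max (qnorm X f) (qnorm Y f))\<rparr>"

definition cont_embedded :: "'v qspace \<Rightarrow> 'v qspace \<Rightarrow> bool" where
  "cont_embedded X Y \<longleftrightarrow>
     carrier X \<subseteq> carrier Y \<and> (\<exists>C. \<forall>f\<in>carrier X. qnorm Y f \<le> C * qnorm X f)"

definition same_space :: "'v qspace \<Rightarrow> 'v qspace \<Rightarrow> bool" where
  "same_space X Y \<longleftrightarrow> cont_embedded X Y \<and> cont_embedded Y X"

end

theory Submission
  imports Defs
begin

text \<open>
  All norms are discretised along the points \<open>exp i\<close> with \<open>i\<close> an integer: the \<open>K\<close>-functional and the
  weights change at most by a bounded factor between neighbouring points, so that each weighted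
  \<open>L\<^sub>q\<close> norm is squeezed between norms of step functions and becomes an \<open>\<ell>\<^sub>q\<close> norm of a sequence over
  the integers. This also disposes of the possible non-measurability of \<open>a \<circ> \<rho>\<close>. Slow variation of
  \<open>b\<close> turns into \<open>\<bar>ln (b s) - ln (b t)\<bar> \<le> c + \<epsilon> * \<bar>ln s - ln t\<bar>\<close>, a form stable under products,
  powers and composition with \<open>\<rho>\<close>.

  A Holmstedt formula computes the \<open>K\<close>-functional of the two limiting spaces at \<open>\<rho> t\<close>: it is
  equivalent to \<open>P t + \<rho> t * Q t\<close>, where \<open>P\<close> collects the values of \<open>K\<close> on \<open>(0, t)\<close> and \<open>Q\<close> those on
  \<open>(t, \<infinity>)\<close>. The upper bound comes from a near-optimal decomposition of \<open>f\<close> at \<open>t\<close>, the lower bound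
  from the embeddings of the two spaces into spaces defined by a pointwise bound on \<open>K\<close>. After the
  substitution \<open>u = \<rho> t\<close> the interpolation norm is a weighted norm of \<open>P + \<rho> * Q\<close>. With a positive
  power of \<open>\<rho>\<close> to spare (\<open>\<theta> > 0\<close>) Hardy's inequality absorbs \<open>P\<close>, and with a negative power
  (\<open>\<theta> < 1\<close>) it absorbs \<open>\<rho> * Q\<close>, into the weighted norm of \<open>K\<close> with weight \<open>a\<^sup>#\<close>, which is
  always dominated by that of \<open>P\<close>.
\<close>

subsection \<open>Sequence norms\<close>

text \<open>The obstacle is the exponent 1 of the second space. Against its weight a linear
  \<open>K\<close> leaves only slowly varying factors, so sums over the linear part are not
  geometric and can only be recorded: this is the iterated norm \<open>\<chi>1\<close>. For the
  first space \<open>0 < \<theta>0\<close> makes sums over a constant tail geometric, so that one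
  tail norm of \<open>b0\<close> suffices in \<open>\<chi>0\<close>. The two spaces control
  \<open>K t\<close> pointwise through \<open>\<chi>0 t * t powr (- \<theta>0) * K t\<close> and
  \<open>\<chi>1 t * K t / t\<close>, and \<open>\<rho>\<close> is the quotient of these two
  weights. Its index \<open>1 - \<theta>0\<close> is positive, which gives the substitution and the
  gain in Hardy's inequalities, where the index is multiplied by \<open>\<theta>\<close> or by
  \<open>1 - \<theta>\<close>; when such a factor vanishes, the corresponding norm has to be kept,
  and this is the source of the intersections. All estimates are between extended numbers, with
  constants that do not depend on \<open>f\<close>, so that membership in a space is read off from
  them only at the end.\<close>

lemma ennpow_0 [simp]: "ennpow 0 p = 0"
  by (simp add: ennpow_def)

lemma ennpow_top [simp]: "ennpow top p = top"
  by (simp add: ennpow_def)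

lemma ennpow_ennreal: "0 \<le> x \<Longrightarrow> ennpow (ennreal x) p = ennreal (x powr p)"
  by (simp add: ennpow_def)

lemma ennpow_eq_top_iff [simp]: "ennpow x p = top \<longleftrightarrow> x = top"
  by (simp add: ennpow_def)

lemma ennpow_less_top_iff [simp]: "ennpow x p < top \<longleftrightarrow> x < top"
  by (metis ennpow_eq_top_iff less_top)

lemma ennpow_mono:
  assumes "x \<le> y" "0 \<le> p" shows "ennpow x p \<le> ennpow y p"
proof (cases "y = top")
  case False
  then have "x \<noteq> top" using assms neq_top_trans by blast
  then have "enn2real x \<le> enn2real y" using assms False
    by (simp add: enn2real_mono less_top)
  then show ?thesis using False \<open>x \<noteq> top\<close> assms
    by (simp add: ennpow_def powr_mono2 ennreal_leI)
qed simp

lemma ennpow_mult: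
  assumes "0 < p" shows "ennpow (x * y) p = ennpow x p * ennpow y p"
proof (cases "x = top \<or> y = top")
  case True
  have pos: "ennpow z p \<noteq> 0" if "z \<noteq> 0" "z \<noteq> top" for z
    using that by (cases z) (auto simp: ennpow_def)
  show ?thesis
  proof (cases "x = 0 \<or> y = 0")
    case False
    have nz: "ennpow z p \<noteq> 0" if "z \<noteq> 0" for z
      using that pos by (cases "z = top") auto
    show ?thesis using True False nz[of x] nz[of y]
      by (auto simp: ennreal_top_mult ennreal_mult_top)
  qed auto
next
  case False
  then obtain a b where "x = ennreal a" "y = ennreal b" "0 \<le> a" "0 \<le> b"
    by (metis ennreal_cases)
  then show ?thesis
    by (simp add: ennreal_mult[symmetric] ennpow_ennreal powr_mult)
qed

lemma ennpow_ennpow: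
  assumes "0 < p" shows "ennpow (ennpow x p) (1 / p) = x" "ennpow (ennpow x (1 / p)) p = x"
  using assms by (cases x; simp add: ennpow_ennreal powr_powr)+

text \<open>Comparison with the maximum avoids convexity, so one inequality serves exponents below
  and above 1.\<close>

lemma ennpow_add_le:
  assumes "0 < p" shows "ennpow (x + y) p \<le> ennpow 2 p * (ennpow x p + ennpow y p)"
proof -
  have "x + y \<le> 2 * max x y"
    by (metis add_mono max.cobounded1 max.cobounded2 mult_2)
  then have "ennpow (x + y) p \<le> ennpow 2 p * ennpow (max x y) p"
    using assms ennpow_mono[of "x + y" "2 * max x y" p] by (simp add: ennpow_mult)
  also have "ennpow (max x y) p \<le> ennpow x p + ennpow y p"
    by (simp add: max_def)
  finally show ?thesis by (simp add: mult_left_mono)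
qed

text \<open>The index set is an argument because heads \<open>{..<k}\<close>, tails
  \<open>{k..}\<close> and pieces \<open>{j..<k}\<close> of the integers replace intervals of
  integration. For counting measure the essential supremum is an ordinary supremum.\<close>

definition lq :: "ennreal \<Rightarrow> int set \<Rightarrow> (int \<Rightarrow> ennreal) \<Rightarrow> ennreal" where
  "lq q I x = (if q = top then SUP i\<in>I. x i
     else ennpow (\<integral>\<^sup>+ i. ennpow (x i) (enn2real q) \<partial>count_space I) (recip q))"

lemma exponent_cases:
  assumes "0 < q"
  obtains "q = top" "recip q = 0" | "q \<noteq> top" "0 < enn2real q" "recip q = 1 / enn2real q" "0 < recip q"
proof (cases "q = top")
  case False
  then have "0 < enn2real q" using assms enn2real_positive_iff top.not_eq_extremum by blast
  moreover have "recip q = 1 / enn2real q"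
  proof -
    obtain r where "q = ennreal r" "0 \<le> r" using False by (metis ennreal_cases)
    moreover have "0 < r" using \<open>0 < enn2real q\<close> calculation by simp
    ultimately show ?thesis unfolding recip_def
      by (metis divide_ennreal enn2real_ennreal ennreal_1 zero_le_one divide_nonneg_nonneg)
  qed
  ultimately show ?thesis using False that(2) by simp
qed (use that(1) recip_top in auto)

lemma lq_mono_set:
  assumes "I \<subseteq> J" "\<And>i. i \<in> I \<Longrightarrow> x i \<le> y i" "0 < q"
  shows "lq q I x \<le> lq q J y"
  using \<open>0 < q\<close>
proof (cases rule: exponent_cases)
  case 1
  then show ?thesis using assms by (auto simp: lq_def intro!: SUP_mono)
next
  case 2
  have "(\<integral>\<^sup>+ i. ennpow (x i) (enn2real q) \<partial>count_space I)
      \<le> (\<integral>\<^sup>+ i. ennpow (y i) (enn2real q) \<partial>count_space J)"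
    by (subst (1 2) nn_integral_count_space_indicator)
       (use assms 2 in \<open>auto intro!: nn_integral_mono ennpow_mono split: split_indicator\<close>)
  then show ?thesis using 2 by (simp add: lq_def ennpow_mono)
qed

lemma lq_mono: "(\<And>i. i \<in> I \<Longrightarrow> x i \<le> y i) \<Longrightarrow> 0 < q \<Longrightarrow> lq q I x \<le> lq q I y"
  by (rule lq_mono_set) auto

lemma lq_cmult:
  assumes "0 < q" shows "lq q I (\<lambda>i. c * x i) = c * lq q I x"
  using assms
proof (cases rule: exponent_cases)
  case 1
  then show ?thesis by (simp add: lq_def SUP_mult_left_ennreal)
next
  case 2
  then show ?thesis
    by (simp add: lq_def ennpow_mult nn_integral_cmult ennpow_ennpow)
qed

lemma lq_single:
  assumes "i \<in> I" "0 < q" shows "x i \<le> lq q I x"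
  using \<open>0 < q\<close>
proof (cases rule: exponent_cases)
  case 1
  then show ?thesis using assms by (auto simp: lq_def intro: SUP_upper)
next
  case 2
  have "ennpow (x i) (enn2real q) \<le> (\<integral>\<^sup>+ i. ennpow (x i) (enn2real q) \<partial>count_space I)"
    using nn_integral_ge_point[OF assms(1)] .
  then have "ennpow (ennpow (x i) (enn2real q)) (recip q) \<le> lq q I x"
    using 2 by (simp add: lq_def ennpow_mono)
  then show ?thesis using 2 by (simp add: ennpow_ennpow)
qed

lemma lq_le_lqI:
  assumes "q \<noteq> top" "0 < q" "(\<integral>\<^sup>+ i. ennpow (x i) (enn2real q) \<partial>count_space I)
     \<le> D * (\<integral>\<^sup>+ i. ennpow (y i) (enn2real q) \<partial>count_space J)"
  shows "lq q I x \<le> ennpow D (recip q) * lq q J y"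
  using \<open>0 < q\<close>
proof (cases rule: exponent_cases)
  case 2
  then show ?thesis using assms ennpow_mono[OF assms(3), of "recip q"]
    by (simp add: lq_def ennpow_mult)
qed (use assms in simp)

text \<open>The quasi-triangle inequality for powers is used twice, for the power \<open>p\<close>
  inside the sum and for the power \<open>1 / p\<close> outside. The constant is chosen before the
  index set and the sequences; this uniformity is what later yields embeddings.\<close>

lemma lq_add:
  assumes "0 < q"
  shows "\<exists>C<top. \<forall>I x y. lq q I (\<lambda>i. x i + y i) \<le> C * (lq q I x + lq q I y)"
  using assms
proof (cases rule: exponent_cases)
  case 1
  have "lq q I (\<lambda>i. x i + y i) \<le> 1 * (lq q I x + lq q I y)" for I x y
    using 1 by (auto simp: lq_def intro!: SUP_least add_mono SUP_upper)
  then show ?thesis by (intro exI[of _ 1]) auto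
next
  case 2
  define p where "p = enn2real q"
  have p: "0 < p" "recip q = 1 / p" using 2 by (auto simp: p_def)
  let ?C = "2 * ennpow 2 (1 / p)"
  have "lq q I (\<lambda>i. x i + y i) \<le> ?C * (lq q I x + lq q I y)" for I x y
  proof -
    let ?X = "\<integral>\<^sup>+ i. ennpow (x i) p \<partial>count_space I" and ?Y = "\<integral>\<^sup>+ i. ennpow (y i) p \<partial>count_space I"
    have "(\<integral>\<^sup>+ i. ennpow (x i + y i) p \<partial>count_space I)
        \<le> (\<integral>\<^sup>+ i. ennpow 2 p * (ennpow (x i) p + ennpow (y i) p) \<partial>count_space I)"
      by (intro nn_integral_mono ennpow_add_le p)
    also have "\<dots> = ennpow 2 p * (?X + ?Y)"
      by (simp add: nn_integral_cmult nn_integral_add)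
    finally have "lq q I (\<lambda>i. x i + y i) \<le> ennpow (ennpow 2 p * (?X + ?Y)) (1 / p)"
      using 2 p by (simp add: lq_def p_def[symmetric] ennpow_mono)
    also have "\<dots> = 2 * ennpow (?X + ?Y) (1 / p)"
      using p by (simp add: ennpow_mult ennpow_ennpow)
    also have "\<dots> \<le> 2 * (ennpow 2 (1 / p) * (ennpow ?X (1 / p) + ennpow ?Y (1 / p)))"
      using p by (intro mult_left_mono ennpow_add_le) auto
    finally show ?thesis using 2 by (simp add: lq_def p_def mult.assoc)
  qed
  moreover have "?C < top" by (simp add: ennreal_mult_less_top)
  ultimately show ?thesis by blast
qed

lemma lq_Un:
  assumes "0 < q"
  shows "\<exists>C<top. \<forall>I J x. lq q (I \<union> J) x \<le> C * (lq q I x + lq q J x)"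
proof -
  obtain C where C: "C < top" "\<And>I x y. lq q I (\<lambda>i. x i + y i) \<le> C * (lq q I x + lq q I y)"
    using lq_add[OF assms] by blast
  have ind: "lq q K (\<lambda>i. x i * indicator I i) \<le> lq q I x" for K I x
    using assms
  proof (cases rule: exponent_cases)
    case 1
    then show ?thesis
      by (auto simp: lq_def intro!: SUP_least split: split_indicator intro: SUP_upper)
  next
    case 2
    have "(\<integral>\<^sup>+ i. ennpow (x i * indicator I i) (enn2real q) \<partial>count_space K)
      \<le> (\<integral>\<^sup>+ i. ennpow (x i) (enn2real q) \<partial>count_space I)"
      by (subst (1 2) nn_integral_count_space_indicator)
         (auto intro!: nn_integral_mono split: split_indicator)
    then show ?thesis using 2 by (simp add: lq_def ennpow_mono)
  qed
  have "lq q (I \<union> J) x \<le> C * (lq q I x + lq q J x)" for I J x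
  proof -
    have "lq q (I \<union> J) x \<le> lq q (I \<union> J) (\<lambda>i. x i * indicator I i + x i * indicator J i)"
      using assms by (intro lq_mono) (auto split: split_indicator)
    also have "\<dots> \<le> C * (lq q (I \<union> J) (\<lambda>i. x i * indicator I i) + lq q (I \<union> J) (\<lambda>i. x i * indicator J i))"
      by (rule C)
    also have "\<dots> \<le> C * (lq q I x + lq q J x)"
      by (intro mult_left_mono add_mono ind) auto
    finally show ?thesis .
  qed
  with C(1) show ?thesis by blast
qed

text \<open>After an exchange of the order of summation, \<open>y j\<close> is counted once for
  every point of the fibre over \<open>j\<close>, so a bound on the size of the fibres suffices.
  Injectivity would be too much to ask of the discrete substitution by
  \<open>\<rho>\<close>.\<close>

lemma lq_reindex:
  assumes "0 < q"
  shows "\<exists>C<top. \<forall>I J x y \<phi>. \<phi> ` I \<subseteq> J \<longrightarrow> (\<forall>j. finite {i\<in>I. \<phi> i = j} \<and> card {i\<in>I. \<phi> i = j} \<le> N) \<longrightarrow>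
     (\<forall>i\<in>I. x i \<le> y (\<phi> i)) \<longrightarrow> lq q I x \<le> C * lq q J y"
  using assms
proof (cases rule: exponent_cases)
  case 1
  then show ?thesis
    by (intro exI[of _ 1]) (auto simp: lq_def intro!: SUP_least intro: SUP_upper2)
next
  case 2
  define p where "p = enn2real q"
  have p: "0 < p" using 2 by (simp add: p_def)
  have "lq q I x \<le> ennpow N (recip q) * lq q J y"
    if I: "\<phi> ` I \<subseteq> J" and N: "\<And>j. finite {i\<in>I. \<phi> i = j}" "\<And>j. card {i\<in>I. \<phi> i = j} \<le> N"
      and le: "\<And>i. i \<in> I \<Longrightarrow> x i \<le> y (\<phi> i)" for I J x y \<phi>
  proof (rule lq_le_lqI)
    have "(\<integral>\<^sup>+ i. ennpow (x i) p \<partial>count_space I) \<le> (\<integral>\<^sup>+ i. ennpow (y (\<phi> i)) p \<partial>count_space I)"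
      using le p by (intro nn_integral_mono ennpow_mono) auto
    also have "\<dots> = (\<integral>\<^sup>+ i. \<integral>\<^sup>+ j. ennpow (y j) p * indicator {\<phi> i} j \<partial>count_space J \<partial>count_space I)"
    proof (rule nn_integral_cong)
      fix i assume "i \<in> space (count_space I)"
      then have "\<phi> i \<in> J" using I by auto
      then show "ennpow (y (\<phi> i)) p = (\<integral>\<^sup>+ j. ennpow (y j) p * indicator {\<phi> i} j \<partial>count_space J)"
        by (subst nn_integral_count_space'[where A="{\<phi> i}"]) auto
    qed
    also have "\<dots> = (\<integral>\<^sup>+ j. \<integral>\<^sup>+ i. ennpow (y j) p * indicator {\<phi> i} j \<partial>count_space I \<partial>count_space J)"
      by (rule nn_integral_count_space_nn_integral) auto
    also have "\<dots> = (\<integral>\<^sup>+ j. ennpow (y j) p * of_nat (card {i\<in>I. \<phi> i = j}) \<partial>count_space J)"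
    proof (rule nn_integral_cong)
      fix j
      have "(\<integral>\<^sup>+ i. indicator {\<phi> i} j \<partial>count_space I) = (\<integral>\<^sup>+ i. indicator {i\<in>I. \<phi> i = j} i \<partial>count_space I)"
        by (intro nn_integral_cong) (auto split: split_indicator)
      also have "\<dots> = of_nat (card {i\<in>I. \<phi> i = j})"
        using N by (simp add: emeasure_count_space_finite)
      finally show "(\<integral>\<^sup>+ i. ennpow (y j) p * indicator {\<phi> i} j \<partial>count_space I)
        = ennpow (y j) p * of_nat (card {i\<in>I. \<phi> i = j})"
        by (subst nn_integral_cmult) auto
    qed
    also have "\<dots> \<le> (\<integral>\<^sup>+ j. of_nat N * ennpow (y j) p \<partial>count_space J)"
      using N by (intro nn_integral_mono) (subst mult.commute, intro mult_right_mono, auto)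
    also have "\<dots> = of_nat N * (\<integral>\<^sup>+ j. ennpow (y j) p \<partial>count_space J)"
      by (rule nn_integral_cmult) auto
    finally show "(\<integral>\<^sup>+ i. ennpow (x i) (enn2real q) \<partial>count_space I)
        \<le> of_nat N * (\<integral>\<^sup>+ j. ennpow (y j) (enn2real q) \<partial>count_space J)"
      by (simp add: p_def)
  qed (use assms 2(1) in simp_all)
  moreover have "ennpow (of_nat N) (recip q) < top" by (simp add: of_nat_less_top)
  ultimately show ?thesis by (intro exI[of _ "ennpow (of_nat N) (recip q)"]) simp
qed

lemma lq_inj:
  assumes "0 < q"
  shows "\<exists>C<top. \<forall>I J x y \<phi>. \<phi> ` I \<subseteq> J \<longrightarrow> inj_on \<phi> I \<longrightarrow>
     (\<forall>i\<in>I. x i \<le> y (\<phi> i)) \<longrightarrow> lq q I x \<le> C * lq q J y"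
proof -
  obtain C where C: "C < top" "\<And>I J x y \<phi>. \<phi> ` I \<subseteq> J \<Longrightarrow>
      (\<forall>j. finite {i\<in>I. \<phi> i = j} \<and> card {i\<in>I. \<phi> i = j} \<le> 1) \<Longrightarrow>
     (\<forall>i\<in>I. x i \<le> y (\<phi> i)) \<Longrightarrow> lq q I x \<le> C * lq q J y"
    using lq_reindex[OF assms, of 1] by blast
  have "finite {i\<in>I. \<phi> i = j} \<and> card {i\<in>I. \<phi> i = j} \<le> 1" if "inj_on \<phi> I" for I and \<phi> :: "int \<Rightarrow> int" and j
  proof -
    have "{i\<in>I. \<phi> i = j} = {} \<or> (\<exists>a. {i\<in>I. \<phi> i = j} = {a})"
      using that unfolding inj_on_def by blast
    then show ?thesis
    proof
      assume "{i\<in>I. \<phi> i = j} = {}"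
      then show ?thesis by (simp only: card.empty finite.emptyI) simp
    qed auto
  qed
  then show ?thesis by (intro exI[of _ C] conjI allI impI C) auto
qed

lemma nn_integral_int_exp_less_top:
  assumes "0 < d"
  shows "(\<integral>\<^sup>+ i. ennreal (exp (- d * \<bar>real_of_int i\<bar>)) \<partial>count_space UNIV) < top"
proof -
  have geo: "(\<integral>\<^sup>+ n. ennreal (exp (- d * real n)) \<partial>count_space UNIV) < top"
  proof -
    have "summable (\<lambda>n. exp (- d) ^ n)" using assms by (intro summable_geometric) simp
    then have "summable (\<lambda>n. exp (- d * real n))"
      by (simp add: exp_of_nat_mult[symmetric] mult.commute)
    then show ?thesis
      by (simp add: nn_integral_count_space_nat suminf_ennreal2)
  qed
  have "(\<integral>\<^sup>+ i. ennreal (exp (- d * \<bar>real_of_int i\<bar>)) \<partial>count_space UNIV)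
     \<le> (\<integral>\<^sup>+ i. ennreal (exp (- d * \<bar>real_of_int i\<bar>)) * indicator {0..} i
            + ennreal (exp (- d * \<bar>real_of_int i\<bar>)) * indicator {..0} i \<partial>count_space UNIV)"
    by (intro nn_integral_mono) (auto split: split_indicator)
  also have "\<dots> = (\<integral>\<^sup>+ i. ennreal (exp (- d * \<bar>real_of_int i\<bar>)) \<partial>count_space {0..})
       + (\<integral>\<^sup>+ i. ennreal (exp (- d * \<bar>real_of_int i\<bar>)) \<partial>count_space {..0})"
    by (subst nn_integral_add) (simp_all add: nn_integral_count_space_indicator)
  also have "(\<integral>\<^sup>+ i. ennreal (exp (- d * \<bar>real_of_int i\<bar>)) \<partial>count_space {0..})
     = (\<integral>\<^sup>+ n. ennreal (exp (- d * real n)) \<partial>count_space UNIV)"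
    by (subst nn_integral_bij_count_space[symmetric, where g=int and A=UNIV])
       (auto simp: bij_betw_def image_iff intro!: inj_onI bexI[of _ "nat _"] zero_le_imp_eq_int)
  also have "(\<integral>\<^sup>+ i. ennreal (exp (- d * \<bar>real_of_int i\<bar>)) \<partial>count_space {..0})
     = (\<integral>\<^sup>+ n. ennreal (exp (- d * real n)) \<partial>count_space UNIV)"
    by (subst nn_integral_bij_count_space[symmetric, where g="\<lambda>n. - int n" and A=UNIV])
       (auto simp: bij_betw_def image_iff intro!: inj_onI exI[of _ "nat (- _)"])
  finally show ?thesis by (rule le_less_trans) (use geo in \<open>simp add: less_top[symmetric]\<close>)
qed

lemma nn_integral_int_exp_shift:
  "(\<integral>\<^sup>+ i. ennreal (exp (- d * \<bar>real_of_int (i - k)\<bar>)) \<partial>count_space UNIV)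
   = (\<integral>\<^sup>+ i. ennreal (exp (- d * \<bar>real_of_int i\<bar>)) \<partial>count_space UNIV)"
  by (rule nn_integral_bij_count_space)
     (auto simp: bij_betw_def image_iff inj_on_def intro: exI[of _ "_ + k"])

text \<open>The sum of the exponentials is invariant under translation, hence the constant does not
  depend on the centre \<open>k\<close>.\<close>

lemma lq_geometric:
  assumes "0 < q" "0 < d"
  shows "\<exists>C<top. \<forall>I k y Z. (\<forall>i\<in>I. y i \<le> ennreal (exp (- d * \<bar>real_of_int (i - k)\<bar>)) * Z) \<longrightarrow>
     lq q I y \<le> C * Z"
proof -
  have "\<exists>C<top. \<forall>k. lq q UNIV (\<lambda>i. ennreal (exp (- d * \<bar>real_of_int (i - k)\<bar>))) \<le> C"
    using \<open>0 < q\<close>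
  proof (cases rule: exponent_cases)
    case 1
    have "lq q UNIV (\<lambda>i. ennreal (exp (- d * \<bar>real_of_int (i - k)\<bar>))) \<le> 1" for k
      using assms by (auto simp: lq_def 1 ennreal_le_1 intro!: SUP_least)
    then show ?thesis by (intro exI[of _ 1]) auto
  next
    case 2
    define p where "p = enn2real q"
    have p: "0 < p * d" using 2 assms by (simp add: p_def)
    have eq: "ennpow (ennreal (exp (- d * \<bar>real_of_int (i - k)\<bar>))) (enn2real q)
        = ennreal (exp (- (p * d) * \<bar>real_of_int (i - k)\<bar>))" for i k
      by (simp add: ennpow_ennreal powr_def p_def algebra_simps)
    have "lq q UNIV (\<lambda>i. ennreal (exp (- d * \<bar>real_of_int (i - k)\<bar>)))
      = ennpow (\<integral>\<^sup>+ i. ennreal (exp (- (p * d) * \<bar>real_of_int i\<bar>)) \<partial>count_space UNIV) (recip q)" for k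
      by (simp only: lq_def eq 2 if_False nn_integral_int_exp_shift)
    then show ?thesis
      using nn_integral_int_exp_less_top[OF p] by (metis ennpow_less_top_iff order_refl)
  qed
  then obtain C where C: "C < top" "\<And>k. lq q UNIV (\<lambda>i. ennreal (exp (- d * \<bar>real_of_int (i - k)\<bar>))) \<le> C"
    by blast
  have "lq q I y \<le> C * Z" if "\<forall>i\<in>I. y i \<le> ennreal (exp (- d * \<bar>real_of_int (i - k)\<bar>)) * Z" for I k y Z
  proof -
    have "lq q I y \<le> lq q UNIV (\<lambda>i. Z * ennreal (exp (- d * \<bar>real_of_int (i - k)\<bar>)))"
      using that assms by (intro lq_mono_set) (auto simp: mult.commute)
    also have "\<dots> \<le> Z * C"
      using assms C(2)[of k] by (simp add: lq_cmult mult_left_mono)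
    finally show ?thesis by (simp add: mult.commute)
  qed
  with C(1) show ?thesis by blast
qed

text \<open>This is the core of Hardy's inequality. The power of a supremum is at most the sum of
  the powers, and then the order of summation is exchanged. Starting from a supremum instead of a
  sum makes the argument work for exponents below 1 too.\<close>

lemma lq_sup_hardy:
  assumes "0 < q" "0 < d"
  shows "\<exists>C<top. \<forall>y. lq q UNIV (\<lambda>k. SUP i. ennreal (exp (- d * \<bar>real_of_int (i - k)\<bar>)) * y i)
     \<le> C * lq q UNIV y"
  using \<open>0 < q\<close>
proof (cases rule: exponent_cases)
  case 1
  have "ennreal (exp (- d * \<bar>real_of_int (i - k)\<bar>)) * y i \<le> (SUP i. y i)" for i k and y :: "int \<Rightarrow> ennreal"
  proof -
    have "ennreal (exp (- d * \<bar>real_of_int (i - k)\<bar>)) * y i \<le> 1 * y i"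
      using assms by (intro mult_right_mono) (auto simp: ennreal_le_1)
    also have "\<dots> \<le> (SUP i. y i)" by (simp add: SUP_upper)
    finally show ?thesis .
  qed
  then show ?thesis using 1
    by (intro exI[of _ 1]) (auto simp: lq_def intro!: SUP_least)
next
  case 2
  define p where "p = enn2real q"
  have p: "0 < p" "0 < p * d" using 2 assms by (auto simp: p_def)
  define E where "E = (\<lambda>i k. ennreal (exp (- d * \<bar>real_of_int (i - k)\<bar>)))"
  define E' where "E' = (\<lambda>i k. ennreal (exp (- (p * d) * \<bar>real_of_int (i - k)\<bar>)))"
  define D where "D = (\<integral>\<^sup>+ i. ennreal (exp (- (p * d) * \<bar>real_of_int i\<bar>)) \<partial>count_space UNIV)"
  have EE: "ennpow (E i k) p = E' i k" for i k
    by (simp add: E_def E'_def ennpow_ennreal powr_def algebra_simps)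
  have D: "(\<integral>\<^sup>+ k. E' i k \<partial>count_space UNIV) = D" for i
    unfolding D_def E'_def by (subst nn_integral_int_exp_shift[of _ i, symmetric]) (simp add: abs_minus_commute)
  have "lq q UNIV (\<lambda>k. SUP i. E i k * y i) \<le> ennpow D (recip q) * lq q UNIV y" for y
  proof (rule lq_le_lqI)
    have "(\<integral>\<^sup>+ k. ennpow (SUP i. E i k * y i) p \<partial>count_space UNIV)
       \<le> (\<integral>\<^sup>+ k. \<integral>\<^sup>+ i. E' i k * ennpow (y i) p \<partial>count_space UNIV \<partial>count_space UNIV)"
    proof (rule nn_integral_mono)
      fix k
      let ?T = "\<integral>\<^sup>+ i. E' i k * ennpow (y i) p \<partial>count_space UNIV"
      have "E i k * y i \<le> ennpow ?T (1 / p)" for i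
      proof -
        have "ennpow (E i k * y i) p \<le> ?T"
          using nn_integral_ge_point[of i UNIV "\<lambda>i. E' i k * ennpow (y i) p"] p
          by (simp add: ennpow_mult EE)
        then have "ennpow (ennpow (E i k * y i) p) (1 / p) \<le> ennpow ?T (1 / p)"
          using p by (intro ennpow_mono) auto
        then show ?thesis using p by (simp add: ennpow_ennpow)
      qed
      then have "(SUP i. E i k * y i) \<le> ennpow ?T (1 / p)" by (rule SUP_least)
      then have "ennpow (SUP i. E i k * y i) p \<le> ennpow (ennpow ?T (1 / p)) p"
        using p by (intro ennpow_mono) auto
      then show "ennpow (SUP i. E i k * y i) p \<le> ?T" using p by (simp add: ennpow_ennpow)
    qed
    also have "\<dots> = (\<integral>\<^sup>+ i. \<integral>\<^sup>+ k. E' i k * ennpow (y i) p \<partial>count_space UNIV \<partial>count_space UNIV)"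
      by (rule nn_integral_count_space_nn_integral) auto
    also have "\<dots> = (\<integral>\<^sup>+ i. D * ennpow (y i) p \<partial>count_space UNIV)"
      by (simp add: nn_integral_multc D)
    also have "\<dots> = D * (\<integral>\<^sup>+ i. ennpow (y i) p \<partial>count_space UNIV)"
      by (rule nn_integral_cmult) auto
    finally show "(\<integral>\<^sup>+ k. ennpow (SUP i. E i k * y i) (enn2real q) \<partial>count_space UNIV)
       \<le> D * (\<integral>\<^sup>+ i. ennpow (y i) (enn2real q) \<partial>count_space UNIV)"
      by (simp add: p_def)
  qed (use assms 2 in auto)
  moreover have "ennpow D (recip q) < top"
    using nn_integral_int_exp_less_top[OF p(2)] by (simp add: D_def)
  ultimately show ?thesis unfolding E_def by blast
qed

subsection \<open>Estimates up to constants\<close>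

text \<open>The first argument is a parameter, later the element \<open>f\<close>; the second is a
  position, later an integer or a real cut-off. One finite constant serves all pairs, and both sides
  may be infinite.\<close>

definition les :: "('p \<Rightarrow> 'k \<Rightarrow> ennreal) \<Rightarrow> ('p \<Rightarrow> 'k \<Rightarrow> ennreal) \<Rightarrow> bool" (infix "\<lessapprox>" 50) where
  "F \<lessapprox> G \<longleftrightarrow> (\<exists>C<top. \<forall>p k. F p k \<le> C * G p k)"

lemma lesI: "C < top \<Longrightarrow> (\<And>p k. F p k \<le> C * G p k) \<Longrightarrow> F \<lessapprox> G"
  unfolding les_def by blast

lemma lesE:
  assumes "F \<lessapprox> G" obtains C where "C < top" "\<And>p k. F p k \<le> C * G p k"
  using assms unfolding les_def by blast

lemma les_mono: "(\<And>p k. F p k \<le> G p k) \<Longrightarrow> F \<lessapprox> G"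
  by (rule lesI[of 1]) auto

lemma les_refl [simp]: "F \<lessapprox> F"
  by (simp add: les_mono)

lemma les_trans [trans]:
  assumes "F \<lessapprox> G" "G \<lessapprox> H" shows "F \<lessapprox> H"
proof -
  from assms obtain C D where CD: "C < top" "\<And>p k. F p k \<le> C * G p k" "D < top" "\<And>p k. G p k \<le> D * H p k"
    by (elim lesE) (rule that; assumption)
  show ?thesis
  proof (rule lesI)
    show "C * D < top" using CD by (simp add: ennreal_mult_less_top)
    show "F p k \<le> C * D * H p k" for p k
      using CD(2)[of p k] mult_left_mono[OF CD(4)[of p k], of C] by (simp add: mult.assoc)
  qed
qed

lemma les_le_trans: "F \<lessapprox> G \<Longrightarrow> (\<And>p k. G p k \<le> H p k) \<Longrightarrow> F \<lessapprox> H"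
  using les_mono les_trans by blast

lemma les_add:
  assumes "F \<lessapprox> H" "G \<lessapprox> H" shows "(\<lambda>p k. F p k + G p k) \<lessapprox> H"
proof -
  from assms obtain C D where CD: "C < top" "\<And>p k. F p k \<le> C * H p k" "D < top" "\<And>p k. G p k \<le> D * H p k"
    by (elim lesE) (rule that; assumption)
  show ?thesis
  proof (rule lesI)
    show "C + D < top" using CD by simp
    show "F p k + G p k \<le> (C + D) * H p k" for p k
      using add_mono[OF CD(2,4)[of p k]] by (simp add: distrib_right)
  qed
qed

lemma les_add_mono:
  assumes "F \<lessapprox> F'" "G \<lessapprox> G'" shows "(\<lambda>p k. F p k + G p k) \<lessapprox> (\<lambda>p k. F' p k + G' p k)"
  by (intro les_add les_le_trans[OF assms(1)] les_le_trans[OF assms(2)]) auto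

lemma les_mult:
  assumes "F \<lessapprox> G" shows "(\<lambda>p k. c p k * F p k) \<lessapprox> (\<lambda>p k. c p k * G p k)"
proof -
  obtain C where C: "C < top" "\<And>p k. F p k \<le> C * G p k" using assms by (elim lesE) (rule that; assumption)
  show ?thesis
  proof (rule lesI[OF C(1)])
    show "c p k * F p k \<le> C * (c p k * G p k)" for p k
      using mult_left_mono[OF C(2)[of p k], of "c p k"] by (simp add: mult.left_commute)
  qed
qed

text \<open>The position in the hypothesis becomes the summation index, and the position in the
  conclusion selects the set of summation.\<close>

lemma les_lq:
  assumes "F \<lessapprox> G" "0 < q" shows "(\<lambda>p k. lq q (I p k) (F p)) \<lessapprox> (\<lambda>p k. lq q (I p k) (G p))"
proof -
  obtain C where C: "C < top" "\<And>p k. F p k \<le> C * G p k" using assms by (elim lesE) (rule that; assumption)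
  show ?thesis
  proof (rule lesI[OF C(1)])
    show "lq q (I p k) (F p) \<le> C * lq q (I p k) (G p)" for p k
      using C assms by (subst lq_cmult[symmetric]) (auto intro: lq_mono)
  qed
qed

lemma les_lq_add:
  assumes "0 < q"
  shows "(\<lambda>p k. lq q (I p k) (\<lambda>i. F p i + G p i)) \<lessapprox> (\<lambda>p k. lq q (I p k) (F p) + lq q (I p k) (G p))"
proof -
  obtain C where "C < top" "\<And>I x y. lq q I (\<lambda>i. x i + y i) \<le> C * (lq q I x + lq q I y)"
    using lq_add[OF assms] by blast
  then show ?thesis by (intro lesI)
qed

subsection \<open>Regularly varying functions\<close>

text \<open>Regular variation of index \<open>\<kappa>\<close> up to bounded factors: as a function
  of \<open>ln t\<close>, the logarithm of \<open>w\<close> has slope \<open>\<kappa>\<close> with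
  an arbitrarily small linear error. Slow variation is the case \<open>\<kappa> = 0\<close>.\<close>

definition rv :: "real \<Rightarrow> (real \<Rightarrow> real) \<Rightarrow> bool" where
  "rv \<kappa> w \<longleftrightarrow> (\<forall>t>0. 0 < w t) \<and>
     (\<forall>\<epsilon>>0. \<exists>c. \<forall>s t. 0 < s \<longrightarrow> 0 < t \<longrightarrow> \<bar>ln (w s) - ln (w t) - \<kappa> * (ln s - ln t)\<bar> \<le> c + \<epsilon> * \<bar>ln s - ln t\<bar>)"

lemma rvI:
  assumes "\<And>t. 0 < t \<Longrightarrow> 0 < w t"
    and "\<And>\<epsilon>. 0 < \<epsilon> \<Longrightarrow> \<exists>c. \<forall>s t. 0 < s \<longrightarrow> 0 < t \<longrightarrow>
      \<bar>ln (w s) - ln (w t) - \<kappa> * (ln s - ln t)\<bar> \<le> c + \<epsilon> * \<bar>ln s - ln t\<bar>"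
  shows "rv \<kappa> w"
  unfolding rv_def using assms by simp

lemma rv_pos: "rv \<kappa> w \<Longrightarrow> 0 < t \<Longrightarrow> 0 < w t"
  by (simp add: rv_def)

lemma rvE:
  assumes "rv \<kappa> w" "0 < \<epsilon>"
  obtains c where "\<And>s t. 0 < s \<Longrightarrow> 0 < t \<Longrightarrow>
    \<bar>ln (w s) - ln (w t) - \<kappa> * (ln s - ln t)\<bar> \<le> c + \<epsilon> * \<bar>ln s - ln t\<bar>"
proof -
  have "\<exists>c. \<forall>s t. 0 < s \<longrightarrow> 0 < t \<longrightarrow> \<bar>ln (w s) - ln (w t) - \<kappa> * (ln s - ln t)\<bar> \<le> c + \<epsilon> * \<bar>ln s - ln t\<bar>"
    using assms unfolding rv_def by simp
  then obtain c where "\<forall>s t. 0 < s \<longrightarrow> 0 < t \<longrightarrow> \<bar>ln (w s) - ln (w t) - \<kappa> * (ln s - ln t)\<bar> \<le> c + \<epsilon> * \<bar>ln s - ln t\<bar>" ..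
  then show thesis by (intro that[of c]) simp
qed

lemma rv_mult:
  assumes v: "rv \<kappa> v" and w: "rv \<kappa>' w" shows "rv (\<kappa> + \<kappa>') (\<lambda>t. v t * w t)"
proof (rule rvI)
  fix \<epsilon> :: real assume e: "0 < \<epsilon>"
  obtain c where c: "\<And>s t. 0 < s \<Longrightarrow> 0 < t \<Longrightarrow>
    \<bar>ln (v s) - ln (v t) - \<kappa> * (ln s - ln t)\<bar> \<le> c + \<epsilon> / 2 * \<bar>ln s - ln t\<bar>"
    by (rule rvE[OF v, of "\<epsilon> / 2"]) (use e in \<open>auto intro!: that\<close>)
  obtain d where d: "\<And>s t. 0 < s \<Longrightarrow> 0 < t \<Longrightarrow>
    \<bar>ln (w s) - ln (w t) - \<kappa>' * (ln s - ln t)\<bar> \<le> d + \<epsilon> / 2 * \<bar>ln s - ln t\<bar>"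
    by (rule rvE[OF w, of "\<epsilon> / 2"]) (use e in \<open>auto intro!: that\<close>)
  have key: "\<bar>ln (v s * w s) - ln (v t * w t) - (\<kappa> + \<kappa>') * (ln s - ln t)\<bar> \<le> (c + d) + \<epsilon> * \<bar>ln s - ln t\<bar>"
    if "0 < s" "0 < t" for s t
  proof -
    have "ln (v s * w s) - ln (v t * w t) - (\<kappa> + \<kappa>') * (ln s - ln t)
      = (ln (v s) - ln (v t) - \<kappa> * (ln s - ln t)) + (ln (w s) - ln (w t) - \<kappa>' * (ln s - ln t))"
      using rv_pos[OF v that(1)] rv_pos[OF v that(2)] rv_pos[OF w that(1)] rv_pos[OF w that(2)]
      by (simp add: ln_mult algebra_simps)
    then show ?thesis using c[OF that] d[OF that] by (simp add: algebra_simps)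
  qed
  show "\<exists>c. \<forall>s t. 0 < s \<longrightarrow> 0 < t \<longrightarrow>
      \<bar>ln (v s * w s) - ln (v t * w t) - (\<kappa> + \<kappa>') * (ln s - ln t)\<bar> \<le> c + \<epsilon> * \<bar>ln s - ln t\<bar>"
    by (intro exI[of _ "c + d"] allI impI key)
qed (use rv_pos[OF v] rv_pos[OF w] in simp)

lemma rv_powr:
  assumes v: "rv \<kappa> v" shows "rv (\<kappa> * p) (\<lambda>t. v t powr p)"
proof (rule rvI)
  fix \<epsilon> :: real assume e: "0 < \<epsilon>"
  \<comment> \<open>The summand 1 keeps the divisor positive when \<open>p = 0\<close>.\<close>
  obtain c where c: "\<And>s t. 0 < s \<Longrightarrow> 0 < t \<Longrightarrow>
    \<bar>ln (v s) - ln (v t) - \<kappa> * (ln s - ln t)\<bar> \<le> c + \<epsilon> / (\<bar>p\<bar> + 1) * \<bar>ln s - ln t\<bar>"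
    by (rule rvE[OF v, of "\<epsilon> / (\<bar>p\<bar> + 1)"]) (use e in \<open>auto intro!: divide_pos_pos that\<close>)
  have key: "\<bar>ln (v s powr p) - ln (v t powr p) - \<kappa> * p * (ln s - ln t)\<bar> \<le> \<bar>p\<bar> * c + \<epsilon> * \<bar>ln s - ln t\<bar>"
    if "0 < s" "0 < t" for s t
  proof -
    have "ln (v s powr p) - ln (v t powr p) - \<kappa> * p * (ln s - ln t)
      = p * (ln (v s) - ln (v t) - \<kappa> * (ln s - ln t))"
      using rv_pos[OF v] that by (simp add: ln_powr algebra_simps)
    then have "\<bar>ln (v s powr p) - ln (v t powr p) - \<kappa> * p * (ln s - ln t)\<bar>
      = \<bar>p\<bar> * \<bar>ln (v s) - ln (v t) - \<kappa> * (ln s - ln t)\<bar>" by (simp add: abs_mult)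
    also have "\<dots> \<le> \<bar>p\<bar> * (c + \<epsilon> / (\<bar>p\<bar> + 1) * \<bar>ln s - ln t\<bar>)"
      by (intro mult_left_mono c that) auto
    also have "\<dots> \<le> \<bar>p\<bar> * c + \<epsilon> * \<bar>ln s - ln t\<bar>"
    proof -
      have "\<bar>p\<bar> * (\<epsilon> / (\<bar>p\<bar> + 1)) \<le> \<epsilon>" using e by (simp add: field_simps)
      from mult_right_mono[OF this, of "\<bar>ln s - ln t\<bar>"] show ?thesis
        by (simp add: distrib_left mult.assoc)
    qed
    finally show ?thesis .
  qed
  show "\<exists>c. \<forall>s t. 0 < s \<longrightarrow> 0 < t \<longrightarrow>
      \<bar>ln (v s powr p) - ln (v t powr p) - \<kappa> * p * (ln s - ln t)\<bar> \<le> c + \<epsilon> * \<bar>ln s - ln t\<bar>"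
    by (intro exI[of _ "\<bar>p\<bar> * c"] allI impI key)
qed (use rv_pos[OF v] in \<open>metis powr_gt_zero less_irrefl\<close>)

lemma rv_cong: "rv \<kappa> v \<Longrightarrow> (\<And>t. 0 < t \<Longrightarrow> w t = v t) \<Longrightarrow> rv \<kappa> w"
  unfolding rv_def by simp

lemma rv_divide:
  assumes v: "rv \<kappa> v" and w: "rv \<kappa>' w" shows "rv (\<kappa> - \<kappa>') (\<lambda>t. v t / w t)"
proof (rule rv_cong)
  show "rv (\<kappa> - \<kappa>') (\<lambda>t. v t * w t powr (- 1))"
    using rv_mult[OF v rv_powr[OF w, of "- 1"]] by simp
  show "v t / w t = v t * w t powr (- 1)" if "0 < t" for t
    using rv_pos[OF w that] by (simp add: powr_minus divide_inverse)
qed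

lemma rv_power: "rv \<kappa> (\<lambda>t. t powr \<kappa>)"
proof -
  have "rv 1 (\<lambda>t. t)" by (rule rvI) (auto intro!: exI[of _ 0])
  from rv_powr[OF this, of \<kappa>] show ?thesis by simp
qed

lemma rv_comp:
  assumes a: "rv 0 a" and r: "rv \<kappa> \<rho>" shows "rv 0 (\<lambda>t. a (\<rho> t))"
proof (rule rvI)
  fix \<epsilon> :: real assume e: "0 < \<epsilon>"
  \<comment> \<open>Up to a constant, \<open>\<rho>\<close> stretches logarithmic distances by at
    most \<open>\<bar>\<kappa>\<bar> + 1\<close>; this factor is divided out in advance.\<close>
  define \<delta> where "\<delta> = \<epsilon> / (\<bar>\<kappa>\<bar> + 1)"
  have d: "0 < \<delta>" "\<delta> * (\<bar>\<kappa>\<bar> + 1) = \<epsilon>" using e by (auto simp: \<delta>_def)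
  obtain c where c: "\<And>s t. 0 < s \<Longrightarrow> 0 < t \<Longrightarrow>
    \<bar>ln (a s) - ln (a t) - 0 * (ln s - ln t)\<bar> \<le> c + \<delta> * \<bar>ln s - ln t\<bar>"
    by (rule rvE[OF a d(1)]) (rule that)
  obtain c' where c': "\<And>s t. 0 < s \<Longrightarrow> 0 < t \<Longrightarrow>
    \<bar>ln (\<rho> s) - ln (\<rho> t) - \<kappa> * (ln s - ln t)\<bar> \<le> c' + 1 * \<bar>ln s - ln t\<bar>"
    by (rule rvE[OF r zero_less_one]) (rule that)
  have key: "\<bar>ln (a (\<rho> s)) - ln (a (\<rho> t)) - 0 * (ln s - ln t)\<bar> \<le> (c + \<delta> * c') + \<epsilon> * \<bar>ln s - ln t\<bar>"
    if "0 < s" "0 < t" for s t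
  proof -
    have "\<bar>ln (\<rho> s) - ln (\<rho> t)\<bar> \<le> c' + \<bar>ln s - ln t\<bar> + \<bar>\<kappa> * (ln s - ln t)\<bar>"
      using c'[OF that] abs_triangle_ineq2[of "ln (\<rho> s) - ln (\<rho> t)" "\<kappa> * (ln s - ln t)"] by simp
    also have "\<dots> = c' + (\<bar>\<kappa>\<bar> + 1) * \<bar>ln s - ln t\<bar>" by (simp only: abs_mult) (simp add: algebra_simps)
    finally have "\<delta> * \<bar>ln (\<rho> s) - ln (\<rho> t)\<bar> \<le> \<delta> * (c' + (\<bar>\<kappa>\<bar> + 1) * \<bar>ln s - ln t\<bar>)"
      using d by (intro mult_left_mono) auto
    also have "\<dots> = \<delta> * c' + \<epsilon> * \<bar>ln s - ln t\<bar>"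
      using d by (simp add: distrib_left mult.assoc[symmetric])
    finally show ?thesis using c[of "\<rho> s" "\<rho> t"] rv_pos[OF r] that by simp
  qed
  show "\<exists>c. \<forall>s t. 0 < s \<longrightarrow> 0 < t \<longrightarrow>
    \<bar>ln (a (\<rho> s)) - ln (a (\<rho> t)) - 0 * (ln s - ln t)\<bar> \<le> c + \<epsilon> * \<bar>ln s - ln t\<bar>"
    by (intro exI[of _ "c + \<delta> * c'"] allI impI key)
qed (use rv_pos[OF a] rv_pos[OF r] in simp)

text \<open>For \<open>s \<le> t\<close> the almost increasing function bounds \<open>b s\<close> by
  \<open>b t\<close> and the almost decreasing one bounds \<open>b t\<close> by \<open>b s\<close>,
  each with a loss of \<open>(t / s) powr \<epsilon>\<close>.\<close>

lemma slowly_varying_rv: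
  assumes "slowly_varying b" shows "rv 0 b"
proof (rule rvI)
  have pos: "0 < b t" if "0 < t" for t using assms that by (simp add: slowly_varying_def)
  then show "0 < b t" if "0 < t" for t using that .
  fix \<epsilon> :: real assume e: "0 < \<epsilon>"
  obtain g where g: "\<And>t. 0 < t \<Longrightarrow> 0 < g t" "mono_on {0<..} g" "equivalent_fun (\<lambda>t. t powr \<epsilon> * b t) g"
    using assms e unfolding slowly_varying_def by blast
  obtain h where h: "\<And>t. 0 < t \<Longrightarrow> 0 < h t" "antimono_on {0<..} h" "equivalent_fun (\<lambda>t. t powr (- \<epsilon>) * b t) h"
    using assms e unfolding slowly_varying_def by blast
  have equivD: "\<exists>C>0. \<forall>t>0. v t \<le> C * u t \<and> u t \<le> C * v t" if "equivalent_fun v u" for v u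
  proof -
    obtain C where C: "0 < C" "\<And>t. 0 < t \<Longrightarrow> inverse C * u t \<le> v t \<and> v t \<le> C * u t"
      using \<open>equivalent_fun v u\<close> unfolding equivalent_fun_def by blast
    then have "u t \<le> C * v t" if "0 < t" for t
      using C(1) C(2)[OF that] mult_left_mono[of "inverse C * u t" "v t" C]
      by (simp add: mult.assoc[symmetric])
    then show ?thesis using C by blast
  qed
  obtain C where C: "0 < C" "\<And>t. 0 < t \<Longrightarrow> t powr \<epsilon> * b t \<le> C * g t" "\<And>t. 0 < t \<Longrightarrow> g t \<le> C * (t powr \<epsilon> * b t)"
    using equivD[OF g(3)] by blast
  obtain D where D: "0 < D" "\<And>t. 0 < t \<Longrightarrow> t powr (- \<epsilon>) * b t \<le> D * h t"
      "\<And>t. 0 < t \<Longrightarrow> h t \<le> D * (t powr (- \<epsilon>) * b t)"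
    using equivD[OF h(3)] by blast
  \<comment> \<open>The logarithms are doubled because each equivalence is applied at both
    arguments.\<close>
  define c where "c = max (2 * ln C) (2 * ln D)"
  have key: "\<bar>ln (b s) - ln (b t)\<bar> \<le> c + \<epsilon> * \<bar>ln s - ln t\<bar>" if st: "0 < s" "s \<le> t" for s t
  proof -
    have t: "0 < t" using st by simp
    have "s powr \<epsilon> * b s \<le> C * (C * (t powr \<epsilon> * b t))"
    proof -
      have "s powr \<epsilon> * b s \<le> C * g s" using C st by blast
      also have "g s \<le> g t" using g(2) st t by (auto simp: monotone_on_def)
      also have "g t \<le> C * (t powr \<epsilon> * b t)" using C t by blast
      finally show ?thesis using C(1) by simp
    qed
    then have "ln (s powr \<epsilon> * b s) \<le> ln (C * (C * (t powr \<epsilon> * b t)))"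
      using C(1) pos[of s] pos[of t] st t by (subst ln_le_cancel_iff) auto
    then have 1: "\<epsilon> * ln s + ln (b s) \<le> 2 * ln C + \<epsilon> * ln t + ln (b t)"
      using C(1) pos[of s] pos[of t] st t by (simp add: ln_mult ln_powr)
    have "t powr (- \<epsilon>) * b t \<le> D * (D * (s powr (- \<epsilon>) * b s))"
    proof -
      have "t powr (- \<epsilon>) * b t \<le> D * h t" using D t by blast
      also have "h t \<le> h s" using h(2) st t by (auto simp: monotone_on_def)
      also have "h s \<le> D * (s powr (- \<epsilon>) * b s)" using D st by blast
      finally show ?thesis using D(1) by simp
    qed
    then have "ln (t powr (- \<epsilon>) * b t) \<le> ln (D * (D * (s powr (- \<epsilon>) * b s)))"
      using D(1) pos[of s] pos[of t] st t by (subst ln_le_cancel_iff) auto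
    then have 2: "- \<epsilon> * ln t + ln (b t) \<le> 2 * ln D - \<epsilon> * ln s + ln (b s)"
      using D(1) pos[of s] pos[of t] st t by (simp add: ln_mult ln_powr)
    have "\<bar>ln s - ln t\<bar> = ln t - ln s" using st by simp
    then show ?thesis using 1 2 unfolding c_def by (auto simp: algebra_simps max_def)
  qed
  have key': "\<bar>ln (b s) - ln (b t) - 0 * (ln s - ln t)\<bar> \<le> c + \<epsilon> * \<bar>ln s - ln t\<bar>" if "0 < s" "0 < t" for s t
    using key[of s t] key[of t s] that by (cases "s \<le> t") (auto simp: abs_minus_commute)
  show "\<exists>c. \<forall>s t. 0 < s \<longrightarrow> 0 < t \<longrightarrow>
      \<bar>ln (b s) - ln (b t) - 0 * (ln s - ln t)\<bar> \<le> c + \<epsilon> * \<bar>ln s - ln t\<bar>"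
    by (intro exI[of _ c] allI impI key')
qed

lemma rv_le_exp:
  assumes w: "rv \<kappa> w" and e: "0 < \<epsilon>"
  shows "\<exists>C<top. \<forall>s t. 0 < s \<longrightarrow> 0 < t \<longrightarrow>
    ennreal (w s) \<le> C * ennreal (exp (\<kappa> * (ln s - ln t) + \<epsilon> * \<bar>ln s - ln t\<bar>)) * ennreal (w t)"
proof -
  obtain c where c: "\<And>s t. 0 < s \<Longrightarrow> 0 < t \<Longrightarrow>
    \<bar>ln (w s) - ln (w t) - \<kappa> * (ln s - ln t)\<bar> \<le> c + \<epsilon> * \<bar>ln s - ln t\<bar>"
    by (rule rvE[OF assms]) (rule that)
  have "ennreal (w s) \<le> ennreal (exp c) * ennreal (exp (\<kappa> * (ln s - ln t) + \<epsilon> * \<bar>ln s - ln t\<bar>)) * ennreal (w t)"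
    if st: "0 < s" "0 < t" for s t
  proof -
    have "w s = exp (ln (w s))" using rv_pos[OF w st(1)] by simp
    also have "\<dots> \<le> exp (c + (\<kappa> * (ln s - ln t) + \<epsilon> * \<bar>ln s - ln t\<bar>) + ln (w t))"
      using c[OF st] by (subst exp_le_cancel_iff) linarith
    also have "\<dots> = exp c * exp (\<kappa> * (ln s - ln t) + \<epsilon> * \<bar>ln s - ln t\<bar>) * w t"
      using rv_pos[OF w st(2)] by (simp add: exp_add)
    finally show ?thesis
      using rv_pos[OF w] st by (simp add: ennreal_mult[symmetric] ennreal_leI less_imp_le)
  qed
  then show ?thesis by (intro exI[of _ "ennreal (exp c)"]) auto
qed

lemma rv_near:
  assumes w: "rv \<kappa> w"
  shows "\<exists>C<top. \<forall>s t. 0 < s \<longrightarrow> 0 < t \<longrightarrow> \<bar>ln s - ln t\<bar> \<le> 1 \<longrightarrow> ennreal (w s) \<le> C * ennreal (w t)"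
proof -
  obtain C where C: "C < top" "\<And>s t. 0 < s \<Longrightarrow> 0 < t \<Longrightarrow>
    ennreal (w s) \<le> C * ennreal (exp (\<kappa> * (ln s - ln t) + 1 * \<bar>ln s - ln t\<bar>)) * ennreal (w t)"
    using rv_le_exp[OF w zero_less_one] by blast
  have "ennreal (w s) \<le> C * ennreal (exp (\<bar>\<kappa>\<bar> + 1)) * ennreal (w t)"
    if st: "0 < s" "0 < t" "\<bar>ln s - ln t\<bar> \<le> 1" for s t
  proof -
    have "\<kappa> * (ln s - ln t) \<le> \<bar>\<kappa>\<bar> * \<bar>ln s - ln t\<bar>" by (simp add: abs_mult[symmetric])
    also have "\<dots> \<le> \<bar>\<kappa>\<bar> * 1" using st by (intro mult_left_mono) auto
    finally have "exp (\<kappa> * (ln s - ln t) + 1 * \<bar>ln s - ln t\<bar>) \<le> exp (\<bar>\<kappa>\<bar> + 1)" using st(3) by simp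
    then show ?thesis using C(2)[OF st(1,2)]
      by (elim order_trans) (intro mult_left_mono mult_right_mono ennreal_leI, auto)
  qed
  then show ?thesis using C(1) by (intro exI[of _ "C * ennreal (exp (\<bar>\<kappa>\<bar> + 1))"]) (auto simp: ennreal_mult_less_top)
qed

section \<open>Step functions on the blocks from \<open>exp i\<close> to
  \<open>exp (i + 1)\<close>\<close>

abbreviation ex :: "int \<Rightarrow> real" where "ex i \<equiv> exp (real_of_int i)"

lemma floor_ln: "0 < u \<Longrightarrow> \<lfloor>ln u\<rfloor> = i \<longleftrightarrow> ex i \<le> u \<and> u < ex (i + 1)"
  by (simp add: floor_eq_iff) (metis exp_ln exp_le_cancel_iff exp_less_cancel_iff)

lemma ln_near_floor: "\<bar>ln u - ln (ex \<lfloor>ln u\<rfloor>)\<bar> \<le> 1" "\<bar>ln (ex \<lfloor>ln u\<rfloor>) - ln u\<bar> \<le> 1"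
  by (simp_all, linarith+)

text \<open>For finite \<open>q\<close> the factor \<open>exp i\<close> cancels the power
  \<open>u powr (- recip q)\<close> of the norm once this is raised to the power \<open>q\<close>.
  Therefore \<open>wt\<close> below contains only the power \<open>- \<theta>\<close>.\<close>

lemma emeasure_block:
  "emeasure lebesgue {ex i..<ex (i + 1)} = ennreal (exp 1 - 1) * ennreal (ex i)"
  "emeasure lebesgue {ex i<..<ex (i + 1)} = ennreal (exp 1 - 1) * ennreal (ex i)"
  by (simp_all add: ennreal_mult[symmetric] exp_add algebra_simps)

lemma nn_integral_blocks:
  assumes "\<And>i. A i \<in> sets lebesgue"
  shows "(\<integral>\<^sup>+ u. \<integral>\<^sup>+ i. y i * indicator (A i) u \<partial>count_space I \<partial>lebesgue)
     = (\<integral>\<^sup>+ i. y i * emeasure lebesgue (A i) \<partial>count_space (I :: int set))"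
proof -
  have "(\<integral>\<^sup>+ u. \<integral>\<^sup>+ i. y i * indicator (A i) u \<partial>count_space I \<partial>lebesgue)
    = (\<integral>\<^sup>+ i. \<integral>\<^sup>+ u. y i * indicator (A i) u \<partial>lebesgue \<partial>count_space I)"
    using assms by (intro nn_integral_count_space_nn_integral) auto
  then show ?thesis using assms by (simp add: nn_integral_cmult_indicator)
qed

abbreviation wt :: "real \<Rightarrow> (real \<Rightarrow> real) \<Rightarrow> int \<Rightarrow> ennreal" where
  "wt \<theta> w i \<equiv> ennreal (exp (- \<theta> * real_of_int i) * w (ex i))"

lemma wnorm_weight_near:
  assumes "rv \<kappa> w"
  shows "\<exists>C<top. \<forall>u. 0 < u \<longrightarrow>
    ennreal (u powr (- \<theta> - r) * w u) \<le> C * (ennreal (exp (- r * \<lfloor>ln u\<rfloor>)) * wt \<theta> w \<lfloor>ln u\<rfloor>) \<and>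
    ennreal (exp (- r * \<lfloor>ln u\<rfloor>)) * wt \<theta> w \<lfloor>ln u\<rfloor> \<le> C * ennreal (u powr (- \<theta> - r) * w u)"
proof -
  obtain C where C: "C < top" "\<And>s t. 0 < s \<Longrightarrow> 0 < t \<Longrightarrow> \<bar>ln s - ln t\<bar> \<le> 1 \<Longrightarrow>
      ennreal (s powr (- \<theta> - r) * w s) \<le> C * ennreal (t powr (- \<theta> - r) * w t)"
    using rv_near[OF rv_mult[OF rv_power[of "- \<theta> - r"] assms]] by blast
  have eq: "ennreal (ex i powr (- \<theta> - r) * w (ex i)) = ennreal (exp (- r * i)) * wt \<theta> w i" for i
    using rv_pos[OF assms, of "ex i"]
    by (subst ennreal_mult[symmetric]) (auto simp: powr_def exp_add[symmetric] algebra_simps)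
  show ?thesis
    unfolding eq[symmetric] by (intro exI[of _ C] conjI allI impI C ln_near_floor exp_gt_zero)
qed

text \<open>The integrand is dominated by a step function, and the monotonicity of the integral
  holds for an arbitrary \<open>g\<close>. The set \<open>I\<close> has to contain the index of
  every block that meets \<open>S\<close>.\<close>

lemma wnorm_le_lq:
  assumes w: "rv \<kappa> w" and q: "0 < q"
  shows "\<exists>C<top. \<forall>S I g G. S \<in> sets lebesgue \<longrightarrow>
     (\<forall>u\<in>S. 0 < u \<and> \<lfloor>ln u\<rfloor> \<in> I \<and> g u \<le> G \<lfloor>ln u\<rfloor>) \<longrightarrow>
     wnorm \<theta> q w S g \<le> C * lq q I (\<lambda>i. wt \<theta> w i * G i)"
proof -
  obtain C where C: "C < top" "\<And>u. 0 < u \<Longrightarrow> ennreal (u powr (- \<theta> - recip q) * w u)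
      \<le> C * (ennreal (exp (- recip q * \<lfloor>ln u\<rfloor>)) * wt \<theta> w \<lfloor>ln u\<rfloor>)"
    using wnorm_weight_near[OF w] by blast
  have le: "ennreal (u powr (- \<theta> - recip q) * w u) * g u
      \<le> C * (ennreal (exp (- recip q * \<lfloor>ln u\<rfloor>)) * (wt \<theta> w \<lfloor>ln u\<rfloor> * G \<lfloor>ln u\<rfloor>))"
    if "0 < u" "g u \<le> G \<lfloor>ln u\<rfloor>" for u g and G :: "int \<Rightarrow> ennreal"
    using mult_mono[OF C(2)[OF that(1)] that(2)] by (simp add: mult.assoc)
  show ?thesis using q
  proof (cases rule: exponent_cases)
    case 1
    have "wnorm \<theta> q w S g \<le> C * lq q I (\<lambda>i. wt \<theta> w i * G i)"
      if S: "S \<in> sets lebesgue" "\<And>u. u \<in> S \<Longrightarrow> 0 < u \<and> \<lfloor>ln u\<rfloor> \<in> I \<and> g u \<le> G \<lfloor>ln u\<rfloor>" for S I g G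
    proof -
      have "AE u in lebesgue_on S. ennreal (u powr (- \<theta> - recip q) * w u) * g u
          \<le> C * lq q I (\<lambda>i. wt \<theta> w i * G i)"
      proof (rule AE_I2)
        fix u assume "u \<in> space (lebesgue_on S)"
        then have u: "u \<in> S" by simp
        have "wt \<theta> w \<lfloor>ln u\<rfloor> * G \<lfloor>ln u\<rfloor> \<le> lq q I (\<lambda>i. wt \<theta> w i * G i)"
          using S(2)[OF u] q by (intro lq_single) auto
        then show "ennreal (u powr (- \<theta> - recip q) * w u) * g u \<le> C * lq q I (\<lambda>i. wt \<theta> w i * G i)"
          using order_trans[OF le[of u g G] mult_left_mono] S(2)[OF u] 1 by simp
      qed
      then show ?thesis unfolding wnorm_def Lq_norm_def using 1 by (auto intro: Inf_lower)
    qed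
    with C(1) show ?thesis by blast
  next
    case 2
    define p where "p = enn2real q"
    have p: "0 < p" "recip q = 1 / p" using 2 by (auto simp: p_def)
    define D where "D = ennpow C p * ennreal (exp 1 - 1)"
    have "wnorm \<theta> q w S g \<le> ennpow D (recip q) * lq q I (\<lambda>i. wt \<theta> w i * G i)"
      if S: "S \<in> sets lebesgue" "\<And>u. u \<in> S \<Longrightarrow> 0 < u \<and> \<lfloor>ln u\<rfloor> \<in> I \<and> g u \<le> G \<lfloor>ln u\<rfloor>" for S I g G
    proof -
      \<comment> \<open>Value of the dominating step function on block \<open>i\<close>;
        \<open>exp (- i)\<close> comes from \<open>u powr (- recip q)\<close> raised to the power
        \<open>q\<close>.\<close>
      define y where "y = (\<lambda>i. ennpow C p * (ennreal (exp (- real_of_int i)) * ennpow (wt \<theta> w i * G i) p))"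
      have "(\<integral>\<^sup>+ u. ennpow (ennreal (u powr (- \<theta> - recip q) * w u) * g u) p \<partial>lebesgue_on S)
        = (\<integral>\<^sup>+ u. ennpow (ennreal (u powr (- \<theta> - recip q) * w u) * g u) p * indicator S u \<partial>lebesgue)"
        using S by (simp add: nn_integral_restrict_space)
      also have "\<dots> \<le> (\<integral>\<^sup>+ u. \<integral>\<^sup>+ i. y i * indicator {ex i..<ex (i + 1)} u \<partial>count_space I \<partial>lebesgue)"
      proof (rule nn_integral_mono)
        fix u
        show "ennpow (ennreal (u powr (- \<theta> - recip q) * w u) * g u) p * indicator S u
           \<le> (\<integral>\<^sup>+ i. y i * indicator {ex i..<ex (i + 1)} u \<partial>count_space I)"
        proof (cases "u \<in> S")
          case True
          let ?i = "\<lfloor>ln u\<rfloor>"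
          have u: "0 < u" "?i \<in> I" "g u \<le> G ?i" using S True by auto
          have "ennpow (ennreal (u powr (- \<theta> - recip q) * w u) * g u) p
             \<le> ennpow (C * (ennreal (exp (- recip q * ?i)) * (wt \<theta> w ?i * G ?i))) p"
            using u p by (intro ennpow_mono le) auto
          also have "\<dots> = ennpow C p * (ennreal (exp (- recip q * ?i) powr p) * ennpow (wt \<theta> w ?i * G ?i) p)"
            using p by (simp add: ennpow_mult ennpow_ennreal)
          also have "\<dots> = y ?i"
            using p by (simp add: y_def powr_def)
          also have "\<dots> = y ?i * indicator {ex ?i..<ex (?i + 1)} u"
            using floor_ln[OF u(1), of ?i] by simp
          also have "\<dots> \<le> (\<integral>\<^sup>+ i. y i * indicator {ex i..<ex (i + 1)} u \<partial>count_space I)"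
            by (rule nn_integral_ge_point[OF u(2)])
          finally show ?thesis using True by simp
        qed simp
      qed
      also have "\<dots> = (\<integral>\<^sup>+ i. y i * (ennreal (exp 1 - 1) * ennreal (ex i)) \<partial>count_space I)"
        by (subst nn_integral_blocks) (simp_all only: emeasure_block, simp)
      also have "\<dots> = (\<integral>\<^sup>+ i. D * ennpow (wt \<theta> w i * G i) p \<partial>count_space I)"
      proof (rule nn_integral_cong)
        fix i
        have "ennreal (exp (- real_of_int i)) * ennreal (ex i) = 1"
          by (simp add: ennreal_mult[symmetric] exp_minus)
        moreover have "y i * (ennreal (exp 1 - 1) * ennreal (ex i))
          = D * ennpow (wt \<theta> w i * G i) p * (ennreal (exp (- real_of_int i)) * ennreal (ex i))"
          unfolding y_def D_def by (simp only: ac_simps)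
        ultimately show "y i * (ennreal (exp 1 - 1) * ennreal (ex i)) = D * ennpow (wt \<theta> w i * G i) p"
          by simp
      qed
      also have "\<dots> = D * (\<integral>\<^sup>+ i. ennpow (wt \<theta> w i * G i) p \<partial>count_space I)"
        by (rule nn_integral_cmult) simp
      finally have "ennpow (\<integral>\<^sup>+ u. ennpow (ennreal (u powr (- \<theta> - recip q) * w u) * g u) p \<partial>lebesgue_on S) (recip q)
         \<le> ennpow (D * (\<integral>\<^sup>+ i. ennpow (wt \<theta> w i * G i) p \<partial>count_space I)) (recip q)"
        using 2 by (intro ennpow_mono) auto
      then show ?thesis using 2 by (simp add: wnorm_def Lq_norm_def lq_def ennpow_mult p_def)
    qed
    moreover have "ennpow D (recip q) < top" using C(1) by (simp add: D_def ennreal_mult_less_top)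
    ultimately show ?thesis by blast
  qed
qed

text \<open>Now \<open>I\<close> may contain only blocks inside \<open>S\<close>. Open blocks are
  used because the sets of integration are open intervals. The inequality between the weights is
  inverted by a factor \<open>c\<close> with \<open>c * C = 1\<close>, since extended numbers cannot
  be cancelled freely.\<close>

lemma lq_le_wnorm:
  assumes w: "rv \<kappa> w" and q: "0 < q"
  shows "\<exists>C<top. \<forall>S I g G. S \<in> sets lebesgue \<longrightarrow>
     (\<forall>i\<in>I. \<forall>u. ex i < u \<longrightarrow> u < ex (i + 1) \<longrightarrow> u \<in> S \<and> G i \<le> g u) \<longrightarrow>
     lq q I (\<lambda>i. wt \<theta> w i * G i) \<le> C * wnorm \<theta> q w S g"
proof -
  obtain C0 where C0: "C0 < top" "\<And>u. 0 < u \<Longrightarrow> ennreal (exp (- recip q * \<lfloor>ln u\<rfloor>)) * wt \<theta> w \<lfloor>ln u\<rfloor>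
      \<le> C0 * ennreal (u powr (- \<theta> - recip q) * w u)"
    using wnorm_weight_near[OF w] by blast
  \<comment> \<open>The summand 1 makes the constant invertible even if \<open>C0\<close>
    vanishes.\<close>
  define C where "C = ennreal (enn2real C0 + 1)"
  define c where "c = ennreal (1 / (enn2real C0 + 1))"
  have "C0 = ennreal (enn2real C0)" using C0(1) by simp
  then have C: "C0 \<le> C" "C < top"
    unfolding C_def by (metis ennreal_leI le_add_same_cancel1 zero_le_one, simp only: ennreal_less_top)
  have cC: "c * C = 1"
    unfolding C_def c_def by (subst ennreal_mult[symmetric]) (auto simp: add_nonneg_eq_0_iff)
  have le: "ennreal (exp (- recip q * i)) * (c * (wt \<theta> w i * G i))
      \<le> ennreal (u powr (- \<theta> - recip q) * w u) * g u"
    if "ex i < u" "u < ex (i + 1)" "G i \<le> g u" for u g i and G :: "int \<Rightarrow> ennreal"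
  proof -
    have u: "0 < u" using that(1) exp_gt_zero less_trans by blast
    then have i: "\<lfloor>ln u\<rfloor> = i" using floor_ln that by auto
    have "ennreal (exp (- recip q * i)) * wt \<theta> w i \<le> C * ennreal (u powr (- \<theta> - recip q) * w u)"
      using order_trans[OF C0(2)[OF u] mult_right_mono[OF C(1)]] i by simp
    then have "c * (ennreal (exp (- recip q * i)) * wt \<theta> w i) \<le> c * (C * ennreal (u powr (- \<theta> - recip q) * w u))"
      by (rule mult_left_mono) simp
    also have "\<dots> = ennreal (u powr (- \<theta> - recip q) * w u)"
      using cC by (simp add: mult.assoc[symmetric])
    finally have "c * (ennreal (exp (- recip q * i)) * wt \<theta> w i) * G i \<le> ennreal (u powr (- \<theta> - recip q) * w u) * g u"
      using that(3) by (rule mult_mono) auto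
    then show ?thesis by (simp only: mult.assoc mult.left_commute)
  qed
  have e1: "1 \<le> exp 1 - (1::real)" using exp_ge_add_one_self[of "1::real"] by simp
  have main: "lq q I (\<lambda>i. c * (wt \<theta> w i * G i)) \<le> wnorm \<theta> q w S g"
    if S: "S \<in> sets lebesgue" "\<And>i u. i \<in> I \<Longrightarrow> ex i < u \<Longrightarrow> u < ex (i + 1) \<Longrightarrow> u \<in> S \<and> G i \<le> g u" for S I g G
    using q
  proof (cases rule: exponent_cases)
    case 1
    have "lq q I (\<lambda>i. c * (wt \<theta> w i * G i)) \<le> b"
      if b: "AE u in lebesgue_on S. ennreal (u powr (- \<theta> - recip q) * w u) * g u \<le> b" for b
    proof -
      have b': "AE u in lebesgue. u \<in> S \<longrightarrow> ennreal (u powr (- \<theta> - recip q) * w u) * g u \<le> b"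
        using b S(1) by (subst (asm) AE_restrict_space_iff) auto
      have "c * (wt \<theta> w i * G i) \<le> b" if i: "i \<in> I" for i
      proof -
        \<comment> \<open>A bound that holds almost everywhere holds at some point of the block,
          because the block has positive measure.\<close>
        have "\<exists>u. ex i < u \<and> u < ex (i + 1) \<and> ennreal (u powr (- \<theta> - recip q) * w u) * g u \<le> b"
        proof (rule ccontr)
          assume no: "\<nexists>u. ex i < u \<and> u < ex (i + 1) \<and> ennreal (u powr (- \<theta> - recip q) * w u) * g u \<le> b"
          have "AE u in lebesgue. u \<notin> {ex i<..<ex (i + 1)}"
            using b' by eventually_elim (use no S(2)[OF i] in auto)
          then have "emeasure lebesgue {ex i<..<ex (i + 1)} = 0"
            by (subst (asm) AE_iff_measurable[of "{ex i<..<ex (i + 1)}"]) auto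
          moreover have "0 < (exp 1 - 1) * ex i" using e1 by (intro mult_pos_pos) auto
          ultimately show False using e1
            by (simp only: emeasure_block) (simp add: ennreal_mult[symmetric] del: exp_gt_one)
        qed
        then obtain u where u: "ex i < u" "u < ex (i + 1)" "ennreal (u powr (- \<theta> - recip q) * w u) * g u \<le> b"
          by blast
        then show ?thesis using le[OF u(1,2), of G g] S(2)[OF i u(1,2)] 1 by simp
      qed
      then show ?thesis using 1 by (auto simp: lq_def intro: SUP_least)
    qed
    then show ?thesis
      unfolding wnorm_def Lq_norm_def using 1 by (auto intro: Inf_greatest)
  next
    case 2
    define p where "p = enn2real q"
    have p: "0 < p" "recip q = 1 / p" using 2 by (auto simp: p_def)
    define x where "x = (\<lambda>i. c * (wt \<theta> w i * G i))"
    define y where "y = (\<lambda>i. ennreal (exp (- real_of_int i)) * ennpow (x i) p)"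
    let ?F = "\<lambda>u. ennpow (ennreal (u powr (- \<theta> - recip q) * w u) * g u) p"
    have "(\<integral>\<^sup>+ i. ennpow (x i) p \<partial>count_space I)
      \<le> (\<integral>\<^sup>+ i. y i * (ennreal (exp 1 - 1) * ennreal (ex i)) \<partial>count_space I)"
    proof (rule nn_integral_mono)
      fix i
      have "1 \<le> ennreal (exp 1 - 1)" using e1 by (subst ennreal_1[symmetric], intro ennreal_leI)
      then have "1 * ennpow (x i) p \<le> ennreal (exp 1 - 1) * ennpow (x i) p"
        by (rule mult_right_mono) simp
      moreover have "ennreal (exp (- real_of_int i)) * ennreal (ex i) = 1"
        by (simp add: ennreal_mult[symmetric] exp_minus)
      moreover have "y i * (ennreal (exp 1 - 1) * ennreal (ex i))
          = ennreal (exp 1 - 1) * ennpow (x i) p * (ennreal (exp (- real_of_int i)) * ennreal (ex i))"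
        unfolding y_def by (simp only: ac_simps)
      ultimately show "ennpow (x i) p \<le> y i * (ennreal (exp 1 - 1) * ennreal (ex i))" by simp
    qed
    also have "\<dots> = (\<integral>\<^sup>+ u. \<integral>\<^sup>+ i. y i * indicator {ex i<..<ex (i + 1)} u \<partial>count_space I \<partial>lebesgue)"
      by (subst nn_integral_blocks) (simp_all only: emeasure_block, simp)
    also have "\<dots> \<le> (\<integral>\<^sup>+ u. ?F u * indicator S u \<partial>lebesgue)"
    proof (rule nn_integral_mono)
      fix u
      show "(\<integral>\<^sup>+ i. y i * indicator {ex i<..<ex (i + 1)} u \<partial>count_space I) \<le> ?F u * indicator S u"
      proof (cases "\<exists>i\<in>I. ex i < u \<and> u < ex (i + 1)")
        case True
        then obtain i where i: "i \<in> I" "ex i < u" "u < ex (i + 1)" by blast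
        have u: "0 < u" using i(2) exp_gt_zero less_trans by blast
        have "(\<integral>\<^sup>+ j. y j * indicator {ex j<..<ex (j + 1)} u \<partial>count_space I)
          \<le> (\<integral>\<^sup>+ j. y i * indicator {i} j \<partial>count_space I)"
        proof (rule nn_integral_mono)
          fix j
          have "j = i" if "ex j < u" "u < ex (j + 1)"
            using floor_ln[OF u, of i] floor_ln[OF u, of j] i that by auto
          then show "y j * indicator {ex j<..<ex (j + 1)} u \<le> y i * indicator {i} j"
            by (cases "ex j < u \<and> u < ex (j + 1)") (use i in simp_all)
        qed
        also have "\<dots> \<le> y i"
          using i(1) by (subst nn_integral_cmult_indicator) auto
        also have "y i = ennpow (ennreal (exp (- recip q * i)) * x i) p"
          using p by (simp add: y_def ennpow_mult ennpow_ennreal powr_def)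
        also have "\<dots> \<le> ?F u"
          using p S(2)[OF i] unfolding x_def by (intro ennpow_mono le i) auto
        finally show ?thesis using S(2)[OF i] by simp
      next
        case False
        then have "(\<integral>\<^sup>+ i. y i * indicator {ex i<..<ex (i + 1)} u \<partial>count_space I) = (\<integral>\<^sup>+ i. 0 \<partial>count_space I)"
          by (intro nn_integral_cong) auto
        then show ?thesis by simp
      qed
    qed
    finally have "ennpow (\<integral>\<^sup>+ i. ennpow (x i) p \<partial>count_space I) (recip q)
      \<le> ennpow (\<integral>\<^sup>+ u. ?F u \<partial>lebesgue_on S) (recip q)"
      using 2 S by (intro ennpow_mono) (auto simp: nn_integral_restrict_space)
    then show ?thesis
      using 2 by (simp add: wnorm_def Lq_norm_def lq_def p_def x_def)
  qed
  show ?thesis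
  proof (intro exI[of _ C] conjI allI impI)
    fix S I g and G :: "int \<Rightarrow> ennreal"
    assume S: "S \<in> sets lebesgue"
      "\<forall>i\<in>I. \<forall>u. ex i < u \<longrightarrow> u < ex (i + 1) \<longrightarrow> u \<in> S \<and> G i \<le> g u"
    have "c * lq q I (\<lambda>i. wt \<theta> w i * G i) \<le> wnorm \<theta> q w S g"
    proof -
      have "lq q I (\<lambda>i. c * (wt \<theta> w i * G i)) \<le> wnorm \<theta> q w S g"
        by (rule main) (use S in blast)+
      then show ?thesis using q by (simp add: lq_cmult)
    qed
    then have "C * (c * lq q I (\<lambda>i. wt \<theta> w i * G i)) \<le> C * wnorm \<theta> q w S g"
      by (rule mult_left_mono) simp
    moreover have "C * (c * lq q I (\<lambda>i. wt \<theta> w i * G i)) = lq q I (\<lambda>i. wt \<theta> w i * G i)"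
      using cC by (simp add: mult.assoc[symmetric] mult.commute[of C c])
    ultimately show "lq q I (\<lambda>i. wt \<theta> w i * G i) \<le> C * wnorm \<theta> q w S g" by simp
  qed (rule C(2))
qed

lemma ennreal_recip:
  assumes "K < top" shows "\<exists>c. c * (K + 1) = (1::ennreal)"
proof -
  have "K = ennreal (enn2real K)" using assms by simp
  then have "K + 1 = ennreal (enn2real K + 1)" by (metis ennreal_1 ennreal_plus enn2real_nonneg zero_le_one)
  then have "ennreal (1 / (enn2real K + 1)) * (K + 1) = 1"
    by (simp only:) (subst ennreal_mult[symmetric], auto simp: add_nonneg_eq_0_iff)
  then show ?thesis by blast
qed

text \<open>The doubling property supplies a minorant only up to a factor \<open>K\<close>. This
  factor is taken out of \<open>G\<close> by means of a reciprocal of \<open>K + 1\<close>.\<close>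

lemma lq_le_wnorm_mult:
  assumes w: "rv \<kappa> w" and q: "0 < q" and K: "K < top"
  shows "\<exists>C<top. \<forall>S I g G. S \<in> sets lebesgue \<longrightarrow>
     (\<forall>i\<in>I. \<forall>u. ex i < u \<longrightarrow> u < ex (i + 1) \<longrightarrow> u \<in> S \<and> G i \<le> K * g u) \<longrightarrow>
     lq q I (\<lambda>i. wt \<theta> w i * G i) \<le> C * wnorm \<theta> q w S g"
proof -
  obtain c where c: "c * (K + 1) = 1" using ennreal_recip[OF K] by blast
  obtain C where C: "C < top" "\<And>S I g G. S \<in> sets lebesgue \<Longrightarrow>
     (\<forall>i\<in>I. \<forall>u. ex i < u \<longrightarrow> u < ex (i + 1) \<longrightarrow> u \<in> S \<and> G i \<le> g u) \<Longrightarrow>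
     lq q I (\<lambda>i. wt \<theta> w i * G i) \<le> C * wnorm \<theta> q w S g"
    using lq_le_wnorm[OF w q, of \<theta>] by blast
  show ?thesis
  proof (intro exI[of _ "(K + 1) * C"] conjI allI impI)
    show "(K + 1) * C < top" using K C(1) by (simp add: ennreal_mult_less_top)
    fix S I g and G :: "int \<Rightarrow> ennreal"
    assume S: "S \<in> sets lebesgue" "\<forall>i\<in>I. \<forall>u. ex i < u \<longrightarrow> u < ex (i + 1) \<longrightarrow> u \<in> S \<and> G i \<le> K * g u"
    have "lq q I (\<lambda>i. wt \<theta> w i * (c * G i)) \<le> C * wnorm \<theta> q w S g"
    proof (rule C(2)[OF S(1)], intro ballI allI impI conjI)
      fix i u assume iu: "i \<in> I" "ex i < u" "u < ex (i + 1)"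
      then show "u \<in> S" using S(2) by blast
      have "G i \<le> K * g u" using S(2) iu by blast
      also have "\<dots> \<le> (K + 1) * g u" by (intro mult_right_mono) auto
      finally have "c * G i \<le> c * ((K + 1) * g u)" by (rule mult_left_mono) simp
      then show "c * G i \<le> g u" using c by (simp add: mult.assoc[symmetric])
    qed
    then have "c * lq q I (\<lambda>i. wt \<theta> w i * G i) \<le> C * wnorm \<theta> q w S g"
      using q by (simp add: lq_cmult[symmetric] mult.left_commute)
    then have "(K + 1) * (c * lq q I (\<lambda>i. wt \<theta> w i * G i)) \<le> (K + 1) * (C * wnorm \<theta> q w S g)"
      by (rule mult_left_mono) simp
    moreover have "(K + 1) * (c * lq q I (\<lambda>i. wt \<theta> w i * G i)) = lq q I (\<lambda>i. wt \<theta> w i * G i)"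
      using c by (simp add: mult.assoc[symmetric] mult.commute[of "K + 1" c])
    ultimately show "lq q I (\<lambda>i. wt \<theta> w i * G i) \<le> (K + 1) * C * wnorm \<theta> q w S g"
      by (simp add: mult.assoc)
  qed
qed

subsection \<open>Doubling families and discretisation\<close>

text \<open>Doubling in the logarithmic variable, with one constant for the whole family. An
  infinite value at one positive point forces infinite values at all of them, so nothing has to be
  assumed finite.\<close>

definition reg :: "('p \<Rightarrow> real \<Rightarrow> ennreal) \<Rightarrow> bool" where
  "reg F \<longleftrightarrow> (\<exists>C<top. \<forall>p s t. 0 < s \<longrightarrow> 0 < t \<longrightarrow> \<bar>ln s - ln t\<bar> \<le> 1 \<longrightarrow> F p s \<le> C * F p t)"

definition sreg :: "('p \<Rightarrow> int \<Rightarrow> ennreal) \<Rightarrow> bool" where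
  "sreg x \<longleftrightarrow> (\<exists>C<top. \<forall>p i j. \<bar>i - j\<bar> \<le> 1 \<longrightarrow> x p i \<le> C * x p j)"

lemma regI:
  assumes "C < top" "\<And>p s t. 0 < s \<Longrightarrow> 0 < t \<Longrightarrow> \<bar>ln s - ln t\<bar> \<le> 1 \<Longrightarrow> F p s \<le> C * F p t"
  shows "reg F"
  using assms unfolding reg_def by (intro exI[of _ C]) simp

lemma regE:
  assumes "reg F"
  obtains C where "C < top" "\<And>p s t. 0 < s \<Longrightarrow> 0 < t \<Longrightarrow> \<bar>ln s - ln t\<bar> \<le> 1 \<Longrightarrow> F p s \<le> C * F p t"
proof -
  obtain C where "C < top \<and> (\<forall>p s t. 0 < s \<longrightarrow> 0 < t \<longrightarrow> \<bar>ln s - ln t\<bar> \<le> 1 \<longrightarrow> F p s \<le> C * F p t)"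
    using assms unfolding reg_def by (elim exE)
  then show thesis by (intro that[of C]) simp_all
qed

lemma sregE:
  assumes "sreg x" obtains C where "C < top" "\<And>p i j. \<bar>i - j\<bar> \<le> 1 \<Longrightarrow> x p i \<le> C * x p j"
  using assms unfolding sreg_def by blast

lemma reg_1 [simp]: "reg (\<lambda>_ _. 1)"
  by (rule regI[of 1]) auto

lemma reg_rv: "rv \<kappa> w \<Longrightarrow> reg (\<lambda>_ t. ennreal (w t))"
proof -
  assume "rv \<kappa> w"
  then obtain C where "C < top" "\<And>s t. 0 < s \<Longrightarrow> 0 < t \<Longrightarrow> \<bar>ln s - ln t\<bar> \<le> 1 \<Longrightarrow> ennreal (w s) \<le> C * ennreal (w t)"
    using rv_near by blast
  then show ?thesis by (rule regI)
qed

lemma reg_mult: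
  assumes "reg F" "reg G" shows "reg (\<lambda>p t. F p t * G p t)"
proof -
  obtain C where C: "C < top" "\<And>p s t. 0 < s \<Longrightarrow> 0 < t \<Longrightarrow> \<bar>ln s - ln t\<bar> \<le> 1 \<Longrightarrow> F p s \<le> C * F p t"
    using assms(1) by (rule regE) (rule that)
  obtain D where D: "D < top" "\<And>p s t. 0 < s \<Longrightarrow> 0 < t \<Longrightarrow> \<bar>ln s - ln t\<bar> \<le> 1 \<Longrightarrow> G p s \<le> D * G p t"
    using assms(2) by (rule regE) (rule that)
  show ?thesis
  proof (rule regI)
    show "C * D < top" using C D by (simp add: ennreal_mult_less_top)
    fix p and s t :: real assume st: "0 < s" "0 < t" "\<bar>ln s - ln t\<bar> \<le> 1"
    have "F p s * G p s \<le> (C * F p t) * (D * G p t)"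
      by (intro mult_mono C D st) auto
    then show "F p s * G p s \<le> C * D * (F p t * G p t)" by (simp add: ac_simps)
  qed
qed

lemma sreg_reg:
  assumes "reg F" shows "sreg (\<lambda>p i. F p (ex i))"
proof -
  obtain C where C: "C < top" "\<And>p s t. 0 < s \<Longrightarrow> 0 < t \<Longrightarrow> \<bar>ln s - ln t\<bar> \<le> 1 \<Longrightarrow> F p s \<le> C * F p t"
    using assms by (rule regE) (rule that)
  have "F p (ex i) \<le> C * F p (ex j)" if "\<bar>i - j\<bar> \<le> 1" for p i j
    by (rule C(2)) (use that in auto)
  with C(1) show ?thesis unfolding sreg_def by blast
qed

lemma reg_iter:
  assumes "reg F"
  shows "\<exists>C<top. \<forall>p s t. 0 < s \<longrightarrow> 0 < t \<longrightarrow> \<bar>ln s - ln t\<bar> \<le> real n \<longrightarrow> F p s \<le> C * F p t"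
proof -
  obtain C where C: "C < top" "\<And>p s t. 0 < s \<Longrightarrow> 0 < t \<Longrightarrow> \<bar>ln s - ln t\<bar> \<le> 1 \<Longrightarrow> F p s \<le> C * F p t"
    using assms by (rule regE) (rule that)
  have "F p s \<le> C ^ Suc n * F p t" if "0 < s" "0 < t" "\<bar>ln s - ln t\<bar> \<le> real n" for p s t
    using that
  proof (induction n arbitrary: s)
    case 0
    then show ?case using C(2)[of s t p] by simp
  next
    case (Suc n)
    \<comment> \<open>The point nearest to \<open>s\<close> on the logarithmic scale among those at
      distance at most \<open>n\<close> from \<open>t\<close>.\<close>
    define s' where "s' = exp (ln t + (if \<bar>ln s - ln t\<bar> \<le> real n then ln s - ln t else if ln t \<le> ln s then real n else - real n))"
    have 1: "\<bar>ln s - ln s'\<bar> \<le> 1" "\<bar>ln s' - ln t\<bar> \<le> real n" "0 < s'"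
      using Suc.prems unfolding s'_def by auto
    have "F p s \<le> C * F p s'" using C(2)[OF _ _ 1(1)] Suc.prems 1 by blast
    also have "\<dots> \<le> C * (C ^ Suc n * F p t)" using Suc.IH[of s'] Suc.prems 1 by (intro mult_left_mono) auto
    finally show ?case by (simp add: mult.assoc)
  qed
  moreover have "C ^ Suc n < top" using C(1) by (simp add: ennreal_mult_less_top power_less_top_ennreal)
  ultimately show ?thesis by (intro exI[of _ "C ^ Suc n"]) simp
qed

lemma lq_shift:
  assumes "0 < q"
  shows "\<exists>C<top. \<forall>I J n x c. (\<forall>i\<in>I. i - n \<in> J \<and> x i \<le> c * x (i - n)) \<longrightarrow> lq q I x \<le> C * (c * lq q J x)"
proof -
  obtain C where C: "C < top" "\<And>I J x y \<phi>. \<phi> ` I \<subseteq> J \<Longrightarrow> inj_on \<phi> I \<Longrightarrow>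
     (\<forall>i\<in>I. x i \<le> y (\<phi> i)) \<Longrightarrow> lq q I x \<le> C * lq q J y"
    using lq_inj[OF assms] by blast
  have "lq q I x \<le> C * lq q J (\<lambda>i. c * x i)" if "\<forall>i\<in>I. i - n \<in> J \<and> x i \<le> c * x (i - n)" for I J n x c
    by (rule C(2)[of "\<lambda>i. i - n"]) (use that in \<open>auto intro: inj_onI\<close>)
  with C(1) show ?thesis using assms by (intro exI[of _ C]) (simp add: lq_cmult)
qed

text \<open>Moving the index set by one block costs only the doubling constant. This repairs the
  blocks that a cut-off divides.\<close>

lemma lq_sreg_shift:
  assumes "0 < q" "sreg x" "\<bar>n\<bar> \<le> 1" "\<And>k i. i \<in> I k \<Longrightarrow> i - n \<in> J k"
  shows "(\<lambda>p k. lq q (I k) (x p)) \<lessapprox> (\<lambda>p k. lq q (J k) (x p))"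
proof -
  obtain C where C: "C < top" "\<And>I J n x c. (\<forall>i\<in>I. i - n \<in> J \<and> x i \<le> c * x (i - n)) \<Longrightarrow> lq q I x \<le> C * (c * lq q J x)"
    using lq_shift[OF assms(1)] by blast
  obtain D where D: "D < top" "\<And>p i j. \<bar>i - j\<bar> \<le> 1 \<Longrightarrow> x p i \<le> D * x p j"
    using assms(2) by (rule sregE) (rule that)
  show ?thesis
  proof (rule lesI)
    show "C * D < top" using C(1) D(1) by (simp add: ennreal_mult_less_top)
    have "lq q (I k) (x p) \<le> C * (D * lq q (J k) (x p))" for p k
      by (rule C(2)[of _ n]) (use assms(3,4) D(2) in auto)
    then show "lq q (I k) (x p) \<le> C * D * lq q (J k) (x p)" for p k by (simp add: mult.assoc)
  qed
qed

lemma wnorm_les_lq: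
  assumes w: "rv \<kappa> w" and q: "0 < q" and F: "reg F"
    and S: "\<And>k. S k \<in> sets lebesgue" "\<And>k u. u \<in> S k \<Longrightarrow> 0 < u \<and> \<lfloor>ln u\<rfloor> \<in> I k"
  shows "(\<lambda>p k. wnorm \<theta> q w (S k) (F p)) \<lessapprox> (\<lambda>p k. lq q (I k) (\<lambda>i. wt \<theta> w i * F p (ex i)))"
proof -
  obtain C where C: "C < top" "\<And>S I g G. S \<in> sets lebesgue \<Longrightarrow>
     (\<forall>u\<in>S. 0 < u \<and> \<lfloor>ln u\<rfloor> \<in> I \<and> g u \<le> G \<lfloor>ln u\<rfloor>) \<Longrightarrow>
     wnorm \<theta> q w S g \<le> C * lq q I (\<lambda>i. wt \<theta> w i * G i)"
    using wnorm_le_lq[OF w q, of \<theta>] by blast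
  obtain D where D: "D < top" "\<And>p s t. 0 < s \<Longrightarrow> 0 < t \<Longrightarrow> \<bar>ln s - ln t\<bar> \<le> 1 \<Longrightarrow> F p s \<le> D * F p t"
    using F by (rule regE) (rule that)
  show ?thesis
  proof (rule lesI)
    show "C * D < top" using C(1) D(1) by (simp add: ennreal_mult_less_top)
    fix p k
    have "wnorm \<theta> q w (S k) (F p) \<le> C * lq q (I k) (\<lambda>i. wt \<theta> w i * (D * F p (ex i)))"
      by (rule C(2)[OF S(1)], intro ballI conjI D(2) ln_near_floor exp_gt_zero) (use S(2) in auto)
    then show "wnorm \<theta> q w (S k) (F p) \<le> C * D * lq q (I k) (\<lambda>i. wt \<theta> w i * F p (ex i))"
      using q by (simp add: lq_cmult mult.left_commute[of _ D] mult.assoc)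
  qed
qed

lemma lq_les_wnorm:
  assumes w: "rv \<kappa> w" and q: "0 < q" and F: "reg F"
    and S: "\<And>k. S k \<in> sets lebesgue" "\<And>k i u. i \<in> I k \<Longrightarrow> ex i < u \<Longrightarrow> u < ex (i + 1) \<Longrightarrow> u \<in> S k"
  shows "(\<lambda>p k. lq q (I k) (\<lambda>i. wt \<theta> w i * F p (ex i))) \<lessapprox> (\<lambda>p k. wnorm \<theta> q w (S k) (F p))"
proof -
  obtain D where D: "D < top" "\<And>p s t. 0 < s \<Longrightarrow> 0 < t \<Longrightarrow> \<bar>ln s - ln t\<bar> \<le> 1 \<Longrightarrow> F p s \<le> D * F p t"
    using F by (rule regE) (rule that)
  obtain C where C: "C < top" "\<And>S I g G. S \<in> sets lebesgue \<Longrightarrow>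
     (\<forall>i\<in>I. \<forall>u. ex i < u \<longrightarrow> u < ex (i + 1) \<longrightarrow> u \<in> S \<and> G i \<le> D * g u) \<Longrightarrow>
     lq q I (\<lambda>i. wt \<theta> w i * G i) \<le> C * wnorm \<theta> q w S g"
    using lq_le_wnorm_mult[OF w q D(1), of \<theta>] by blast
  have "F p (ex i) \<le> D * F p u" if "ex i < u" "u < ex (i + 1)" for p i u
  proof (rule D(2))
    show u: "0 < u" using that(1) exp_gt_zero less_trans by blast
    then have "\<lfloor>ln u\<rfloor> = i" using floor_ln that by auto
    then show "\<bar>ln (ex i) - ln u\<bar> \<le> 1" using ln_near_floor(2)[of u] by simp
  qed simp
  then show ?thesis
    by (intro lesI[OF C(1)] C(2) S(1)) (use S(2) in blast)
qed

lemma les_pre: "F \<lessapprox> G \<Longrightarrow> (\<lambda>p k. F (h p k) (m p k)) \<lessapprox> (\<lambda>p k. G (h p k) (m p k))"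
  unfolding les_def by blast

lemma floor_ln_less:
  fixes u y :: real
  assumes "0 < u" shows "u < exp y \<Longrightarrow> \<lfloor>ln u\<rfloor> \<le> \<lfloor>y\<rfloor>" "exp y < u \<Longrightarrow> \<lfloor>y\<rfloor> \<le> \<lfloor>ln u\<rfloor>"
proof -
  have "u = exp (ln u)" using exp_ln[OF assms] by (rule sym)
  then have "u < exp y \<Longrightarrow> ln u < y" "exp y < u \<Longrightarrow> y < ln u"
    by (metis exp_less_cancel_iff)+
  then show "u < exp y \<Longrightarrow> \<lfloor>ln u\<rfloor> \<le> \<lfloor>y\<rfloor>" "exp y < u \<Longrightarrow> \<lfloor>y\<rfloor> \<le> \<lfloor>ln u\<rfloor>"
    by linarith+
qed

lemma ex_le_exp:
  "i < \<lfloor>y\<rfloor> \<Longrightarrow> u < ex (i + 1) \<Longrightarrow> u < exp y"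
  "\<lfloor>y\<rfloor> + 1 \<le> i \<Longrightarrow> ex i < u \<Longrightarrow> exp y < u"
proof -
  assume "i < \<lfloor>y\<rfloor>" "u < ex (i + 1)"
  then have "ex (i + 1) \<le> exp y" by simp linarith
  with \<open>u < ex (i + 1)\<close> show "u < exp y" by (rule less_le_trans)
next
  assume "\<lfloor>y\<rfloor> + 1 \<le> i" "ex i < u"
  then have "exp y \<le> ex i" by simp linarith
  then show "exp y < u" using \<open>ex i < u\<close> by (rule le_less_trans)
qed

lemma wt_sreg:
  assumes "rv \<kappa> w" "reg F" shows "sreg (\<lambda>p i. wt \<theta> w i * F p (ex i))"
proof -
  have "reg (\<lambda>p t. ennreal (t powr (- \<theta>) * w t) * F p t)"
    by (rule reg_mult[OF reg_rv[OF rv_mult[OF rv_power assms(1)]] assms(2)])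
  from sreg_reg[OF this] show ?thesis by (simp add: powr_def)
qed

text \<open>Points at logarithmic distance at most 1 lie in the same block or in neighbouring
  blocks, so doubling passes from the sequence \<open>\<Psi>\<close> to the function
  \<open>\<Phi>\<close>.\<close>

lemma reg_equiv:
  assumes "(\<lambda>p y. \<Phi> p (exp y)) \<lessapprox> (\<lambda>p y. \<Psi> p \<lfloor>y\<rfloor>)" "(\<lambda>p y. \<Psi> p \<lfloor>y\<rfloor>) \<lessapprox> (\<lambda>p y. \<Phi> p (exp y))"
    "sreg \<Psi>"
  shows "reg \<Phi>"
proof -
  obtain C where C: "C < top" "\<And>p y. \<Phi> p (exp y) \<le> C * \<Psi> p \<lfloor>y\<rfloor>" using assms(1) by (rule lesE) (rule that)
  obtain D where D: "D < top" "\<And>p y. \<Psi> p \<lfloor>y\<rfloor> \<le> D * \<Phi> p (exp y)" using assms(2) by (rule lesE) (rule that)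
  obtain E where E: "E < top" "\<And>p i j. \<bar>i - j\<bar> \<le> 1 \<Longrightarrow> \<Psi> p i \<le> E * \<Psi> p j"
    using assms(3) by (rule sregE) (rule that)
  show ?thesis
  proof (rule regI)
    show "C * (E * D) < top" using C D E by (simp add: ennreal_mult_less_top)
    fix p and s t :: real assume st: "0 < s" "0 < t" "\<bar>ln s - ln t\<bar> \<le> 1"
    have "\<bar>\<lfloor>ln s\<rfloor> - \<lfloor>ln t\<rfloor>\<bar> \<le> 1" using st(3) by linarith
    then have "\<Psi> p \<lfloor>ln s\<rfloor> \<le> E * (D * \<Phi> p (exp (ln t)))"
      using E(2)[of "\<lfloor>ln s\<rfloor>" "\<lfloor>ln t\<rfloor>" p] D(2)[of p "ln t"] by (meson mult_left_mono order_trans zero_le)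
    then have "C * \<Psi> p \<lfloor>ln s\<rfloor> \<le> C * (E * (D * \<Phi> p (exp (ln t))))" by (rule mult_left_mono) simp
    with C(2)[of p "ln s"] show "\<Phi> p s \<le> C * (E * D) * \<Phi> p t"
      using st by (simp add: mult.assoc)
  qed
qed

context
  fixes w :: "real \<Rightarrow> real" and \<kappa> :: real and q :: ennreal and F :: "'p \<Rightarrow> real \<Rightarrow> ennreal" and \<theta> :: real
  assumes w: "rv \<kappa> w" and q: "0 < q" and F: "reg F"
begin

text \<open>The cut-off \<open>exp y\<close> may fall inside block
  \<open>\<lfloor>y\<rfloor>\<close>, so this block is included in the upper estimate and then
  removed by a shift.\<close>

lemma wnorm_L_les: "(\<lambda>p y. wnorm \<theta> q w {0<..<exp y} (F p)) \<lessapprox> (\<lambda>p y. lq q {..<\<lfloor>y\<rfloor>} (\<lambda>i. wt \<theta> w i * F p (ex i)))"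
proof -
  have "(\<lambda>p y. wnorm \<theta> q w {0<..<exp y} (F p)) \<lessapprox> (\<lambda>p y. lq q {..<\<lfloor>y\<rfloor> + 1} (\<lambda>i. wt \<theta> w i * F p (ex i)))"
    by (rule wnorm_les_lq[OF w q F]) (auto intro: floor_ln_less)
  also have "\<dots> \<lessapprox> (\<lambda>p y. lq q {..<\<lfloor>y\<rfloor>} (\<lambda>i. wt \<theta> w i * F p (ex i)))"
    by (rule lq_sreg_shift[OF q wt_sreg[OF w F], of 1]) auto
  finally show ?thesis .
qed

lemma les_wnorm_L: "(\<lambda>p y. lq q {..<\<lfloor>y\<rfloor>} (\<lambda>i. wt \<theta> w i * F p (ex i))) \<lessapprox> (\<lambda>p y. wnorm \<theta> q w {0<..<exp y} (F p))"
  by (rule lq_les_wnorm[OF w q F])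
     (auto intro: ex_le_exp intro: less_trans[OF exp_gt_zero])

lemma wnorm_R_les: "(\<lambda>p y. wnorm \<theta> q w {exp y<..} (F p)) \<lessapprox> (\<lambda>p y. lq q {\<lfloor>y\<rfloor>..} (\<lambda>i. wt \<theta> w i * F p (ex i)))"
  by (rule wnorm_les_lq[OF w q F])
     (auto intro: floor_ln_less less_trans[OF exp_gt_zero])

text \<open>Block \<open>\<lfloor>y\<rfloor>\<close> may lie only partly to the right of
  \<open>exp y\<close>; the sum is shifted so as to start with the next block.\<close>

lemma les_wnorm_R: "(\<lambda>p y. lq q {\<lfloor>y\<rfloor>..} (\<lambda>i. wt \<theta> w i * F p (ex i))) \<lessapprox> (\<lambda>p y. wnorm \<theta> q w {exp y<..} (F p))"
proof -
  have "(\<lambda>p y. lq q {\<lfloor>y\<rfloor>..} (\<lambda>i. wt \<theta> w i * F p (ex i))) \<lessapprox> (\<lambda>p y. lq q {\<lfloor>y\<rfloor> + 1..} (\<lambda>i. wt \<theta> w i * F p (ex i)))"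
    by (rule lq_sreg_shift[OF q wt_sreg[OF w F], of "- 1"]) auto
  also have "\<dots> \<lessapprox> (\<lambda>p y. wnorm \<theta> q w {exp y<..} (F p))"
    by (rule lq_les_wnorm[OF w q F]) (auto intro: ex_le_exp)
  finally show ?thesis .
qed

lemma wnorm_UNIV_les: "(\<lambda>p (k::'k). wnorm \<theta> q w {0<..} (F p)) \<lessapprox> (\<lambda>p k. lq q UNIV (\<lambda>i. wt \<theta> w i * F p (ex i)))"
  by (rule wnorm_les_lq[OF w q F]) auto

lemma les_wnorm_UNIV: "(\<lambda>p (k::'k). lq q UNIV (\<lambda>i. wt \<theta> w i * F p (ex i))) \<lessapprox> (\<lambda>p k. wnorm \<theta> q w {0<..} (F p))"
  by (rule lq_les_wnorm[OF w q F]) (auto intro: less_trans[OF exp_gt_zero])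

text \<open>A one-sided norm is again doubling as a function of its cut-off, so iterated norms can
  be discretised one layer at a time.\<close>

lemma reg_wnorm_L: "reg (\<lambda>p t. wnorm \<theta> q w {0<..<t} (F p))"
proof (rule reg_equiv[OF wnorm_L_les les_wnorm_L])
  have "(\<lambda>p k. lq q {..<k} (\<lambda>i. wt \<theta> w i * F p (ex i))) \<lessapprox> (\<lambda>p k. lq q {..<k - 1} (\<lambda>i. wt \<theta> w i * F p (ex i)))"
    by (rule lq_sreg_shift[OF q wt_sreg[OF w F], of 1]) auto
  then obtain C where C: "C < top" "\<And>p k. lq q {..<k} (\<lambda>i. wt \<theta> w i * F p (ex i)) \<le> C * lq q {..<k - 1} (\<lambda>i. wt \<theta> w i * F p (ex i))"
    by (rule lesE) (rule that)
  show "sreg (\<lambda>p k. lq q {..<k} (\<lambda>i. wt \<theta> w i * F p (ex i)))"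
    unfolding sreg_def
  proof (intro exI[of _ C] conjI allI impI C(1))
    fix p and i j :: int assume "\<bar>i - j\<bar> \<le> 1"
    then have "lq q {..<i - 1} (\<lambda>i. wt \<theta> w i * F p (ex i)) \<le> lq q {..<j} (\<lambda>i. wt \<theta> w i * F p (ex i))"
      by (intro lq_mono_set q) auto
    then show "lq q {..<i} (\<lambda>i. wt \<theta> w i * F p (ex i)) \<le> C * lq q {..<j} (\<lambda>i. wt \<theta> w i * F p (ex i))"
      using C(2)[where p=p and k=i] by (meson mult_left_mono order_trans zero_le)
  qed
qed

lemma reg_wnorm_R: "reg (\<lambda>p t. wnorm \<theta> q w {t<..} (F p))"
proof (rule reg_equiv[OF wnorm_R_les les_wnorm_R])
  have "(\<lambda>p k. lq q {k..} (\<lambda>i. wt \<theta> w i * F p (ex i))) \<lessapprox> (\<lambda>p k. lq q {k + 1..} (\<lambda>i. wt \<theta> w i * F p (ex i)))"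
    by (rule lq_sreg_shift[OF q wt_sreg[OF w F], of "- 1"]) auto
  then obtain C where C: "C < top" "\<And>p k. lq q {k..} (\<lambda>i. wt \<theta> w i * F p (ex i)) \<le> C * lq q {k + 1..} (\<lambda>i. wt \<theta> w i * F p (ex i))"
    by (rule lesE) (rule that)
  show "sreg (\<lambda>p k. lq q {k..} (\<lambda>i. wt \<theta> w i * F p (ex i)))"
    unfolding sreg_def
  proof (intro exI[of _ C] conjI allI impI C(1))
    fix p and i j :: int assume "\<bar>i - j\<bar> \<le> 1"
    then have "lq q {i + 1..} (\<lambda>i. wt \<theta> w i * F p (ex i)) \<le> lq q {j..} (\<lambda>i. wt \<theta> w i * F p (ex i))"
      by (intro lq_mono_set q) auto
    then show "lq q {i..} (\<lambda>i. wt \<theta> w i * F p (ex i)) \<le> C * lq q {j..} (\<lambda>i. wt \<theta> w i * F p (ex i))"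
      using C(2)[where p=p and k=i] by (meson mult_left_mono order_trans zero_le)
  qed
qed

end

text \<open>For weights that are defined as norms and hence as extended numbers. Finiteness at 1
  spreads to all positive points through \<open>shift\<close>, positivity comes from
  \<open>\<Psi>\<close>, and then \<open>enn2real\<close> loses no information.\<close>

lemma rv_enn2real:
  fixes \<Phi> :: "real \<Rightarrow> ennreal" and \<Psi> :: "int \<Rightarrow> ennreal"
  assumes up: "(\<lambda>(_::unit) y. \<Phi> (exp y)) \<lessapprox> (\<lambda>_ y. \<Psi> \<lfloor>y\<rfloor>)"
    and lo: "(\<lambda>(_::unit) y. \<Psi> \<lfloor>y\<rfloor>) \<lessapprox> (\<lambda>_ y. \<Phi> (exp y))"
    and shift: "\<And>\<epsilon>. 0 < \<epsilon> \<Longrightarrow> \<exists>C<top. \<forall>i j. \<Psi> i \<le> C * ennreal (exp (\<epsilon> * \<bar>real_of_int (i - j)\<bar>)) * \<Psi> j"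
    and pos: "\<And>i. 0 < \<Psi> i" and fin: "\<Phi> 1 < top"
  shows "rv 0 (\<lambda>t. enn2real (\<Phi> t))" and "0 < t \<Longrightarrow> ennreal (enn2real (\<Phi> t)) = \<Phi> t"
proof -
  obtain C where C: "C < top" "\<And>p y. \<Phi> (exp y) \<le> C * \<Psi> \<lfloor>y\<rfloor>" using up by (rule lesE) (rule that)
  obtain D where D: "D < top" "\<And>p y. \<Psi> \<lfloor>y\<rfloor> \<le> D * \<Phi> (exp y)" using lo by (rule lesE) (rule that)
  have key: "\<exists>E<top. \<forall>s t. 0 < s \<longrightarrow> 0 < t \<longrightarrow> \<Phi> s \<le> E * ennreal (exp (\<epsilon> * \<bar>ln s - ln t\<bar>)) * \<Phi> t" if e: "0 < \<epsilon>" for \<epsilon>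
  proof -
    obtain E where E: "E < top" "\<And>i j. \<Psi> i \<le> E * ennreal (exp (\<epsilon> * \<bar>real_of_int (i - j)\<bar>)) * \<Psi> j"
      using shift[OF e] by blast
    let ?E = "C * (E * (ennreal (exp \<epsilon>) * D))"
    have "\<Phi> s \<le> ?E * ennreal (exp (\<epsilon> * \<bar>ln s - ln t\<bar>)) * \<Phi> t" if st: "0 < s" "0 < t" for s t
    proof -
      have le: "ennreal (exp (\<epsilon> * \<bar>real_of_int (\<lfloor>ln s\<rfloor> - \<lfloor>ln t\<rfloor>)\<bar>)) \<le> ennreal (exp \<epsilon>) * ennreal (exp (\<epsilon> * \<bar>ln s - ln t\<bar>))"
      proof -
        have "\<bar>real_of_int (\<lfloor>ln s\<rfloor> - \<lfloor>ln t\<rfloor>)\<bar> \<le> 1 + \<bar>ln s - ln t\<bar>" by simp linarith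
        then have "\<epsilon> * \<bar>real_of_int (\<lfloor>ln s\<rfloor> - \<lfloor>ln t\<rfloor>)\<bar> \<le> \<epsilon> * (1 + \<bar>ln s - ln t\<bar>)"
          using e by (intro mult_left_mono) auto
        then show ?thesis by (simp add: ennreal_mult[symmetric] exp_add[symmetric] distrib_left)
      qed
      have "\<Phi> s \<le> C * \<Psi> \<lfloor>ln s\<rfloor>" using C(2)[of "ln s"] st by simp
      also have "\<dots> \<le> C * (E * ennreal (exp (\<epsilon> * \<bar>real_of_int (\<lfloor>ln s\<rfloor> - \<lfloor>ln t\<rfloor>)\<bar>)) * \<Psi> \<lfloor>ln t\<rfloor>)"
        by (intro mult_left_mono E) auto
      also have "\<dots> \<le> C * (E * (ennreal (exp \<epsilon>) * ennreal (exp (\<epsilon> * \<bar>ln s - ln t\<bar>))) * (D * \<Phi> t))"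
        using D(2)[of "ln t"] st le by (intro mult_left_mono mult_mono) auto
      finally show ?thesis by (simp add: ac_simps)
    qed
    moreover have "?E < top" using C D E by (simp add: ennreal_mult_less_top)
    ultimately show ?thesis by (intro exI[of _ ?E]) simp
  qed
  have finite: "\<Phi> t < top" if "0 < t" for t
  proof -
    obtain E where E: "E < top" "\<And>s t. 0 < s \<Longrightarrow> 0 < t \<Longrightarrow> \<Phi> s \<le> E * ennreal (exp (1 * \<bar>ln s - ln t\<bar>)) * \<Phi> t"
      using key[OF zero_less_one] by blast
    have "\<Phi> t \<le> E * ennreal (exp (1 * \<bar>ln t - ln 1\<bar>)) * \<Phi> 1" using E(2)[OF that, of 1] by simp
    also have "\<dots> < top" using E(1) fin by (simp add: ennreal_mult_less_top)
    finally show ?thesis .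
  qed
  have gt0: "0 < \<Phi> t" if "0 < t" for t
  proof -
    have "0 < D * \<Phi> t" using pos[of "\<lfloor>ln t\<rfloor>"] D(2)[of "ln t"] that by (simp add: less_le_trans)
    then show ?thesis by (metis mult_zero_right not_gr_zero)
  qed
  show eq: "ennreal (enn2real (\<Phi> t)) = \<Phi> t" if "0 < t" for t using finite[OF that] by simp
  show "rv 0 (\<lambda>t. enn2real (\<Phi> t))"
  proof (rule rvI)
    show pos: "0 < enn2real (\<Phi> t)" if "0 < t" for t
      using finite[OF that] gt0[OF that] by (simp add: enn2real_positive_iff)
    fix \<epsilon> :: real assume e: "0 < \<epsilon>"
    obtain E where E: "E < top" "\<And>s t. 0 < s \<Longrightarrow> 0 < t \<Longrightarrow> \<Phi> s \<le> E * ennreal (exp (\<epsilon> * \<bar>ln s - ln t\<bar>)) * \<Phi> t"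
      using key[OF e] by blast
    define c where "c = enn2real E + 1"
    have c: "0 < c" "E \<le> ennreal c"
      using E(1) unfolding c_def
      by (simp add: add_nonneg_pos) (metis E(1) ennreal_enn2real ennreal_leI le_add_same_cancel1 zero_le_one)
    have one: "ln (enn2real (\<Phi> s)) - ln (enn2real (\<Phi> t)) \<le> ln c + \<epsilon> * \<bar>ln s - ln t\<bar>" if st: "0 < s" "0 < t" for s t
    proof -
      have "ennreal (enn2real (\<Phi> s)) \<le> E * ennreal (exp (\<epsilon> * \<bar>ln s - ln t\<bar>)) * ennreal (enn2real (\<Phi> t))"
        using E(2)[OF st] eq st by simp
      also have "\<dots> \<le> ennreal c * ennreal (exp (\<epsilon> * \<bar>ln s - ln t\<bar>)) * ennreal (enn2real (\<Phi> t))"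
        by (intro mult_right_mono c) auto
      also have "\<dots> = ennreal (c * exp (\<epsilon> * \<bar>ln s - ln t\<bar>) * enn2real (\<Phi> t))"
        using c(1) by (simp add: ennreal_mult)
      finally have "enn2real (\<Phi> s) \<le> c * exp (\<epsilon> * \<bar>ln s - ln t\<bar>) * enn2real (\<Phi> t)"
        using c(1) by (subst (asm) ennreal_le_iff) auto
      then have "ln (enn2real (\<Phi> s)) \<le> ln (c * exp (\<epsilon> * \<bar>ln s - ln t\<bar>) * enn2real (\<Phi> t))"
        using pos[OF st(1)] pos[OF st(2)] c(1) by (subst ln_le_cancel_iff) auto
      also have "\<dots> = ln c + \<epsilon> * \<bar>ln s - ln t\<bar> + ln (enn2real (\<Phi> t))"
        using pos[OF st(2)] c(1) by (simp add: ln_mult)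
      finally show ?thesis by simp
    qed
    have key': "\<bar>ln (enn2real (\<Phi> s)) - ln (enn2real (\<Phi> t)) - 0 * (ln s - ln t)\<bar> \<le> ln c + \<epsilon> * \<bar>ln s - ln t\<bar>"
      if "0 < s" "0 < t" for s t
      using one[OF that] one[OF that(2,1)] by (simp add: abs_minus_commute abs_le_iff)
    show "\<exists>c. \<forall>s t. 0 < s \<longrightarrow> 0 < t \<longrightarrow>
      \<bar>ln (enn2real (\<Phi> s)) - ln (enn2real (\<Phi> t)) - 0 * (ln s - ln t)\<bar> \<le> c + \<epsilon> * \<bar>ln s - ln t\<bar>"
      by (intro exI[of _ "ln c"] allI impI key')
  qed
qed

section \<open>The substitution on the logarithmic scale\<close>

lemma card_int_diam:
  fixes A :: "int set"
  assumes "\<And>i j. i \<in> A \<Longrightarrow> j \<in> A \<Longrightarrow> \<bar>i - j\<bar> \<le> int N"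
  shows "finite A \<and> card A \<le> 2 * N + 1"
proof (cases "A = {}")
  case False
  then obtain a where a: "a \<in> A" by blast
  have "A \<subseteq> {a - int N..a + int N}" using assms[OF a] by force
  then show ?thesis
    using card_mono[of "{a - int N..a + int N}" A] finite_subset by auto
qed simp

text \<open>On the logarithmic scale \<open>\<rho>\<close> maps the integers to the reals with bounded gaps and boundedly many
  points in each unit interval, which replaces the substitution \<open>u = \<rho> t\<close>.\<close>

lemma lq_change_of_variable:
  assumes r: "rv \<kappa> \<rho>" and k: "0 < \<kappa>" and F: "reg F" and q: "0 < q"
  shows "(\<lambda>p (k::'k). lq q UNIV (\<lambda>i. F p (\<rho> (ex i)))) \<lessapprox> (\<lambda>p k. lq q UNIV (\<lambda>i. F p (ex i)))"
    and "(\<lambda>p (k::'k). lq q UNIV (\<lambda>i. F p (ex i))) \<lessapprox> (\<lambda>p k. lq q UNIV (\<lambda>i. F p (\<rho> (ex i))))"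
proof -
  define L where "L = (\<lambda>i. ln (\<rho> (ex i)))"
  have k2: "0 < \<kappa> / 2" using k by simp
  \<comment> \<open>With an error of half the index, \<open>L\<close> still grows with slope at
    least \<open>\<kappa> / 2\<close> up to a constant. This bounds the fibres.\<close>
  obtain c0 where c0: "\<And>s t. 0 < s \<Longrightarrow> 0 < t \<Longrightarrow>
    \<bar>ln (\<rho> s) - ln (\<rho> t) - \<kappa> * (ln s - ln t)\<bar> \<le> c0 + \<kappa> / 2 * \<bar>ln s - ln t\<bar>"
    by (rule rvE[OF r k2]) (rule that)
  define c where "c = max c0 0"
  have L: "\<bar>L i - L j - \<kappa> * (real_of_int i - real_of_int j)\<bar> \<le> c + \<kappa> / 2 * \<bar>real_of_int i - real_of_int j\<bar>" for i j
    using c0[of "ex i" "ex j"] by (simp add: L_def c_def)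
  have c_nonneg: "0 \<le> c" by (simp add: c_def)
  have Llow: "\<kappa> / 2 * (real_of_int i - real_of_int j) \<le> L i - L j + c" if "j \<le> i" for i j
  proof -
    define d where "d = real_of_int i - real_of_int j"
    have "\<bar>L i - L j - \<kappa> * d\<bar> \<le> c + \<kappa> / 2 * d" using L[of i j] that by (simp add: d_def)
    moreover have "\<kappa> * d = \<kappa> / 2 * d + \<kappa> / 2 * d" by simp
    ultimately show ?thesis unfolding d_def[symmetric] abs_le_iff by linarith
  qed
  have Lpos: "exp (L i) = \<rho> (ex i)" for i
    using rv_pos[OF r, of "ex i"] by (simp add: L_def)
  have diam: "\<bar>i - j\<bar> \<le> int (nat \<lceil>2 * (c + d) / \<kappa>\<rceil>)" if "\<bar>L i - L j\<bar> \<le> d" for i j d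
  proof -
    have "\<kappa> / 2 * \<bar>real_of_int i - real_of_int j\<bar> \<le> d + c"
      using Llow[of i j] Llow[of j i] that by (cases "i \<le> j") auto
    then have "real_of_int \<bar>i - j\<bar> \<le> 2 * (c + d) / \<kappa>" using k by (simp add: field_simps)
    then show ?thesis by linarith
  qed
  define C where "C = (3 / 2 * \<kappa> + c)"
  \<comment> \<open>Discrete intermediate value argument: \<open>L\<close> is at most
    \<open>j\<close> somewhere on the left and exceeds \<open>j\<close> far to the right, so it
    crosses \<open>j\<close> between two consecutive integers. As \<open>L\<close> need not be
    monotone there may be several crossings; any of them will do.\<close>
  have ex: "\<exists>i. \<bar>L i - real_of_int j\<bar> \<le> C" for j
  proof -
    define S where "S = {i. L i \<le> real_of_int j}"
    have "\<exists>i0. i0 \<in> S"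
    proof -
      define n where "n = nat \<lceil>2 * (c + \<bar>L 0\<bar> + \<bar>real_of_int j\<bar>) / \<kappa>\<rceil>"
      have "2 * (c + \<bar>L 0\<bar> + \<bar>real_of_int j\<bar>) / \<kappa> \<le> real n" unfolding n_def by linarith
      then have "c + \<bar>L 0\<bar> + \<bar>real_of_int j\<bar> \<le> \<kappa> / 2 * real n" using k by (simp add: field_simps)
      then have "L (- int n) \<le> real_of_int j" using Llow[of "- int n" 0] by simp
      then show ?thesis unfolding S_def by blast
    qed
    then obtain i0 where i0: "i0 \<in> S" by blast
    have "\<exists>i\<in>S. i + 1 \<notin> S"
    proof (rule ccontr)
      assume "\<not> (\<exists>i\<in>S. i + 1 \<notin> S)"
      then have step: "i + 1 \<in> S" if "i \<in> S" for i using that by blast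
      have all: "i0 + int n \<in> S" for n
        by (induction n) (use i0 step[of "i0 + int _"] in \<open>auto simp: algebra_simps\<close>)
      define n where "n = nat (\<lceil>2 * (c + real_of_int j - L i0) / \<kappa>\<rceil> + 1)"
      have "2 * (c + real_of_int j - L i0) / \<kappa> < real n" unfolding n_def by linarith
      then have "c + real_of_int j - L i0 < \<kappa> / 2 * real n" using k by (simp add: field_simps)
      then have "real_of_int j < L (i0 + int n)" using Llow[of i0 "i0 + int n"] by simp
      then show False using all[of n] by (simp add: S_def)
    qed
    then obtain i where i: "L i \<le> real_of_int j" "real_of_int j < L (i + 1)" unfolding S_def by auto
    have "L (i + 1) - L i \<le> C" using L[of "i + 1" i] by (simp add: C_def abs_le_iff)
    then show ?thesis using i by (intro exI[of _ i]) auto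
  qed
  obtain \<phi> where phi: "\<And>j. \<bar>L (\<phi> j) - real_of_int j\<bar> \<le> C" using ex by metis
  have C0: "0 \<le> C" using c_nonneg k by (simp add: C_def)
  obtain D where D: "D < top" "\<And>p s t. 0 < s \<Longrightarrow> 0 < t \<Longrightarrow> \<bar>ln s - ln t\<bar> \<le> real (Suc (nat \<lceil>C\<rceil>)) \<Longrightarrow> F p s \<le> D * F p t"
    using reg_iter[OF F, of "Suc (nat \<lceil>C\<rceil>)"] by blast
  have CN: "C \<le> real (Suc (nat \<lceil>C\<rceil>))" by linarith
  have gen: "(\<lambda>p (k::'k). lq q UNIV (X p)) \<lessapprox> (\<lambda>p k. lq q UNIV (Y p))"
    if psi: "\<And>i j. \<psi> i = \<psi> j \<Longrightarrow> \<bar>i - j\<bar> \<le> int N" and le: "\<And>p i. X p i \<le> D * Y p (\<psi> i)"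
    for X Y :: "'a \<Rightarrow> int \<Rightarrow> ennreal" and \<psi> N
  proof -
    obtain E where E: "E < top" "\<And>I J x y \<phi>. \<phi> ` I \<subseteq> J \<Longrightarrow>
        (\<forall>j. finite {i\<in>I. \<phi> i = j} \<and> card {i\<in>I. \<phi> i = j} \<le> 2 * N + 1) \<Longrightarrow>
        (\<forall>i\<in>I. x i \<le> y (\<phi> i)) \<Longrightarrow> lq q I x \<le> E * lq q J y"
      using lq_reindex[OF q, of "2 * N + 1"] by blast
    have "lq q UNIV (X p) \<le> E * lq q UNIV (\<lambda>i. D * Y p i)" for p
      by (rule E(2)[of \<psi>]) (use le in \<open>auto intro!: card_int_diam[THEN conjunct1] card_int_diam[of _ N, THEN conjunct2, simplified] psi\<close>)
    then show ?thesis
      using E(1) D(1) q by (intro lesI[of "E * D"]) (auto simp: lq_cmult ennreal_mult_less_top mult.assoc)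
  qed
  show "(\<lambda>p (k::'k). lq q UNIV (\<lambda>i. F p (\<rho> (ex i)))) \<lessapprox> (\<lambda>p k. lq q UNIV (\<lambda>i. F p (ex i)))"
  proof (rule gen[of "\<lambda>i. \<lfloor>L i\<rfloor>" "nat \<lceil>2 * (c + 1) / \<kappa>\<rceil>"])
    fix i j assume "\<lfloor>L i\<rfloor> = \<lfloor>L j\<rfloor>"
    then have "\<bar>L i - L j\<bar> \<le> 1" by linarith
    then show "\<bar>i - j\<bar> \<le> int (nat \<lceil>2 * (c + 1) / \<kappa>\<rceil>)" by (rule diam)
  next
    fix p i
    show "F p (\<rho> (ex i)) \<le> D * F p (ex \<lfloor>L i\<rfloor>)"
    proof (rule D(2))
      show "0 < \<rho> (ex i)" by (rule rv_pos[OF r]) simp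
      show "\<bar>ln (\<rho> (ex i)) - ln (ex \<lfloor>L i\<rfloor>)\<bar> \<le> real (Suc (nat \<lceil>C\<rceil>))"
      proof -
        have "ln (\<rho> (ex i)) = L i" by (simp add: L_def)
        then show ?thesis by simp linarith
      qed
    qed simp
  qed
  show "(\<lambda>p (k::'k). lq q UNIV (\<lambda>i. F p (ex i))) \<lessapprox> (\<lambda>p k. lq q UNIV (\<lambda>i. F p (\<rho> (ex i))))"
  proof (rule gen[of \<phi> "nat \<lceil>2 * C\<rceil>"])
    fix i j assume "\<phi> i = \<phi> j"
    then have "\<bar>real_of_int i - real_of_int j\<bar> \<le> 2 * C" using phi[of i] phi[of j] by (simp add: abs_le_iff)
    then show "\<bar>i - j\<bar> \<le> int (nat \<lceil>2 * C\<rceil>)" by linarith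
  next
    fix p i
    show "F p (ex i) \<le> D * F p (\<rho> (ex (\<phi> i)))"
    proof (rule D(2))
      show "0 < \<rho> (ex (\<phi> i))" by (rule rv_pos[OF r]) simp
      show "\<bar>ln (ex i) - ln (\<rho> (ex (\<phi> i)))\<bar> \<le> real (Suc (nat \<lceil>C\<rceil>))"
      proof -
        have "ln (\<rho> (ex (\<phi> i))) = L (\<phi> i)" by (simp add: L_def)
        then show ?thesis using phi[of i] CN by (simp add: abs_minus_commute)
      qed
    qed simp
  qed
qed

abbreviation sq :: "(real \<Rightarrow> real) \<Rightarrow> int \<Rightarrow> ennreal" where
  "sq w i \<equiv> ennreal (w (ex i))"

lemma sq_mult: "rv \<kappa> v \<Longrightarrow> rv \<kappa>' w \<Longrightarrow> sq v i * sq w i = sq (\<lambda>t. v t * w t) i"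
  by (simp add: ennreal_mult rv_pos less_imp_le)

lemma sq_le_exp:
  assumes "rv \<kappa> w" "0 < \<epsilon>"
  shows "\<exists>C<top. \<forall>i j. sq w i \<le> C * ennreal (exp (\<kappa> * real_of_int (i - j) + \<epsilon> * \<bar>real_of_int (i - j)\<bar>)) * sq w j"
proof -
  obtain C where C: "C < top" "\<And>s t. 0 < s \<Longrightarrow> 0 < t \<Longrightarrow>
      ennreal (w s) \<le> C * ennreal (exp (\<kappa> * (ln s - ln t) + \<epsilon> * \<bar>ln s - ln t\<bar>)) * ennreal (w t)"
    using rv_le_exp[OF assms] by blast
  have "sq w i \<le> C * ennreal (exp (\<kappa> * real_of_int (i - j) + \<epsilon> * \<bar>real_of_int (i - j)\<bar>)) * sq w j" for i j
    using C(2)[of "ex i" "ex j"] by simp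
  with C(1) show ?thesis by blast
qed

subsection \<open>The weights built from tails\<close>

text \<open>Translation by \<open>i - j\<close> carries the index set for \<open>i\<close> into that
  for \<open>j\<close> and changes the weight by at most a constant times
  \<open>exp (\<epsilon> * \<bar>i - j\<bar>)\<close>. Hence head and tail norms of a slowly varying
  weight vary slowly.\<close>

lemma lq_weight_shift:
  assumes b: "rv 0 b" and q: "0 < q" and e: "0 < \<epsilon>" and I: "\<And>i j l. l \<in> I i \<Longrightarrow> l - (i - j) \<in> I j"
  shows "\<exists>C<top. \<forall>i j. lq q (I i) (sq b) \<le> C * ennreal (exp (\<epsilon> * \<bar>real_of_int (i - j)\<bar>)) * lq q (I j) (sq b)"
proof -
  obtain C where C: "C < top" "\<And>i j. sq b i \<le> C * ennreal (exp (0 * real_of_int (i - j) + \<epsilon> * \<bar>real_of_int (i - j)\<bar>)) * sq b j"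
    using sq_le_exp[OF b e] by blast
  obtain D where D: "D < top" "\<And>I J n x c. (\<forall>i\<in>I. i - n \<in> J \<and> x i \<le> c * x (i - n)) \<Longrightarrow> lq q I x \<le> D * (c * lq q J x)"
    using lq_shift[OF q] by blast
  have "lq q (I i) (sq b) \<le> D * (C * ennreal (exp (\<epsilon> * \<bar>real_of_int (i - j)\<bar>)) * lq q (I j) (sq b))" for i j
  proof (rule D(2)[of _ "i - j"], intro ballI conjI)
    fix l assume "l \<in> I i"
    then show "l - (i - j) \<in> I j" by (rule I)
    show "sq b l \<le> C * ennreal (exp (\<epsilon> * \<bar>real_of_int (i - j)\<bar>)) * sq b (l - (i - j))"
      using C(2)[of l "l - (i - j)"] by simp
  qed
  moreover have "D * C < top" using C D by (simp add: ennreal_mult_less_top)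
  ultimately show ?thesis by (intro exI[of _ "D * C"]) (simp add: mult.assoc)
qed

lemma lq_weight_pos: "rv \<kappa> b \<Longrightarrow> 0 < q \<Longrightarrow> i \<in> I \<Longrightarrow> 0 < lq q I (sq b)"
  using lq_single[of i I q "sq b"] rv_pos[of \<kappa> b "ex i"] by (simp add: less_le_trans[of 0 "sq b i"])

lemma rv_head:
  assumes b: "rv 0 b" and q: "0 < q" and fin: "wnorm 0 q b {0<..<1} (\<lambda>_. 1) < top"
  defines "D \<equiv> \<lambda>t. enn2real (wnorm 0 q b {0<..<t} (\<lambda>_. 1))"
  shows "rv 0 D" "0 < t \<Longrightarrow> ennreal (D t) = wnorm 0 q b {0<..<t} (\<lambda>_. 1)"
    "(\<lambda>(p::unit) k. sq D k) \<lessapprox> (\<lambda>p k. lq q {..<k} (sq b))"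
    "(\<lambda>(p::unit) k. lq q {..<k} (sq b)) \<lessapprox> (\<lambda>p k. sq D k)"
proof -
  have up: "(\<lambda>(p::unit) y. wnorm 0 q b {0<..<exp y} (\<lambda>_. 1)) \<lessapprox> (\<lambda>p y. lq q {..<\<lfloor>y\<rfloor>} (sq b))"
    using wnorm_L_les[OF b q reg_1, of 0] by simp
  have lo: "(\<lambda>(p::unit) y. lq q {..<\<lfloor>y\<rfloor>} (sq b)) \<lessapprox> (\<lambda>p y. wnorm 0 q b {0<..<exp y} (\<lambda>_. 1))"
    using les_wnorm_L[OF b q reg_1, of 0] by simp
  have pos: "0 < lq q {..<i} (sq b)" for i by (rule lq_weight_pos[OF b q, of "i - 1"]) simp
  note * = rv_enn2real[OF up lo _ pos fin]
  have shift: "\<exists>C<top. \<forall>i j. lq q {..<i} (sq b) \<le> C * ennreal (exp (\<epsilon> * \<bar>real_of_int (i - j)\<bar>)) * lq q {..<j} (sq b)"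
    if "0 < \<epsilon>" for \<epsilon> by (rule lq_weight_shift[OF b q that]) auto
  show "rv 0 D" unfolding D_def by (rule *(1)[OF shift])
  show eq: "ennreal (D t) = wnorm 0 q b {0<..<t} (\<lambda>_. 1)" if "0 < t" for t
    unfolding D_def by (rule *(2)[OF shift that])
  show "(\<lambda>(p::unit) k. sq D k) \<lessapprox> (\<lambda>p k. lq q {..<k} (sq b))"
    using les_pre[OF up, where m="\<lambda>p k. real_of_int k"] by (simp add: eq)
  show "(\<lambda>(p::unit) k. lq q {..<k} (sq b)) \<lessapprox> (\<lambda>p k. sq D k)"
    using les_pre[OF lo, where m="\<lambda>p k. real_of_int k"] by (simp add: eq)
qed

lemma rv_tail:
  assumes b: "rv 0 b" and q: "0 < q" and fin: "wnorm 0 q b {1<..} (\<lambda>_. 1) < top"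
  defines "D \<equiv> \<lambda>t. enn2real (wnorm 0 q b {t<..} (\<lambda>_. 1))"
  shows "rv 0 D" "0 < t \<Longrightarrow> ennreal (D t) = wnorm 0 q b {t<..} (\<lambda>_. 1)"
    "(\<lambda>(p::unit) k. sq D k) \<lessapprox> (\<lambda>p k. lq q {k..} (sq b))"
    "(\<lambda>(p::unit) k. lq q {k..} (sq b)) \<lessapprox> (\<lambda>p k. sq D k)"
proof -
  have up: "(\<lambda>(p::unit) y. wnorm 0 q b {exp y<..} (\<lambda>_. 1)) \<lessapprox> (\<lambda>p y. lq q {\<lfloor>y\<rfloor>..} (sq b))"
    using wnorm_R_les[OF b q reg_1, of 0] by simp
  have lo: "(\<lambda>(p::unit) y. lq q {\<lfloor>y\<rfloor>..} (sq b)) \<lessapprox> (\<lambda>p y. wnorm 0 q b {exp y<..} (\<lambda>_. 1))"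
    using les_wnorm_R[OF b q reg_1, of 0] by simp
  have pos: "0 < lq q {i..} (sq b)" for i by (rule lq_weight_pos[OF b q, of "i"]) simp
  note * = rv_enn2real[OF up lo _ pos fin]
  have shift: "\<exists>C<top. \<forall>i j. lq q {i..} (sq b) \<le> C * ennreal (exp (\<epsilon> * \<bar>real_of_int (i - j)\<bar>)) * lq q {j..} (sq b)"
    if "0 < \<epsilon>" for \<epsilon> by (rule lq_weight_shift[OF b q that]) auto
  show "rv 0 D" unfolding D_def by (rule *(1)[OF shift])
  show eq: "ennreal (D t) = wnorm 0 q b {t<..} (\<lambda>_. 1)" if "0 < t" for t
    unfolding D_def by (rule *(2)[OF shift that])
  show "(\<lambda>(p::unit) k. sq D k) \<lessapprox> (\<lambda>p k. lq q {k..} (sq b))"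
    using les_pre[OF up, where m="\<lambda>p k. real_of_int k"] by (simp add: eq)
  show "(\<lambda>(p::unit) k. lq q {k..} (sq b)) \<lessapprox> (\<lambda>p k. sq D k)"
    using les_pre[OF lo, where m="\<lambda>p k. real_of_int k"] by (simp add: eq)
qed

text \<open>The inner interval \<open>(s, t)\<close> depends on both variables, so the results for a
  single cut-off do not apply and the two layers are estimated together. The last claim holds
  because the inner sum over \<open>{j..<0}\<close> contains the term at \<open>- 1\<close> for
  every \<open>j < 0\<close>, whence the iterated norm dominates a multiple of the plain norm of
  \<open>b\<close>.\<close>

lemma rv_iterated_head:
  assumes a: "rv 0 a" and b: "rv 0 b" and q: "0 < q" and r: "0 < r"
    and fin: "wnorm 0 r b {0<..<1} (\<lambda>s. wnorm 0 q a {s<..<1} (\<lambda>_. 1)) < top"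
  defines "X \<equiv> \<lambda>t. enn2real (wnorm 0 r b {0<..<t} (\<lambda>s. wnorm 0 q a {s<..<t} (\<lambda>_. 1)))"
  defines "\<Psi> \<equiv> \<lambda>k. lq r {..<k} (\<lambda>j. sq b j * lq q {j..<k} (sq a))"
  shows "rv 0 X"
    "(\<lambda>(p::unit) k. sq X k) \<lessapprox> (\<lambda>p k. \<Psi> k)"
    "(\<lambda>(p::unit) k. \<Psi> k) \<lessapprox> (\<lambda>p k. sq X k)"
    "wnorm 0 r b {0<..<1} (\<lambda>_. 1) < top"
proof -
  define \<Phi> where "\<Phi> = (\<lambda>t. wnorm 0 r b {0<..<t} (\<lambda>s. wnorm 0 q a {s<..<t} (\<lambda>_. 1)))"
  have shift: "\<exists>C<top. \<forall>i j. \<Psi> i \<le> C * ennreal (exp (\<epsilon> * \<bar>real_of_int (i - j)\<bar>)) * \<Psi> j" if e: "0 < \<epsilon>" for \<epsilon>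
  proof -
    \<comment> \<open>Each of the two weights may use up half of the error.\<close>
    have e2: "0 < \<epsilon> / 2" using e by simp
    obtain A where A: "A < top" "\<And>i j. sq a i \<le> A * ennreal (exp (0 * real_of_int (i - j) + \<epsilon> / 2 * \<bar>real_of_int (i - j)\<bar>)) * sq a j"
      using sq_le_exp[OF a e2] by blast
    obtain B where B: "B < top" "\<And>i j. sq b i \<le> B * ennreal (exp (0 * real_of_int (i - j) + \<epsilon> / 2 * \<bar>real_of_int (i - j)\<bar>)) * sq b j"
      using sq_le_exp[OF b e2] by blast
    obtain C where C: "C < top" "\<And>I J n x c. (\<forall>i\<in>I. i - n \<in> J \<and> x i \<le> c * x (i - n)) \<Longrightarrow> lq q I x \<le> C * (c * lq q J x)"
      using lq_shift[OF q] by blast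
    obtain D where D: "D < top" "\<And>I J x y \<phi>. \<phi> ` I \<subseteq> J \<Longrightarrow> inj_on \<phi> I \<Longrightarrow>
       (\<forall>i\<in>I. x i \<le> y (\<phi> i)) \<Longrightarrow> lq r I x \<le> D * lq r J y"
      using lq_inj[OF r] by blast
    have "\<Psi> i \<le> D * lq r {..<j} (\<lambda>l. (B * C * A * ennreal (exp (\<epsilon> * \<bar>real_of_int (i - j)\<bar>))) * (sq b l * lq q {l..<j} (sq a)))" for i j
      unfolding \<Psi>_def
    proof (rule D(2)[of "\<lambda>l. l - (i - j)"], safe)
      fix l assume "l < i"
      let ?e = "ennreal (exp (\<epsilon> / 2 * \<bar>real_of_int (i - j)\<bar>))"
      have ee: "?e * ?e = ennreal (exp (\<epsilon> * \<bar>real_of_int (i - j)\<bar>))"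
        by (simp add: ennreal_mult[symmetric] exp_add[symmetric])
      have "lq q {l..<i} (sq a) \<le> C * (A * ?e * lq q {l - (i - j)..<j} (sq a))"
      proof (rule C(2)[of _ "i - j"], intro ballI conjI)
        fix m assume "m \<in> {l..<i}"
        then show "m - (i - j) \<in> {l - (i - j)..<j}" by auto
        show "sq a m \<le> A * ?e * sq a (m - (i - j))" using A(2)[of m "m - (i - j)"] by simp
      qed
      moreover have "sq b l \<le> B * ?e * sq b (l - (i - j))"
        using B(2)[of l "l - (i - j)"] by simp
      ultimately have "sq b l * lq q {l..<i} (sq a) \<le> (B * ?e * sq b (l - (i - j))) * (C * (A * ?e * lq q {l - (i - j)..<j} (sq a)))"
        by (intro mult_mono) auto
      also have "\<dots> = B * C * A * (?e * ?e) * (sq b (l - (i - j)) * lq q {l - (i - j)..<j} (sq a))"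
        by (simp only: ac_simps)
      finally show "sq b l * lq q {l..<i} (sq a) \<le> B * C * A * ennreal (exp (\<epsilon> * \<bar>real_of_int (i - j)\<bar>)) *
          (sq b (l - (i - j)) * lq q {l - (i - j)..<j} (sq a))"
        unfolding ee .
    qed (auto intro: inj_onI)
    then have "\<Psi> i \<le> D * (B * C * A) * ennreal (exp (\<epsilon> * \<bar>real_of_int (i - j)\<bar>)) * \<Psi> j" for i j
      unfolding \<Psi>_def by (simp only: lq_cmult[OF r] mult.assoc)
    moreover have "D * (B * C * A) < top" using A B C D by (simp add: ennreal_mult_less_top)
    ultimately show ?thesis by blast
  qed
  have pos: "0 < \<Psi> k" for k
  proof -
    have "0 < lq q {k - 1..<k} (sq a)" by (rule lq_weight_pos[OF a q, of "k - 1"]) simp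
    then have "0 < sq b (k - 1) * lq q {k - 1..<k} (sq a)"
      using rv_pos[OF b, of "ex (k - 1)"] by (simp add: ennreal_zero_less_mult_iff)
    also have "\<dots> \<le> \<Psi> k" unfolding \<Psi>_def by (rule lq_single[OF _ r]) simp
    finally show ?thesis .
  qed
  obtain E where E: "E < top" "\<And>i j. \<Psi> i \<le> E * ennreal (exp (1 * \<bar>real_of_int (i - j)\<bar>)) * \<Psi> j"
    using shift[OF zero_less_one] by blast
  have up: "(\<lambda>(_::unit) y. \<Phi> (exp y)) \<lessapprox> (\<lambda>_ y. \<Psi> \<lfloor>y\<rfloor>)"
  proof -
    obtain A where A: "A < top" "\<And>S I g G. S \<in> sets lebesgue \<Longrightarrow>
       (\<forall>u\<in>S. 0 < u \<and> \<lfloor>ln u\<rfloor> \<in> I \<and> g u \<le> G \<lfloor>ln u\<rfloor>) \<Longrightarrow>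
       wnorm 0 q a S g \<le> A * lq q I (\<lambda>i. wt 0 a i * G i)"
      using wnorm_le_lq[OF a q, of 0] by blast
    obtain B where B: "B < top" "\<And>S I g G. S \<in> sets lebesgue \<Longrightarrow>
       (\<forall>u\<in>S. 0 < u \<and> \<lfloor>ln u\<rfloor> \<in> I \<and> g u \<le> G \<lfloor>ln u\<rfloor>) \<Longrightarrow>
       wnorm 0 r b S g \<le> B * lq r I (\<lambda>i. wt 0 b i * G i)"
      using wnorm_le_lq[OF b r, of 0] by blast
    have in1: "wnorm 0 q a {s<..<exp y} (\<lambda>_. 1) \<le> A * lq q {\<lfloor>ln s\<rfloor>..<\<lfloor>y\<rfloor> + 1} (sq a)" if "0 < s" for s y
    proof -
      have "wnorm 0 q a {s<..<exp y} (\<lambda>_. 1) \<le> A * lq q {\<lfloor>ln s\<rfloor>..<\<lfloor>y\<rfloor> + 1} (\<lambda>i. wt 0 a i * 1)"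
      proof (rule A(2))
        show "\<forall>u\<in>{s<..<exp y}. 0 < u \<and> \<lfloor>ln u\<rfloor> \<in> {\<lfloor>ln s\<rfloor>..<\<lfloor>y\<rfloor> + 1} \<and> 1 \<le> (1::ennreal)"
          using that floor_ln_less(1) by (auto intro!: floor_mono)
      qed simp
      then show ?thesis by simp
    qed
    have "\<Phi> (exp y) \<le> B * lq r {..<\<lfloor>y\<rfloor> + 1} (\<lambda>i. wt 0 b i * (A * lq q {i..<\<lfloor>y\<rfloor> + 1} (sq a)))" for y
      unfolding \<Phi>_def
      by (rule B(2)) (use in1 floor_ln_less(1) in auto)
    then have "\<Phi> (exp y) \<le> B * A * \<Psi> (\<lfloor>y\<rfloor> + 1)" for y
      unfolding \<Psi>_def using r by (simp add: mult.left_commute[of _ A] lq_cmult mult.assoc)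
    also have "B * A * \<Psi> (\<lfloor>y\<rfloor> + 1) \<le> B * A * (E * ennreal (exp 1) * \<Psi> \<lfloor>y\<rfloor>)" for y
      using E(2)[of "\<lfloor>y\<rfloor> + 1" "\<lfloor>y\<rfloor>"] by (intro mult_left_mono) auto
    finally show ?thesis
      using A B E by (intro lesI[of "B * A * (E * ennreal (exp 1))"]) (auto simp: ennreal_mult_less_top mult.assoc)
  qed
  have lo: "(\<lambda>(_::unit) y. \<Psi> \<lfloor>y\<rfloor>) \<lessapprox> (\<lambda>_ y. \<Phi> (exp y))"
  proof -
    obtain A where A: "A < top" "\<And>S I g G. S \<in> sets lebesgue \<Longrightarrow>
       (\<forall>i\<in>I. \<forall>u. ex i < u \<longrightarrow> u < ex (i + 1) \<longrightarrow> u \<in> S \<and> G i \<le> g u) \<Longrightarrow>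
       lq q I (\<lambda>i. wt 0 a i * G i) \<le> A * wnorm 0 q a S g"
      using lq_le_wnorm[OF a q, of 0] by blast
    have sr: "sreg (\<lambda>(_::unit). sq a)" using sreg_reg[OF reg_rv[OF a]] .
    obtain C where C: "C < top" "\<And>k. lq q {fst k..<snd k - 1} (sq a) \<le> C * lq q {fst k + 1..<snd k} (sq a)"
    proof -
      have "(\<lambda>(p::unit) k. lq q {fst k..<snd k - 1} (sq a)) \<lessapprox> (\<lambda>p k. lq q {fst k + 1..<snd k} (sq a))"
        by (rule lq_sreg_shift[OF q sr, of "- 1"]) auto
      then show thesis by (rule lesE) (rule that)
    qed
    have CA: "C * A < top" using A C by (simp add: ennreal_mult_less_top)
    obtain B where B: "B < top" "\<And>S I g G. S \<in> sets lebesgue \<Longrightarrow>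
       (\<forall>i\<in>I. \<forall>u. ex i < u \<longrightarrow> u < ex (i + 1) \<longrightarrow> u \<in> S \<and> G i \<le> (C * A) * g u) \<Longrightarrow>
       lq r I (\<lambda>i. wt 0 b i * G i) \<le> B * wnorm 0 r b S g"
      using lq_le_wnorm_mult[OF b r CA, of 0] by blast
    \<comment> \<open>For \<open>u\<close> in block \<open>i\<close>, only the blocks from
      \<open>i + 1\<close> on are sure to lie to the right of \<open>u\<close>. The inner sum over
      \<open>{i + 1..<\<lfloor>y\<rfloor>}\<close> is compared with its shift by one block, which
      produces \<open>\<Psi>\<close> at \<open>\<lfloor>y\<rfloor> - 1\<close>; the constant
      \<open>E\<close> leads back to \<open>\<lfloor>y\<rfloor>\<close>.\<close>
    have "lq r {..<\<lfloor>y\<rfloor> - 1} (\<lambda>i. wt 0 b i * lq q {i..<\<lfloor>y\<rfloor> - 1} (sq a)) \<le> B * \<Phi> (exp y)" for y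
      unfolding \<Phi>_def
    proof (rule B(2), simp, intro ballI allI impI conjI)
      fix i u assume i: "i \<in> {..<\<lfloor>y\<rfloor> - 1}" and u: "ex i < u" "u < ex (i + 1)"
      have "0 < u" using u(1) exp_gt_zero less_trans by blast
      moreover have "u < exp y" by (rule ex_le_exp(1)[OF _ u(2)]) (use i in auto)
      ultimately show "u \<in> {0<..<exp y}" by simp
      have "lq q {i + 1..<\<lfloor>y\<rfloor>} (\<lambda>i. wt 0 a i * 1) \<le> A * wnorm 0 q a {u<..<exp y} (\<lambda>_. 1)"
      proof (rule A(2), simp, intro ballI allI impI conjI)
        fix l v assume l: "l \<in> {i + 1..<\<lfloor>y\<rfloor>}" and v: "ex l < v" "v < ex (l + 1)"
        have "v < exp y" by (rule ex_le_exp(1)[OF _ v(2)]) (use l in auto)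
        moreover have "ex (i + 1) \<le> ex l" using l by auto
        then have "u < v" using less_le_trans[OF u(2)] less_trans v(1) by blast
        ultimately show "v \<in> {u<..<exp y}" by simp
      qed auto
      then have "C * lq q {i + 1..<\<lfloor>y\<rfloor>} (sq a) \<le> C * (A * wnorm 0 q a {u<..<exp y} (\<lambda>_. 1))"
        by (intro mult_left_mono) simp_all
      then show "lq q {i..<\<lfloor>y\<rfloor> - 1} (sq a) \<le> C * A * wnorm 0 q a {u<..<exp y} (\<lambda>_. 1)"
        using C(2)[of "(i, \<lfloor>y\<rfloor>)"] by (simp add: mult.assoc)
    qed
    then have "\<Psi> (\<lfloor>y\<rfloor> - 1) \<le> B * \<Phi> (exp y)" for y
      unfolding \<Psi>_def by simp
    then have "(E * ennreal (exp 1)) * \<Psi> (\<lfloor>y\<rfloor> - 1) \<le> (E * ennreal (exp 1)) * (B * \<Phi> (exp y))" for y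
      by (intro mult_left_mono) auto
    moreover have "\<Psi> \<lfloor>y\<rfloor> \<le> (E * ennreal (exp 1)) * \<Psi> (\<lfloor>y\<rfloor> - 1)" for y
      using E(2)[of "\<lfloor>y\<rfloor>" "\<lfloor>y\<rfloor> - 1"] by simp
    ultimately have "\<Psi> \<lfloor>y\<rfloor> \<le> (E * ennreal (exp 1)) * B * \<Phi> (exp y)" for y
      using order_trans by (metis (no_types, lifting) mult.assoc)
    then show ?thesis
      using B E by (intro lesI[of "E * ennreal (exp 1) * B"]) (auto simp: ennreal_mult_less_top)
  qed
  have fin': "\<Phi> 1 < top" using fin by (simp add: \<Phi>_def)
  note * = rv_enn2real[OF up lo shift pos fin']
  show "rv 0 X" using *(1) unfolding X_def \<Phi>_def .
  have eq: "ennreal (X t) = \<Phi> t" if "0 < t" for t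
    using *(2)[OF _ that] unfolding X_def \<Phi>_def .
  show "(\<lambda>(p::unit) k. sq X k) \<lessapprox> (\<lambda>p k. \<Psi> k)"
    using les_pre[OF up, where m="\<lambda>p k. real_of_int k"] by (simp add: eq)
  show "(\<lambda>(p::unit) k. \<Psi> k) \<lessapprox> (\<lambda>p k. sq X k)"
    using les_pre[OF lo, where m="\<lambda>p k. real_of_int k"] by (simp add: eq)
  show "wnorm 0 r b {0<..<1} (\<lambda>_. 1) < top"
  proof -
    have fin0: "\<Psi> 0 < top"
    proof -
      obtain C where "C < top" "\<And>p y. \<Psi> \<lfloor>y\<rfloor> \<le> C * \<Phi> (exp y)" using lo by (rule lesE) (rule that)
      from this(2)[of 0] show ?thesis using \<open>C < top\<close> fin'
        by (simp add: ennreal_mult_less_top le_less_trans)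
    qed
    have "sq a (- 1) * lq r {..<0} (sq b) = lq r {..<0} (\<lambda>j. sq b j * sq a (- 1))"
      using r by (simp add: lq_cmult[symmetric] mult.commute)
    also have "\<dots> \<le> \<Psi> 0"
      unfolding \<Psi>_def by (intro lq_mono mult_left_mono lq_single r q) auto
    finally have "sq a (- 1) * lq r {..<0} (sq b) < top" using fin0 by simp
    moreover have "0 < sq a (- 1)" using rv_pos[OF a, of "ex (- 1)"] by simp
    ultimately have "lq r {..<0} (sq b) < top"
      by (metis ennreal_mult_top less_irrefl not_less_iff_gr_or_eq top.not_eq_extremum)
    moreover have "(\<lambda>(p::unit) y. wnorm 0 r b {0<..<exp y} (\<lambda>_. 1)) \<lessapprox> (\<lambda>p y. lq r {..<\<lfloor>y\<rfloor>} (sq b))"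
      using wnorm_L_les[OF b r reg_1, of 0] by simp
    then obtain C where "C < top" "\<And>y. wnorm 0 r b {0<..<exp y} (\<lambda>_. 1) \<le> C * lq r {..<\<lfloor>y\<rfloor>} (sq b)"
      by (rule lesE) (rule that)
    ultimately show ?thesis
      using \<open>\<And>y. wnorm 0 r b {0<..<exp y} (\<lambda>_. 1) \<le> C * lq r {..<\<lfloor>y\<rfloor>} (sq b)\<close>[of 0]
      by (simp add: ennreal_mult_less_top le_less_trans)
  qed
qed

subsection \<open>The discretised functionals\<close>

text \<open>There is no constant besides the exponential: \<open>S\<close> will depend on
  \<open>f\<close>, and a constant of its own would spoil the uniformity.\<close>

definition slow :: "real \<Rightarrow> (int \<Rightarrow> ennreal) \<Rightarrow> bool" where
  "slow \<sigma> S \<longleftrightarrow> (\<forall>i j. S i \<le> ennreal (exp (\<sigma> * \<bar>real_of_int (i - j)\<bar>)) * S j)"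

lemma slow_const: "slow 0 (\<lambda>_. c)"
  by (simp add: slow_def)

lemma slow_cmult: "slow \<sigma> S \<Longrightarrow> slow \<sigma> (\<lambda>i. c * S i)"
  unfolding slow_def by (simp add: mult.left_commute mult_left_mono)

text \<open>On the side of \<open>k\<close> where \<open>w\<close> decreases, it decays faster than
  \<open>S\<close> can grow, so the whole sum is controlled by the term at \<open>k\<close>. With a
  constant \<open>S\<close> this serves Holmstedt's formula, with an envelope it serves Hardy's
  inequalities.\<close>

lemma lq_rv_slow:
  assumes w: "rv \<kappa> w" and q: "0 < q" and s: "\<sigma> < \<bar>\<kappa>\<bar>"
  shows "\<exists>C<top. \<forall>I k y S. (\<forall>i\<in>I. \<kappa> * real_of_int (i - k) \<le> 0) \<longrightarrow> slow \<sigma> S \<longrightarrow>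
     (\<forall>i\<in>I. y i \<le> sq w i * S i) \<longrightarrow> lq q I y \<le> C * (sq w k * S k)"
proof -
  \<comment> \<open>Of the decay rate \<open>\<bar>\<kappa>\<bar>\<close> the weight loses
    \<open>\<epsilon>\<close> and \<open>S\<close> takes \<open>\<sigma>\<close>; exactly
    \<open>\<epsilon>\<close> remains.\<close>
  define \<epsilon> where "\<epsilon> = (\<bar>\<kappa>\<bar> - \<sigma>) / 2"
  have e: "0 < \<epsilon>" using s by (simp add: \<epsilon>_def)
  obtain A where A: "A < top" "\<And>i j. sq w i \<le> A * ennreal (exp (\<kappa> * real_of_int (i - j) + \<epsilon> * \<bar>real_of_int (i - j)\<bar>)) * sq w j"
    using sq_le_exp[OF w e] by blast
  obtain B where B: "B < top" "\<And>I k y Z. (\<forall>i\<in>I. y i \<le> ennreal (exp (- \<epsilon> * \<bar>real_of_int (i - k)\<bar>)) * Z) \<Longrightarrow> lq q I y \<le> B * Z"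
    using lq_geometric[OF q e] by blast
  have "lq q I y \<le> B * A * (sq w k * S k)"
    if I: "\<forall>i\<in>I. \<kappa> * real_of_int (i - k) \<le> 0" and S: "slow \<sigma> S" and y: "\<forall>i\<in>I. y i \<le> sq w i * S i" for I k y S
  proof -
    have "lq q I y \<le> B * (A * (sq w k * S k))"
    proof (rule B(2), rule ballI)
      fix i assume i: "i \<in> I"
      let ?d = "\<bar>real_of_int (i - k)\<bar>"
      have neg: "\<kappa> * real_of_int (i - k) = - (\<bar>\<kappa>\<bar> * ?d)"
        using I i by (simp only: abs_mult[symmetric]) (simp add: abs_of_nonpos)
      have "\<kappa> * real_of_int (i - k) + \<epsilon> * ?d + \<sigma> * ?d = - \<epsilon> * ?d"
        unfolding neg \<epsilon>_def by (simp add: field_simps)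
      then have ee: "ennreal (exp (\<kappa> * real_of_int (i - k) + \<epsilon> * ?d)) * ennreal (exp (\<sigma> * ?d)) = ennreal (exp (- \<epsilon> * ?d))"
        by (simp only: ennreal_mult[symmetric] exp_ge_zero exp_add[symmetric])
      have "y i \<le> sq w i * S i" using y i by blast
      also have "\<dots> \<le> (A * ennreal (exp (\<kappa> * real_of_int (i - k) + \<epsilon> * ?d)) * sq w k) * (ennreal (exp (\<sigma> * ?d)) * S k)"
        using S unfolding slow_def by (intro mult_mono A) auto
      also have "\<dots> = (ennreal (exp (\<kappa> * real_of_int (i - k) + \<epsilon> * ?d)) * ennreal (exp (\<sigma> * ?d))) * (A * (sq w k * S k))"
        by (simp only: ac_simps)
      finally show "y i \<le> ennreal (exp (- \<epsilon> * ?d)) * (A * (sq w k * S k))" unfolding ee .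
    qed
    then show ?thesis by (simp add: mult.assoc)
  qed
  moreover have "B * A < top" using A B by (simp add: ennreal_mult_less_top)
  ultimately show ?thesis by blast
qed

lemma rv_near_seq:
  assumes "rv \<kappa> w"
  shows "\<exists>C<top. \<forall>k. sq w k \<le> C * sq w (k - 1)"
proof -
  obtain C where C: "C < top" "\<And>s t. 0 < s \<Longrightarrow> 0 < t \<Longrightarrow> \<bar>ln s - ln t\<bar> \<le> 1 \<Longrightarrow> ennreal (w s) \<le> C * ennreal (w t)"
    using rv_near[OF assms] by blast
  have "sq w k \<le> C * sq w (k - 1)" for k by (rule C(2)) auto
  with C(1) show ?thesis by blast
qed

text \<open>In the application \<open>B\<close> is the tail norm of \<open>\<beta>0\<close>,
  \<open>D\<close> the head norm of \<open>\<beta>1\<close> and \<open>X\<close> the function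
  \<open>\<chi>1\<close>. They enter only up to equivalence with their discrete
  counterparts.\<close>

locale weights =
  fixes \<theta>0 :: real and q0 r0 q1 r1 :: ennreal and \<alpha>0 \<beta>0 \<alpha>1 \<beta>1 B D X :: "real \<Rightarrow> real"
  assumes exponents: "0 < q0" "0 < r0" "0 < q1" "0 < r1" and \<theta>0: "0 < \<theta>0" "\<theta>0 < 1"
    and rv: "rv 0 \<alpha>0" "rv 0 \<beta>0" "rv 0 \<alpha>1" "rv 0 \<beta>1" "rv 0 B" "rv 0 D" "rv 0 X"
    and B_les: "(\<lambda>(p::unit) k. sq B k) \<lessapprox> (\<lambda>p k. lq r0 {k..} (sq \<beta>0))"
    and les_B: "(\<lambda>(p::unit) k. lq r0 {k..} (sq \<beta>0)) \<lessapprox> (\<lambda>p k. sq B k)"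
    and D_les: "(\<lambda>(p::unit) k. sq D k) \<lessapprox> (\<lambda>p k. lq r1 {..<k} (sq \<beta>1))"
    and les_D: "(\<lambda>(p::unit) k. lq r1 {..<k} (sq \<beta>1)) \<lessapprox> (\<lambda>p k. sq D k)"
    and X_les: "(\<lambda>(p::unit) k. sq X k) \<lessapprox> (\<lambda>p k. lq r1 {..<k} (\<lambda>j. sq \<beta>1 j * lq q1 {j..<k} (sq \<alpha>1)))"
    and les_X: "(\<lambda>(p::unit) k. lq r1 {..<k} (\<lambda>j. sq \<beta>1 j * lq q1 {j..<k} (sq \<alpha>1))) \<lessapprox> (\<lambda>p k. sq X k)"
begin

definition g0 :: "real \<Rightarrow> real" where "g0 t = t powr (- \<theta>0) * \<alpha>0 t"
definition g1 :: "real \<Rightarrow> real" where "g1 t = t powr (- 1) * \<alpha>1 t"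
text \<open>Agrees with \<open>\<rho>\<close> at positive arguments; the power
  \<open>- \<theta>0\<close> is hidden in \<open>g0\<close>.\<close>

definition R :: "real \<Rightarrow> real" where "R t = t * g0 t * B t / X t"

lemma rv_id: "rv 1 (\<lambda>t. t)"
  by (rule rv_cong[OF rv_power[of 1]]) simp

lemma rv_g0: "rv (- \<theta>0) g0"
  using rv_mult[OF rv_power[of "- \<theta>0"] rv(1)] by (simp add: g0_def[abs_def])

lemma rv_g1: "rv (- 1) g1"
  using rv_mult[OF rv_power[of "- 1"] rv(3)] by (simp add: g1_def[abs_def])

lemma rv_R: "rv (1 - \<theta>0) R"
  using rv_divide[OF rv_mult[OF rv_mult[OF rv_id rv_g0] rv(5)] rv(7)] by (simp add: R_def[abs_def])

definition U :: "(int \<Rightarrow> ennreal) \<Rightarrow> int \<Rightarrow> ennreal" where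
  "U x k = lq q0 {..<k} (\<lambda>i. sq g0 i * x i)"
definition V :: "(int \<Rightarrow> ennreal) \<Rightarrow> int \<Rightarrow> ennreal" where
  "V x k = lq q1 {k..} (\<lambda>i. sq g1 i * x i)"
text \<open>Up to constants, \<open>P x k\<close> is the norm \<open>N0\<close> of \<open>\<lambda>i. x (min i k)\<close> and \<open>Q x k\<close> is the norm \<open>N1\<close> of \<open>x\<close>
  made linear to the left of \<open>k\<close>, except for the contribution of that linear part.\<close>

definition P :: "(int \<Rightarrow> ennreal) \<Rightarrow> int \<Rightarrow> ennreal" where
  "P x k = lq r0 {..<k} (\<lambda>j. sq \<beta>0 j * U x j) + sq B k * U x k"
definition Q :: "(int \<Rightarrow> ennreal) \<Rightarrow> int \<Rightarrow> ennreal" where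
  "Q x k = sq D k * V x k + lq r1 {k..} (\<lambda>j. sq \<beta>1 j * V x j)"
definition N0 :: "(int \<Rightarrow> ennreal) \<Rightarrow> ennreal" where
  "N0 x = lq r0 UNIV (\<lambda>j. sq \<beta>0 j * U x j)"
definition N1 :: "(int \<Rightarrow> ennreal) \<Rightarrow> ennreal" where
  "N1 x = lq r1 UNIV (\<lambda>j. sq \<beta>1 j * V x j)"

lemma U_mono: "i \<le> j \<Longrightarrow> U x i \<le> U x j"
  unfolding U_def by (rule lq_mono_set) (use exponents in auto)

lemma V_mono: "i \<le> j \<Longrightarrow> V x j \<le> V x i"
  unfolding V_def by (rule lq_mono_set) (use exponents in auto)

lemma U_le:
  assumes "\<And>i. i < k \<Longrightarrow> y i \<le> M * x i" shows "U y k \<le> M * U x k"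
proof -
  have "U y k \<le> lq q0 {..<k} (\<lambda>i. M * (sq g0 i * x i))"
    unfolding U_def using exponents assms
    by (intro lq_mono) (auto simp: mult.left_commute[of M] intro!: mult_left_mono)
  then show ?thesis using exponents by (simp add: U_def lq_cmult)
qed

lemma V_le:
  assumes "\<And>i. k \<le> i \<Longrightarrow> y i \<le> M * x i" shows "V y k \<le> M * V x k"
proof -
  have "V y k \<le> lq q1 {k..} (\<lambda>i. M * (sq g1 i * x i))"
    unfolding V_def using exponents assms
    by (intro lq_mono) (auto simp: mult.left_commute[of M] intro!: mult_left_mono)
  then show ?thesis using exponents by (simp add: V_def lq_cmult)
qed

lemma B_leE: obtains C where "C < top" "\<And>k. sq B k \<le> C * lq r0 {k..} (sq \<beta>0)"
  using B_les by (rule lesE) (rule that)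
lemma le_BE: obtains C where "C < top" "\<And>k. lq r0 {k..} (sq \<beta>0) \<le> C * sq B k"
  using les_B by (rule lesE) (rule that)
lemma D_leE: obtains C where "C < top" "\<And>k. sq D k \<le> C * lq r1 {..<k} (sq \<beta>1)"
  using D_les by (rule lesE) (rule that)
lemma le_DE: obtains C where "C < top" "\<And>k. lq r1 {..<k} (sq \<beta>1) \<le> C * sq D k"
  using les_D by (rule lesE) (rule that)
lemma X_leE: obtains C where "C < top" "\<And>k. sq X k \<le> C * lq r1 {..<k} (\<lambda>j. sq \<beta>1 j * lq q1 {j..<k} (sq \<alpha>1))"
  using X_les by (rule lesE) (rule that)
lemma le_XE: obtains C where "C < top" "\<And>k. lq r1 {..<k} (\<lambda>j. sq \<beta>1 j * lq q1 {j..<k} (sq \<alpha>1)) \<le> C * sq X k"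
  using les_X by (rule lesE) (rule that)

lemma \<beta>0_le_B: obtains C where "C < top" "\<And>k. sq \<beta>0 k \<le> C * sq B k"
proof -
  obtain C where C: "C < top" "\<And>k. lq r0 {k..} (sq \<beta>0) \<le> C * sq B k" by (rule le_BE) (rule that)
  have "sq \<beta>0 k \<le> C * sq B k" for k
    using lq_single[of k "{k..}" r0 "sq \<beta>0"] exponents C(2)[of k] by (simp add: order_trans)
  with C(1) show thesis by (rule that)
qed

text \<open>Of the inner sum over \<open>{j..<k}\<close> in \<open>X\<close> only the term at
  \<open>k - 1\<close> is kept, which is present for every \<open>j < k\<close>; one doubling step
  moves \<open>\<alpha>1\<close> from \<open>k - 1\<close> to \<open>k\<close>.\<close>

lemma \<alpha>1_D_le_X: obtains C where "C < top" "\<And>k. sq \<alpha>1 k * sq D k \<le> C * sq X k"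
proof -
  obtain C where C: "C < top" "\<And>k. lq r1 {..<k} (\<lambda>j. sq \<beta>1 j * lq q1 {j..<k} (sq \<alpha>1)) \<le> C * sq X k"
    by (rule le_XE) (rule that)
  obtain A where A: "A < top" "\<And>k. sq D k \<le> A * lq r1 {..<k} (sq \<beta>1)" by (rule D_leE) (rule that)
  obtain E where E: "E < top" "\<And>k. sq \<alpha>1 k \<le> E * sq \<alpha>1 (k - 1)" using rv_near_seq[OF rv(3)] by blast
  have "sq \<alpha>1 k * sq D k \<le> (E * A * C) * sq X k" for k
  proof -
    have "sq \<alpha>1 k * sq D k \<le> (E * sq \<alpha>1 (k - 1)) * (A * lq r1 {..<k} (sq \<beta>1))"
      by (intro mult_mono A E) auto
    also have "\<dots> = E * A * lq r1 {..<k} (\<lambda>j. sq \<alpha>1 (k - 1) * sq \<beta>1 j)"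
      using exponents by (simp only: lq_cmult) (simp only: ac_simps)
    also have "\<dots> \<le> E * A * lq r1 {..<k} (\<lambda>j. sq \<beta>1 j * lq q1 {j..<k} (sq \<alpha>1))"
      using exponents by (subst mult.commute[of "sq \<alpha>1 (k - 1)"]) (intro mult_left_mono lq_mono lq_single, auto)
    also have "\<dots> \<le> E * A * (C * sq X k)" by (intro mult_left_mono C) auto
    finally show ?thesis by (simp add: mult.assoc)
  qed
  moreover have "E * A * C < top" using A C E by (simp add: ennreal_mult_less_top)
  ultimately show thesis using that by blast
qed

lemma \<alpha>1_\<beta>1_le_X: obtains C where "C < top" "\<And>k. sq \<alpha>1 k * sq \<beta>1 k \<le> C * sq X k"
proof -
  obtain C where C: "C < top" "\<And>k. sq \<alpha>1 k * sq D k \<le> C * sq X k" by (rule \<alpha>1_D_le_X) (rule that)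
  obtain A where A: "A < top" "\<And>k. lq r1 {..<k} (sq \<beta>1) \<le> A * sq D k" by (rule le_DE) (rule that)
  obtain E where E: "E < top" "\<And>k. sq \<beta>1 k \<le> E * sq \<beta>1 (k - 1)" using rv_near_seq[OF rv(4)] by blast
  have "sq \<alpha>1 k * sq \<beta>1 k \<le> (E * A * C) * sq X k" for k
  proof -
    have "sq \<beta>1 (k - 1) \<le> lq r1 {..<k} (sq \<beta>1)" using exponents by (intro lq_single) auto
    then have "sq \<beta>1 (k - 1) \<le> A * sq D k" using A(2)[of k] by (rule order_trans)
    then have "E * sq \<beta>1 (k - 1) \<le> E * (A * sq D k)" by (rule mult_left_mono) simp
    with E(2)[of k] have "sq \<beta>1 k \<le> E * (A * sq D k)" by (rule order_trans)
    then have "sq \<alpha>1 k * sq \<beta>1 k \<le> sq \<alpha>1 k * (E * (A * sq D k))" by (rule mult_left_mono) simp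
    also have "\<dots> = E * A * (sq \<alpha>1 k * sq D k)" by (simp only: ac_simps)
    also have "\<dots> \<le> E * A * (C * sq X k)" by (intro mult_left_mono C) auto
    finally show ?thesis by (simp add: mult.assoc)
  qed
  moreover have "E * A * C < top" using A C E by (simp add: ennreal_mult_less_top)
  ultimately show thesis using that by blast
qed

text \<open>\<open>B k\<close> is the norm of \<open>\<beta>0\<close> over the tail from
  \<open>k\<close> on, where \<open>U x\<close> is at least \<open>U x k\<close>. Hence the second
  summand of \<open>P\<close> is dominated by the tail of \<open>N0\<close>. The bound of
  \<open>Q\<close> by \<open>N1\<close> is the mirror image.\<close>

lemma P_le_N0: obtains C where "C < top" "\<And>x k. P x k \<le> C * N0 x"
proof -
  obtain A where A: "A < top" "\<And>k. sq B k \<le> A * lq r0 {k..} (sq \<beta>0)" by (rule B_leE) (rule that)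
  have "P x k \<le> (1 + A) * N0 x" for x k
  proof -
    have 1: "lq r0 {..<k} (\<lambda>j. sq \<beta>0 j * U x j) \<le> N0 x"
      unfolding N0_def by (rule lq_mono_set) (use exponents in auto)
    have "sq B k * U x k \<le> (A * lq r0 {k..} (sq \<beta>0)) * U x k" by (intro mult_right_mono A) auto
    also have "\<dots> = A * lq r0 {k..} (\<lambda>j. U x k * sq \<beta>0 j)"
      using exponents by (simp only: lq_cmult) (simp only: ac_simps)
    also have "\<dots> \<le> A * N0 x"
      unfolding N0_def using exponents U_mono
      by (intro mult_left_mono lq_mono_set) (auto simp: mult.commute[of "U x k"] intro!: mult_left_mono)
    finally show ?thesis using 1 unfolding P_def by (simp add: distrib_right add_mono)
  qed
  moreover have "1 + A < top" using A by simp
  ultimately show thesis using that by blast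
qed

lemma Q_le_N1: obtains C where "C < top" "\<And>x k. Q x k \<le> C * N1 x"
proof -
  obtain A where A: "A < top" "\<And>k. sq D k \<le> A * lq r1 {..<k} (sq \<beta>1)" by (rule D_leE) (rule that)
  have "Q x k \<le> (A + 1) * N1 x" for x k
  proof -
    have 1: "lq r1 {k..} (\<lambda>j. sq \<beta>1 j * V x j) \<le> N1 x"
      unfolding N1_def by (rule lq_mono_set) (use exponents in auto)
    have "sq D k * V x k \<le> (A * lq r1 {..<k} (sq \<beta>1)) * V x k" by (intro mult_right_mono A) auto
    also have "\<dots> = A * lq r1 {..<k} (\<lambda>j. V x k * sq \<beta>1 j)"
      using exponents by (simp only: lq_cmult) (simp only: ac_simps)
    also have "\<dots> \<le> A * N1 x"
      unfolding N1_def using exponents V_mono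
      by (intro mult_left_mono lq_mono_set) (auto simp: mult.commute[of "V x k"] intro!: mult_left_mono)
    finally show ?thesis using 1 unfolding Q_def by (simp add: distrib_right add_mono)
  qed
  moreover have "A + 1 < top" using A by simp
  ultimately show thesis using that by blast
qed

text \<open>The sum in \<open>U x k\<close> stops at \<open>k - 1\<close>; the value at
  \<open>k\<close> is reached by the doubling step that is assumed of \<open>x\<close>. The second
  bound is the pointwise control of \<open>K\<close> by the first space.\<close>

lemma P_point:
  assumes M: "M < top"
  obtains C where "C < top" "\<And>x k. x k \<le> M * x (k - 1) \<Longrightarrow> sq g0 k * x k \<le> C * U x k"
    "\<And>x k. x k \<le> M * x (k - 1) \<Longrightarrow> sq B k * (sq g0 k * x k) \<le> C * P x k"
proof -
  obtain E where E: "E < top" "\<And>k. sq g0 k \<le> E * sq g0 (k - 1)" using rv_near_seq[OF rv_g0] by blast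
  have 1: "sq g0 k * x k \<le> (E * M) * U x k" if "x k \<le> M * x (k - 1)" for x k
  proof -
    have "sq g0 k * x k \<le> (E * sq g0 (k - 1)) * (M * x (k - 1))" by (intro mult_mono E that) auto
    also have "\<dots> = E * M * (sq g0 (k - 1) * x (k - 1))" by (simp only: ac_simps)
    also have "\<dots> \<le> E * M * U x k"
      unfolding U_def using exponents
      by (intro mult_left_mono lq_single[of "k - 1" _ _ "\<lambda>i. sq g0 i * x i"]) auto
    finally show ?thesis .
  qed
  have 2: "sq B k * (sq g0 k * x k) \<le> (E * M) * P x k" if "x k \<le> M * x (k - 1)" for x k
  proof -
    have "sq B k * (sq g0 k * x k) \<le> sq B k * (E * M * U x k)" by (intro mult_left_mono 1 that) auto
    also have "\<dots> = E * M * (sq B k * U x k)" by (simp only: ac_simps)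
    also have "\<dots> \<le> E * M * P x k" unfolding P_def by (intro mult_left_mono) auto
    finally show ?thesis .
  qed
  have "E * M < top" using E M by (simp add: ennreal_mult_less_top)
  then show thesis using that 1 2 by blast
qed

text \<open>The hypothesis says that to the left of \<open>k\<close> the sequence lies above the
  linear one with the same value at \<open>k\<close>. As \<open>g1\<close> times a linear sequence
  is a multiple of \<open>\<alpha>1\<close>, the norm of that linear part is \<open>X k\<close>
  times its slope.\<close>

lemma N1_point:
  obtains C where "C < top" "\<And>x k. (\<And>i. i \<le> k \<Longrightarrow> sq (\<lambda>t. 1 / t) k * x k \<le> sq (\<lambda>t. 1 / t) i * x i) \<Longrightarrow>
    sq X k * (sq (\<lambda>t. 1 / t) k * x k) \<le> C * N1 x"
proof -
  obtain A where A: "A < top" "\<And>k. sq X k \<le> A * lq r1 {..<k} (\<lambda>j. sq \<beta>1 j * lq q1 {j..<k} (sq \<alpha>1))"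
    by (rule X_leE) (rule that)
  have "sq X k * (sq (\<lambda>t. 1 / t) k * x k) \<le> A * N1 x"
    if x: "\<And>i. i \<le> k \<Longrightarrow> sq (\<lambda>t. 1 / t) k * x k \<le> sq (\<lambda>t. 1 / t) i * x i" for x k
  proof -
    let ?z = "sq (\<lambda>t. 1 / t) k * x k"
    have g: "sq g1 i = sq \<alpha>1 i * sq (\<lambda>t. 1 / t) i" for i
      using rv_pos[OF rv(3), of "ex i"]
      by (simp add: ennreal_mult[symmetric] g1_def powr_def exp_minus divide_inverse mult.commute)
    have "sq X k * ?z \<le> (A * lq r1 {..<k} (\<lambda>j. sq \<beta>1 j * lq q1 {j..<k} (sq \<alpha>1))) * ?z"
      by (intro mult_right_mono A) auto
    also have "\<dots> = A * lq r1 {..<k} (\<lambda>j. sq \<beta>1 j * lq q1 {j..<k} (\<lambda>i. ?z * sq \<alpha>1 i))"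
    proof -
      have "sq \<beta>1 j * (?z * y) = ?z * (sq \<beta>1 j * y)" for j y by (rule mult.left_commute)
      then have "lq r1 {..<k} (\<lambda>j. sq \<beta>1 j * lq q1 {j..<k} (\<lambda>i. ?z * sq \<alpha>1 i))
          = ?z * lq r1 {..<k} (\<lambda>j. sq \<beta>1 j * lq q1 {j..<k} (sq \<alpha>1))"
        using exponents by (simp only: lq_cmult)
      then show ?thesis by (simp only: ac_simps)
    qed
    also have "\<dots> \<le> A * N1 x"
      unfolding N1_def
    proof (intro mult_left_mono lq_mono_set)
      fix j assume "j \<in> {..<k}"
      show "lq q1 {j..<k} (\<lambda>i. ?z * sq \<alpha>1 i) \<le> V x j"
        unfolding V_def
      proof (rule lq_mono_set)
        fix i assume "i \<in> {j..<k}"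
        then show "?z * sq \<alpha>1 i \<le> sq g1 i * x i"
          using mult_left_mono[OF x[of i], of "sq \<alpha>1 i"] by (simp add: g mult.commute mult.left_commute)
      qed (use exponents in auto)
    qed (use exponents in auto)
    finally show ?thesis .
  qed
  with A(1) show thesis by (rule that)
qed

text \<open>Meant for the component in \<open>A0\<close>, whose \<open>K\<close>-functional stops
  growing at \<open>k\<close>. Since \<open>0 < \<theta>0\<close>, the sum of \<open>g0\<close> over
  \<open>i \<ge> k\<close> is geometric, so \<open>U y\<close> remains bounded by a multiple of
  \<open>U x k\<close> beyond \<open>k\<close>, and the outer tail contributes
  \<open>B k\<close>.\<close>

lemma N0_truncate:
  assumes M: "M < top"
  obtains C where "C < top" "\<And>x y k. (\<And>i. y i \<le> M * x (min i k)) \<Longrightarrow> x k \<le> M * x (k - 1) \<Longrightarrow> N0 y \<le> C * P x k"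
proof -
  obtain E where E: "E < top" "\<And>x k. x k \<le> M * x (k - 1) \<Longrightarrow> sq g0 k * x k \<le> E * U x k"
    using P_point[OF M] by metis
  obtain A where A: "A < top" "\<And>I k y S. (\<forall>i\<in>I. - \<theta>0 * real_of_int (i - k) \<le> 0) \<Longrightarrow> slow 0 S \<Longrightarrow>
     (\<forall>i\<in>I. y i \<le> sq g0 i * S i) \<Longrightarrow> lq q0 I y \<le> A * (sq g0 k * S k)"
    using lq_rv_slow[OF rv_g0 exponents(1), of 0] \<theta>0 by auto
  obtain F where F: "F < top" "\<And>k. lq r0 {k..} (sq \<beta>0) \<le> F * sq B k" by (rule le_BE) (rule that)
  obtain G where G: "G < top" "\<And>I J x. lq q0 (I \<union> J) x \<le> G * (lq q0 I x + lq q0 J x)"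
    using lq_Un[OF exponents(1)] by blast
  obtain H where H: "H < top" "\<And>I J x. lq r0 (I \<union> J) x \<le> H * (lq r0 I x + lq r0 J x)"
    using lq_Un[OF exponents(2)] by blast
  define L where "L = G * (M + A * (M * E))"
  define C where "C = H * (M + L * F)"
  have "N0 y \<le> C * P x k" if y: "\<And>i. y i \<le> M * x (min i k)" and x: "x k \<le> M * x (k - 1)" for x y k
  proof -
    have UN: "{..<k} \<union> {k..} = (UNIV :: int set)" by auto
    have Ulow: "U y j \<le> M * U x j" if "j \<le> k" for j
    proof (rule U_le)
      fix i assume "i < j"
      then have "min i k = i" using that by simp
      then show "y i \<le> M * x i" using y[of i] by simp
    qed
    have Uhigh: "U y j \<le> L * U x k" if "k \<le> j" for j
    proof -
      have "U y j \<le> G * (U y k + lq q0 {k..<j} (\<lambda>i. sq g0 i * y i))"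
        using G(2)[of "{..<k}" "{k..<j}" "\<lambda>i. sq g0 i * y i"] that
        by (simp add: U_def ivl_disj_un)
      also have "lq q0 {k..<j} (\<lambda>i. sq g0 i * y i) \<le> A * (sq g0 k * (M * x k))"
      proof (rule A(2)[OF _ slow_const])
        show "\<forall>i\<in>{k..<j}. - \<theta>0 * real_of_int (i - k) \<le> 0" using \<theta>0 by simp
        show "\<forall>i\<in>{k..<j}. sq g0 i * y i \<le> sq g0 i * (M * x k)"
        proof
          fix i assume "i \<in> {k..<j}"
          then have "min i k = k" by simp
          then show "sq g0 i * y i \<le> sq g0 i * (M * x k)" using y[of i] by (intro mult_left_mono) auto
        qed
      qed
      also have "\<dots> = A * (M * (sq g0 k * x k))" by (simp only: ac_simps)
      also have "\<dots> \<le> A * (M * (E * U x k))" by (intro mult_left_mono E x) auto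
      finally have "U y j \<le> G * (U y k + A * (M * (E * U x k)))"
        by (simp add: add_mono mult_left_mono)
      also have "\<dots> \<le> G * (M * U x k + A * (M * (E * U x k)))"
        by (intro mult_left_mono add_mono Ulow) auto
      finally show ?thesis by (simp add: L_def distrib_right mult.assoc)
    qed
    have "N0 y \<le> H * (lq r0 {..<k} (\<lambda>j. sq \<beta>0 j * U y j) + lq r0 {k..} (\<lambda>j. sq \<beta>0 j * U y j))"
      using H(2)[of "{..<k}" "{k..}" "\<lambda>j. sq \<beta>0 j * U y j"]
      by (simp only: N0_def UN)
    also have "lq r0 {..<k} (\<lambda>j. sq \<beta>0 j * U y j) \<le> lq r0 {..<k} (\<lambda>j. M * (sq \<beta>0 j * U x j))"
      using exponents Ulow by (intro lq_mono) (auto simp: mult.left_commute[of M] intro!: mult_left_mono)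
    also have "\<dots> = M * lq r0 {..<k} (\<lambda>j. sq \<beta>0 j * U x j)"
      using exponents by (simp add: lq_cmult)
    also have "lq r0 {k..} (\<lambda>j. sq \<beta>0 j * U y j) \<le> lq r0 {k..} (\<lambda>j. (L * U x k) * sq \<beta>0 j)"
      using exponents Uhigh by (intro lq_mono) (auto simp: mult.commute[of _ "sq \<beta>0 _"] intro!: mult_left_mono)
    also have "\<dots> = L * U x k * lq r0 {k..} (sq \<beta>0)" using exponents by (simp add: lq_cmult)
    also have "\<dots> \<le> L * U x k * (F * sq B k)" by (intro mult_left_mono F) auto
    finally have "N0 y \<le> H * (M * lq r0 {..<k} (\<lambda>j. sq \<beta>0 j * U x j) + L * U x k * (F * sq B k))"
      by (simp add: add_mono mult_left_mono)
    also have "\<dots> \<le> H * (M * P x k + L * F * P x k)"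
    proof (intro mult_left_mono add_mono)
      have "L * U x k * (F * sq B k) = L * F * (sq B k * U x k)" by (simp only: ac_simps)
      also have "\<dots> \<le> L * F * P x k" unfolding P_def by (intro mult_left_mono) auto
      finally show "L * U x k * (F * sq B k) \<le> L * F * P x k" .
    qed (auto simp: P_def)
    finally show ?thesis by (simp add: C_def distrib_right mult.assoc)
  qed
  moreover have "C < top" using M A E F G H unfolding C_def L_def by (simp add: ennreal_mult_less_top)
  ultimately show thesis using that by blast
qed

text \<open>Meant for the component in \<open>A1\<close>, whose \<open>K\<close>-functional is at
  most linear to the left of \<open>k\<close>. There \<open>g1 * y\<close> is bounded by
  \<open>\<alpha>1\<close> times the slope and nothing decays: the double sum over
  \<open>j \<le> i < k\<close> is the one that \<open>X\<close> records. The part of the inner sum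
  from \<open>k\<close> on does not depend on \<open>j\<close> and gives
  \<open>D k * V x k\<close>.\<close>

lemma N1_truncate:
  assumes M: "M < top"
  obtains C where "C < top" "\<And>x y k. (\<And>i. k \<le> i \<Longrightarrow> y i \<le> M * x i) \<Longrightarrow>
    (\<And>i. i \<le> k \<Longrightarrow> sq (\<lambda>t. 1 / t) i * y i \<le> M * (sq (\<lambda>t. 1 / t) k * x k)) \<Longrightarrow>
    N1 y \<le> C * (Q x k + sq X k * (sq (\<lambda>t. 1 / t) k * x k))"
proof -
  obtain E where E: "E < top" "\<And>k. lq r1 {..<k} (\<lambda>j. sq \<beta>1 j * lq q1 {j..<k} (sq \<alpha>1)) \<le> E * sq X k"
    by (rule le_XE) (rule that)
  obtain F where F: "F < top" "\<And>k. lq r1 {..<k} (sq \<beta>1) \<le> F * sq D k" by (rule le_DE) (rule that)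
  obtain G where G: "G < top" "\<And>I J x. lq q1 (I \<union> J) x \<le> G * (lq q1 I x + lq q1 J x)"
    using lq_Un[OF exponents(3)] by blast
  obtain H where H: "H < top" "\<And>I J x. lq r1 (I \<union> J) x \<le> H * (lq r1 I x + lq r1 J x)"
    using lq_Un[OF exponents(4)] by blast
  obtain A where A: "A < top" "\<And>I x y. lq r1 I (\<lambda>i. x i + y i) \<le> A * (lq r1 I x + lq r1 I y)"
    using lq_add[OF exponents(4)] by blast
  define L where "L = A * (G * M)"
  define C where "C = H * (L * (E + F) + M)"
  have "N1 y \<le> C * (Q x k + sq X k * (sq (\<lambda>t. 1 / t) k * x k))"
    if y: "\<And>i. k \<le> i \<Longrightarrow> y i \<le> M * x i"
      and y': "\<And>i. i \<le> k \<Longrightarrow> sq (\<lambda>t. 1 / t) i * y i \<le> M * (sq (\<lambda>t. 1 / t) k * x k)" for x y k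
  proof -
    let ?z = "sq (\<lambda>t. 1 / t) k * x k"
    have UN: "{..<k} \<union> {k..} = (UNIV :: int set)" by auto
    have Vhigh: "V y j \<le> M * V x j" if "k \<le> j" for j
      by (rule V_le) (use y that in auto)
    have g: "sq g1 i = sq \<alpha>1 i * sq (\<lambda>t. 1 / t) i" for i
      using rv_pos[OF rv(3), of "ex i"]
      by (simp add: ennreal_mult[symmetric] g1_def powr_def exp_minus divide_inverse mult.commute)
    have Vlow: "V y j \<le> G * M * (?z * lq q1 {j..<k} (sq \<alpha>1) + V x k)" if "j < k" for j
    proof -
      have "V y j \<le> G * (lq q1 {j..<k} (\<lambda>i. sq g1 i * y i) + V y k)"
        using G(2)[of "{j..<k}" "{k..}" "\<lambda>i. sq g1 i * y i"] that
        by (simp add: V_def ivl_disj_un)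
      also have "lq q1 {j..<k} (\<lambda>i. sq g1 i * y i) \<le> lq q1 {j..<k} (\<lambda>i. M * ?z * sq \<alpha>1 i)"
      proof (rule lq_mono)
        fix i assume "i \<in> {j..<k}"
        then show "sq g1 i * y i \<le> M * ?z * sq \<alpha>1 i"
          using mult_left_mono[OF y'[of i], of "sq \<alpha>1 i"] by (simp add: g mult.assoc mult.commute mult.left_commute)
      qed (use exponents in auto)
      also have "\<dots> = M * ?z * lq q1 {j..<k} (sq \<alpha>1)" using exponents by (simp add: lq_cmult)
      finally have "V y j \<le> G * (M * ?z * lq q1 {j..<k} (sq \<alpha>1) + V y k)"
        by (simp add: add_mono mult_left_mono)
      also have "\<dots> \<le> G * (M * ?z * lq q1 {j..<k} (sq \<alpha>1) + M * V x k)"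
        by (intro mult_left_mono add_mono Vhigh) auto
      finally show ?thesis by (simp add: distrib_left mult.assoc)
    qed
    have "N1 y \<le> H * (lq r1 {..<k} (\<lambda>j. sq \<beta>1 j * V y j) + lq r1 {k..} (\<lambda>j. sq \<beta>1 j * V y j))"
      using H(2)[of "{..<k}" "{k..}" "\<lambda>j. sq \<beta>1 j * V y j"]
      by (simp only: N1_def UN)
    also have "lq r1 {k..} (\<lambda>j. sq \<beta>1 j * V y j) \<le> lq r1 {k..} (\<lambda>j. M * (sq \<beta>1 j * V x j))"
      using exponents Vhigh by (intro lq_mono) (auto simp: mult.left_commute[of M] intro!: mult_left_mono)
    also have "\<dots> = M * lq r1 {k..} (\<lambda>j. sq \<beta>1 j * V x j)"
      using exponents by (simp add: lq_cmult)
    also have "lq r1 {..<k} (\<lambda>j. sq \<beta>1 j * V y j)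
      \<le> lq r1 {..<k} (\<lambda>j. G * M * ?z * (sq \<beta>1 j * lq q1 {j..<k} (sq \<alpha>1)) + G * M * V x k * sq \<beta>1 j)"
    proof (rule lq_mono)
      fix j assume "j \<in> {..<k}"
      then have "sq \<beta>1 j * V y j \<le> sq \<beta>1 j * (G * M * (?z * lq q1 {j..<k} (sq \<alpha>1) + V x k))"
        by (intro mult_left_mono Vlow) auto
      also have "\<dots> = G * M * ?z * (sq \<beta>1 j * lq q1 {j..<k} (sq \<alpha>1)) + G * M * V x k * sq \<beta>1 j"
        by (simp only: distrib_left ac_simps)
      finally show "sq \<beta>1 j * V y j \<le> \<dots>" .
    qed (use exponents in auto)
    also have "\<dots> \<le> A * (lq r1 {..<k} (\<lambda>j. G * M * ?z * (sq \<beta>1 j * lq q1 {j..<k} (sq \<alpha>1))) + lq r1 {..<k} (\<lambda>j. G * M * V x k * sq \<beta>1 j))"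
      by (rule A(2))
    also have "\<dots> = A * (G * M * ?z * lq r1 {..<k} (\<lambda>j. sq \<beta>1 j * lq q1 {j..<k} (sq \<alpha>1)) + G * M * V x k * lq r1 {..<k} (sq \<beta>1))"
      using exponents by (simp add: lq_cmult)
    also have "\<dots> \<le> A * (G * M * ?z * (E * sq X k) + G * M * V x k * (F * sq D k))"
      by (intro mult_left_mono add_mono E F) auto
    also have "\<dots> = L * (E * (sq X k * ?z) + F * (sq D k * V x k))"
      unfolding L_def by (simp only: distrib_left ac_simps)
    also have "\<dots> \<le> L * (E * (Q x k + sq X k * ?z) + F * (Q x k + sq X k * ?z))"
      by (intro mult_left_mono add_mono) (auto simp: Q_def intro: add_increasing2 add_increasing)
    finally have "N1 y \<le> H * (L * (E * (Q x k + sq X k * ?z) + F * (Q x k + sq X k * ?z)) + M * lq r1 {k..} (\<lambda>j. sq \<beta>1 j * V x j))"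
      by (simp add: add_mono mult_left_mono)
    also have "\<dots> \<le> H * (L * (E * (Q x k + sq X k * ?z) + F * (Q x k + sq X k * ?z)) + M * (Q x k + sq X k * ?z))"
      by (intro mult_left_mono add_mono) (auto simp: Q_def intro: add_increasing2 add_increasing)
    also have "\<dots> = C * (Q x k + sq X k * ?z)"
      unfolding C_def by (simp only: distrib_right mult.assoc)
    finally show ?thesis .
  qed
  moreover have "C < top" using M A E F G H unfolding C_def L_def by (simp add: ennreal_mult_less_top)
  ultimately show thesis using that by blast
qed

text \<open>A positive index makes the inner sum over \<open>i < j\<close> and the outer sum over
  \<open>j < k\<close> geometric, controlled by their right ends. The outer sum produces
  \<open>\<beta>0 k\<close>, which is dominated by \<open>B k\<close>.\<close>

lemma P_geometric:
  assumes w: "rv \<kappa> w" and k: "0 < \<kappa>" "\<sigma> < \<kappa>"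
  obtains C where "C < top" "\<And>x S k. slow \<sigma> S \<Longrightarrow> (\<And>i. sq g0 i * x i \<le> sq w i * S i) \<Longrightarrow>
    P x k \<le> C * (sq (\<lambda>t. B t * w t) k * S k)"
proof -
  have s: "\<sigma> < \<bar>\<kappa>\<bar>" using k by simp
  obtain A where A: "A < top" "\<And>I k y S. (\<forall>i\<in>I. \<kappa> * real_of_int (i - k) \<le> 0) \<Longrightarrow> slow \<sigma> S \<Longrightarrow>
     (\<forall>i\<in>I. y i \<le> sq w i * S i) \<Longrightarrow> lq q0 I y \<le> A * (sq w k * S k)"
    using lq_rv_slow[OF w exponents(1) s] by blast
  have bw: "rv \<kappa> (\<lambda>t. \<beta>0 t * w t)" using rv_mult[OF rv(2) w] by simp
  obtain E where E: "E < top" "\<And>I k y S. (\<forall>i\<in>I. \<kappa> * real_of_int (i - k) \<le> 0) \<Longrightarrow> slow \<sigma> S \<Longrightarrow>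
     (\<forall>i\<in>I. y i \<le> sq (\<lambda>t. \<beta>0 t * w t) i * S i) \<Longrightarrow> lq r0 I y \<le> E * (sq (\<lambda>t. \<beta>0 t * w t) k * S k)"
    using lq_rv_slow[OF bw exponents(2) s] by blast
  obtain F where F: "F < top" "\<And>k. sq \<beta>0 k \<le> F * sq B k" by (rule \<beta>0_le_B) (rule that)
  have "P x k \<le> (E * A * F + A) * (sq (\<lambda>t. B t * w t) k * S k)"
    if S: "slow \<sigma> S" and x: "\<And>i. sq g0 i * x i \<le> sq w i * S i" for x S k
  proof -
    have neg: "\<forall>i\<in>{..<j}. \<kappa> * real_of_int (i - j) \<le> 0" for j using k by (simp add: mult_nonneg_nonpos)
    have U: "U x j \<le> A * (sq w j * S j)" for j
      unfolding U_def by (rule A(2)[OF neg S]) (use x in blast)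
    have "lq r0 {..<k} (\<lambda>j. sq \<beta>0 j * U x j) \<le> E * (sq (\<lambda>t. \<beta>0 t * w t) k * (A * S k))"
    proof (rule E(2)[OF neg slow_cmult[OF S]], rule ballI)
      fix j
      have "sq \<beta>0 j * U x j \<le> sq \<beta>0 j * (A * (sq w j * S j))" by (intro mult_left_mono U) auto
      also have "\<dots> = (sq \<beta>0 j * sq w j) * (A * S j)" by (simp only: ac_simps)
      finally show "sq \<beta>0 j * U x j \<le> sq (\<lambda>t. \<beta>0 t * w t) j * (A * S j)"
        unfolding sq_mult[OF rv(2) w] .
    qed
    also have "\<dots> = E * A * (sq \<beta>0 k * (sq w k * S k))"
      unfolding sq_mult[OF rv(2) w, symmetric] by (simp only: ac_simps)
    also have "\<dots> \<le> E * A * ((F * sq B k) * (sq w k * S k))"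
      by (intro mult_left_mono mult_right_mono F) auto
    also have "\<dots> = E * A * F * (sq (\<lambda>t. B t * w t) k * S k)"
      unfolding sq_mult[OF rv(5) w, symmetric] by (simp only: ac_simps)
    finally have 1: "lq r0 {..<k} (\<lambda>j. sq \<beta>0 j * U x j) \<le> \<dots>" .
    have "sq B k * U x k \<le> sq B k * (A * (sq w k * S k))" by (intro mult_left_mono U) auto
    also have "\<dots> = A * (sq (\<lambda>t. B t * w t) k * S k)"
      unfolding sq_mult[OF rv(5) w, symmetric] by (simp only: ac_simps)
    finally show ?thesis unfolding P_def distrib_right using 1 by (intro add_mono)
  qed
  moreover have "E * A * F + A < top" using A E F by (simp add: ennreal_mult_less_top)
  ultimately show thesis using that by blast
qed

text \<open>With a negative index the tail sums are controlled by their left ends and produce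
  \<open>D * w\<close> and \<open>\<beta>1 * w\<close>. Both \<open>D\<close> and
  \<open>\<beta>1\<close> are dominated by \<open>X / \<alpha>1\<close>, which explains the form of
  the bound.\<close>

lemma Q_geometric:
  assumes w: "rv \<kappa> w" and k: "\<kappa> < 0" "\<sigma> < - \<kappa>"
  obtains C where "C < top" "\<And>x S k. slow \<sigma> S \<Longrightarrow> (\<And>i. sq g1 i * x i \<le> sq w i * S i) \<Longrightarrow>
    Q x k \<le> C * (sq (\<lambda>t. X t * w t / \<alpha>1 t) k * S k)"
proof -
  have s: "\<sigma> < \<bar>\<kappa>\<bar>" using k by simp
  obtain A where A: "A < top" "\<And>I k y S. (\<forall>i\<in>I. \<kappa> * real_of_int (i - k) \<le> 0) \<Longrightarrow> slow \<sigma> S \<Longrightarrow>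
     (\<forall>i\<in>I. y i \<le> sq w i * S i) \<Longrightarrow> lq q1 I y \<le> A * (sq w k * S k)"
    using lq_rv_slow[OF w exponents(3) s] by blast
  have bw: "rv \<kappa> (\<lambda>t. \<beta>1 t * w t)" using rv_mult[OF rv(4) w] by simp
  obtain E where E: "E < top" "\<And>I k y S. (\<forall>i\<in>I. \<kappa> * real_of_int (i - k) \<le> 0) \<Longrightarrow> slow \<sigma> S \<Longrightarrow>
     (\<forall>i\<in>I. y i \<le> sq (\<lambda>t. \<beta>1 t * w t) i * S i) \<Longrightarrow> lq r1 I y \<le> E * (sq (\<lambda>t. \<beta>1 t * w t) k * S k)"
    using lq_rv_slow[OF bw exponents(4) s] by blast
  obtain F where F: "F < top" "\<And>k. sq \<alpha>1 k * sq D k \<le> F * sq X k" by (rule \<alpha>1_D_le_X) (rule that)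
  obtain G where G: "G < top" "\<And>k. sq \<alpha>1 k * sq \<beta>1 k \<le> G * sq X k" by (rule \<alpha>1_\<beta>1_le_X) (rule that)
  have ia: "rv 0 (\<lambda>t. 1 / \<alpha>1 t)"
  proof -
    have "rv 0 (\<lambda>_. 1)" by (rule rvI) (auto intro!: exI[of _ 0])
    from rv_divide[OF this rv(3)] show ?thesis by simp
  qed
  have one: "sq (\<lambda>t. 1 / \<alpha>1 t) k * sq \<alpha>1 k = 1" for k
    using rv_pos[OF rv(3), of "ex k"] by (subst sq_mult[OF ia rv(3)]) simp
  have div: "y \<le> (c * sq X k) * sq (\<lambda>t. 1 / \<alpha>1 t) k" if "sq \<alpha>1 k * y \<le> c * sq X k" for y c k
  proof -
    have "y = sq (\<lambda>t. 1 / \<alpha>1 t) k * (sq \<alpha>1 k * y)" by (simp only: mult.assoc[symmetric] one mult_1)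
    also have "\<dots> \<le> sq (\<lambda>t. 1 / \<alpha>1 t) k * (c * sq X k)" by (intro mult_left_mono that) auto
    finally show ?thesis by (simp only: mult.commute)
  qed
  have Xw: "sq X k * sq (\<lambda>t. 1 / \<alpha>1 t) k * sq w k = sq (\<lambda>t. X t * w t / \<alpha>1 t) k" for k
    unfolding sq_mult[OF rv(7) ia] using sq_mult[OF rv_mult[OF rv(7) ia] w, of k] by simp
  have "Q x k \<le> (A * F + E * A * G) * (sq (\<lambda>t. X t * w t / \<alpha>1 t) k * S k)"
    if S: "slow \<sigma> S" and x: "\<And>i. sq g1 i * x i \<le> sq w i * S i" for x S k
  proof -
    have neg: "\<forall>i\<in>{j..}. \<kappa> * real_of_int (i - j) \<le> 0" for j using k by (simp add: mult_nonpos_nonneg)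
    have V: "V x j \<le> A * (sq w j * S j)" for j
      unfolding V_def by (rule A(2)[OF neg S]) (use x in blast)
    have "lq r1 {k..} (\<lambda>j. sq \<beta>1 j * V x j) \<le> E * (sq (\<lambda>t. \<beta>1 t * w t) k * (A * S k))"
    proof (rule E(2)[OF neg slow_cmult[OF S]], rule ballI)
      fix j
      have "sq \<beta>1 j * V x j \<le> sq \<beta>1 j * (A * (sq w j * S j))" by (intro mult_left_mono V) auto
      also have "\<dots> = (sq \<beta>1 j * sq w j) * (A * S j)" by (simp only: ac_simps)
      finally show "sq \<beta>1 j * V x j \<le> sq (\<lambda>t. \<beta>1 t * w t) j * (A * S j)"
        unfolding sq_mult[OF rv(4) w] .
    qed
    also have "\<dots> = E * A * (sq \<beta>1 k * (sq w k * S k))"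
      unfolding sq_mult[OF rv(4) w, symmetric] by (simp only: ac_simps)
    also have "\<dots> \<le> E * A * (((G * sq X k) * sq (\<lambda>t. 1 / \<alpha>1 t) k) * (sq w k * S k))"
      by (intro mult_left_mono mult_right_mono div G) auto
    also have "\<dots> = E * A * G * (sq (\<lambda>t. X t * w t / \<alpha>1 t) k * S k)"
      unfolding Xw[symmetric] by (simp only: ac_simps)
    finally have 1: "lq r1 {k..} (\<lambda>j. sq \<beta>1 j * V x j) \<le> \<dots>" .
    have "sq D k * V x k \<le> ((F * sq X k) * sq (\<lambda>t. 1 / \<alpha>1 t) k) * (A * (sq w k * S k))"
      by (rule mult_mono[OF div V]) (auto intro: F)
    also have "\<dots> = A * F * (sq (\<lambda>t. X t * w t / \<alpha>1 t) k * S k)"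
      unfolding Xw[symmetric] by (simp only: ac_simps)
    finally show ?thesis unfolding Q_def distrib_right using 1 by (intro add_mono)
  qed
  moreover have "A * F + E * A * G < top" using A E F G by (simp add: ennreal_mult_less_top)
  ultimately show thesis using that by blast
qed

lemma P_add:
  assumes M: "M < top"
  obtains C where "C < top" "\<And>x y z k. (\<And>i. z i \<le> M * (x i + y i)) \<Longrightarrow> P z k \<le> C * (P x k + P y k)"
proof -
  obtain A where A: "A < top" "\<And>I x y. lq q0 I (\<lambda>i. x i + y i) \<le> A * (lq q0 I x + lq q0 I y)"
    using lq_add[OF exponents(1)] by blast
  obtain E where E: "E < top" "\<And>I x y. lq r0 I (\<lambda>i. x i + y i) \<le> E * (lq r0 I x + lq r0 I y)"
    using lq_add[OF exponents(2)] by blast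
  have "P z k \<le> (M * A * (E + 1)) * (P x k + P y k)" if z: "\<And>i. z i \<le> M * (x i + y i)" for x y z k
  proof -
    have U: "U z j \<le> M * A * (U x j + U y j)" for j
    proof -
      have "U z j \<le> M * U (\<lambda>i. x i + y i) j" by (rule U_le[OF z])
      also have "\<dots> \<le> M * (A * (U x j + U y j))"
        unfolding U_def using A(2)[of "{..<j}" "\<lambda>i. sq g0 i * x i" "\<lambda>i. sq g0 i * y i"]
        by (intro mult_left_mono) (simp_all add: distrib_left)
      finally show ?thesis by (simp add: mult.assoc)
    qed
    have "lq r0 {..<k} (\<lambda>j. sq \<beta>0 j * U z j) \<le> lq r0 {..<k} (\<lambda>j. M * A * (sq \<beta>0 j * U x j + sq \<beta>0 j * U y j))"
    proof (rule lq_mono)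
      fix j
      have "sq \<beta>0 j * U z j \<le> sq \<beta>0 j * (M * A * (U x j + U y j))" by (intro mult_left_mono U) auto
      then show "sq \<beta>0 j * U z j \<le> M * A * (sq \<beta>0 j * U x j + sq \<beta>0 j * U y j)"
        by (simp only: distrib_left ac_simps)
    qed (use exponents in auto)
    also have "\<dots> \<le> M * A * (E * (lq r0 {..<k} (\<lambda>j. sq \<beta>0 j * U x j) + lq r0 {..<k} (\<lambda>j. sq \<beta>0 j * U y j)))"
      using exponents by (subst lq_cmult) (auto intro!: mult_left_mono E)
    also have "\<dots> \<le> M * A * (E * (P x k + P y k))"
      unfolding P_def by (intro mult_left_mono add_mono) auto
    finally have 1: "lq r0 {..<k} (\<lambda>j. sq \<beta>0 j * U z j) \<le> \<dots>" .
    have "sq B k * U z k \<le> sq B k * (M * A * (U x k + U y k))" by (intro mult_left_mono U) auto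
    also have "\<dots> = M * A * (sq B k * U x k + sq B k * U y k)" by (simp only: distrib_left ac_simps)
    also have "\<dots> \<le> M * A * (P x k + P y k)"
      unfolding P_def by (intro mult_left_mono add_mono) auto
    finally have "P z k \<le> M * A * (E * (P x k + P y k)) + M * A * (P x k + P y k)"
      unfolding P_def[of z] using 1 by (intro add_mono)
    then show ?thesis by (simp add: distrib_left distrib_right ac_simps)
  qed
  moreover have "M * A * (E + 1) < top" using A E M by (simp add: ennreal_mult_less_top)
  ultimately show thesis using that by blast
qed

lemma Q_add:
  assumes M: "M < top"
  obtains C where "C < top" "\<And>x y z k. (\<And>i. z i \<le> M * (x i + y i)) \<Longrightarrow> Q z k \<le> C * (Q x k + Q y k)"
proof -
  obtain A where A: "A < top" "\<And>I x y. lq q1 I (\<lambda>i. x i + y i) \<le> A * (lq q1 I x + lq q1 I y)"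
    using lq_add[OF exponents(3)] by blast
  obtain E where E: "E < top" "\<And>I x y. lq r1 I (\<lambda>i. x i + y i) \<le> E * (lq r1 I x + lq r1 I y)"
    using lq_add[OF exponents(4)] by blast
  have "Q z k \<le> (M * A * (1 + E)) * (Q x k + Q y k)" if z: "\<And>i. z i \<le> M * (x i + y i)" for x y z k
  proof -
    have V: "V z j \<le> M * A * (V x j + V y j)" for j
    proof -
      have "V z j \<le> M * V (\<lambda>i. x i + y i) j" by (rule V_le[OF z])
      also have "\<dots> \<le> M * (A * (V x j + V y j))"
        unfolding V_def using A(2)[of "{j..}" "\<lambda>i. sq g1 i * x i" "\<lambda>i. sq g1 i * y i"]
        by (intro mult_left_mono) (simp_all add: distrib_left)
      finally show ?thesis by (simp add: mult.assoc)
    qed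
    have "lq r1 {k..} (\<lambda>j. sq \<beta>1 j * V z j) \<le> lq r1 {k..} (\<lambda>j. M * A * (sq \<beta>1 j * V x j + sq \<beta>1 j * V y j))"
    proof (rule lq_mono)
      fix j
      have "sq \<beta>1 j * V z j \<le> sq \<beta>1 j * (M * A * (V x j + V y j))" by (intro mult_left_mono V) auto
      then show "sq \<beta>1 j * V z j \<le> M * A * (sq \<beta>1 j * V x j + sq \<beta>1 j * V y j)"
        by (simp only: distrib_left ac_simps)
    qed (use exponents in auto)
    also have "\<dots> \<le> M * A * (E * (lq r1 {k..} (\<lambda>j. sq \<beta>1 j * V x j) + lq r1 {k..} (\<lambda>j. sq \<beta>1 j * V y j)))"
      using exponents by (subst lq_cmult) (auto intro!: mult_left_mono E)
    also have "\<dots> \<le> M * A * (E * (Q x k + Q y k))"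
      unfolding Q_def by (intro mult_left_mono add_mono) auto
    finally have 1: "lq r1 {k..} (\<lambda>j. sq \<beta>1 j * V z j) \<le> \<dots>" .
    have "sq D k * V z k \<le> sq D k * (M * A * (V x k + V y k))" by (intro mult_left_mono V) auto
    also have "\<dots> = M * A * (sq D k * V x k + sq D k * V y k)" by (simp only: distrib_left ac_simps)
    also have "\<dots> \<le> M * A * (Q x k + Q y k)"
      unfolding Q_def by (intro mult_left_mono add_mono) auto
    finally have "Q z k \<le> M * A * (Q x k + Q y k) + M * A * (E * (Q x k + Q y k))"
      unfolding Q_def[of z] using 1 by (intro add_mono)
    then show ?thesis by (simp add: distrib_left distrib_right ac_simps)
  qed
  moreover have "M * A * (1 + E) < top" using A E M by (simp add: ennreal_mult_less_top)
  ultimately show thesis using that by blast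
qed

end

subsection \<open>The K-functional\<close>

text \<open>The constant \<open>C + 1\<close> has a reciprocal, by which it is moved past the
  infimum; this also covers an empty \<open>S\<close> and \<open>C = 0\<close>.\<close>

lemma ennreal_le_cmult_Inf:
  fixes C x :: ennreal
  assumes "\<And>v. v \<in> S \<Longrightarrow> x \<le> C * v" "C < top"
  shows "x \<le> (C + 1) * Inf S"
proof -
  obtain c where c: "c * (C + 1) = (1::ennreal)" using ennreal_recip[OF assms(2)] by blast
  have "c * x \<le> Inf S"
  proof (rule Inf_greatest)
    fix v assume "v \<in> S"
    then have "x \<le> C * v" by (rule assms(1))
    also have "\<dots> \<le> (C + 1) * v" by (intro mult_right_mono) auto
    finally have "c * x \<le> c * ((C + 1) * v)" by (rule mult_left_mono) simp
    then show "c * x \<le> v" using c by (simp add: mult.assoc[symmetric])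
  qed
  then have "(C + 1) * (c * x) \<le> (C + 1) * Inf S" by (rule mult_left_mono) simp
  moreover have "(C + 1) * (c * x) = x" using c by (simp add: mult.assoc[symmetric] mult.commute[of "C + 1" c])
  ultimately show ?thesis by simp
qed

lemma K_functional_le:
  "f0 \<in> carrier X0 \<Longrightarrow> f1 \<in> carrier X1 \<Longrightarrow>
    K_functional X0 X1 t (f0 + f1) \<le> ennreal (qnorm X0 f0 + t * qnorm X1 f1)"
  unfolding K_functional_def by (intro Inf_lower) blast

lemma K_functional_top: "f \<notin> sum_carrier X0 X1 \<Longrightarrow> K_functional X0 X1 t f = top"
proof -
  assume f: "f \<notin> sum_carrier X0 X1"
  then have "{ennreal (qnorm X0 f0 + t * qnorm X1 f1) |f0 f1. f0 \<in> carrier X0 \<and> f1 \<in> carrier X1 \<and> f = f0 + f1} = {}"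
    unfolding sum_carrier_def by blast
  then show ?thesis unfolding K_functional_def by (simp only: Inf_empty)
qed

lemma K_functional_mono:
  assumes "\<And>f. f \<in> carrier X1 \<Longrightarrow> 0 \<le> qnorm X1 f" "s \<le> t"
  shows "K_functional X0 X1 s f \<le> K_functional X0 X1 t f"
  unfolding K_functional_def
proof (rule Inf_mono)
  fix b assume "b \<in> {ennreal (qnorm X0 f0 + t * qnorm X1 f1) |f0 f1. f0 \<in> carrier X0 \<and> f1 \<in> carrier X1 \<and> f = f0 + f1}"
  then obtain f0 f1 where f: "b = ennreal (qnorm X0 f0 + t * qnorm X1 f1)" "f0 \<in> carrier X0" "f1 \<in> carrier X1" "f = f0 + f1"
    by blast
  have "ennreal (qnorm X0 f0 + s * qnorm X1 f1) \<le> b"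
    unfolding f(1) using assms f by (intro ennreal_leI add_left_mono mult_right_mono) auto
  with f show "\<exists>a\<in>{ennreal (qnorm X0 f0 + s * qnorm X1 f1) |f0 f1. f0 \<in> carrier X0 \<and> f1 \<in> carrier X1 \<and> f = f0 + f1}. a \<le> b"
    by blast
qed

text \<open>Multiplying the cost of a decomposition at \<open>t\<close> by \<open>s / t\<close>
  turns the part in \<open>X1\<close> into its cost at \<open>s\<close> and does not increase the
  part in \<open>X0\<close>.\<close>

lemma K_functional_quot_mono:
  assumes nonneg: "\<And>f. f \<in> carrier X0 \<Longrightarrow> 0 \<le> qnorm X0 f" "\<And>f. f \<in> carrier X1 \<Longrightarrow> 0 \<le> qnorm X1 f"
    and st: "0 < s" "s \<le> t"
  shows "ennreal (1 / t) * K_functional X0 X1 t f \<le> ennreal (1 / s) * K_functional X0 X1 s f"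
proof -
  have "ennreal (s / t) * K_functional X0 X1 t f \<le> K_functional X0 X1 s f"
    unfolding K_functional_def[of _ _ s]
  proof (rule Inf_greatest)
    fix b assume "b \<in> {ennreal (qnorm X0 f0 + s * qnorm X1 f1) |f0 f1. f0 \<in> carrier X0 \<and> f1 \<in> carrier X1 \<and> f = f0 + f1}"
    then obtain f0 f1 where f: "b = ennreal (qnorm X0 f0 + s * qnorm X1 f1)" "f0 \<in> carrier X0" "f1 \<in> carrier X1" "f = f0 + f1"
      by blast
    have n: "0 \<le> qnorm X0 f0" "0 \<le> qnorm X1 f1" using nonneg f by auto
    have "ennreal (s / t) * K_functional X0 X1 t f \<le> ennreal (s / t) * ennreal (qnorm X0 f0 + t * qnorm X1 f1)"
      unfolding f(4) by (intro mult_left_mono K_functional_le f) auto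
    also have "\<dots> = ennreal (s / t * qnorm X0 f0 + s * qnorm X1 f1)"
      using n st by (subst ennreal_mult[symmetric]) (auto simp: field_simps)
    also have "\<dots> \<le> b"
    proof -
      have "s / t * qnorm X0 f0 \<le> 1 * qnorm X0 f0" using st n by (intro mult_right_mono) auto
      then show ?thesis unfolding f(1) by (intro ennreal_leI) simp
    qed
    finally show "ennreal (s / t) * K_functional X0 X1 t f \<le> b" .
  qed
  then have "ennreal (1 / s) * (ennreal (s / t) * K_functional X0 X1 t f) \<le> ennreal (1 / s) * K_functional X0 X1 s f"
    by (rule mult_left_mono) simp
  moreover have "ennreal (1 / s) * ennreal (s / t) = ennreal (1 / t)"
    using st by (subst ennreal_mult[symmetric]) auto
  ultimately show ?thesis by (simp add: mult.assoc[symmetric])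
qed

lemma reg_K_functional:
  assumes nonneg: "\<And>f. f \<in> carrier X0 \<Longrightarrow> 0 \<le> qnorm X0 f" "\<And>f. f \<in> carrier X1 \<Longrightarrow> 0 \<le> qnorm X1 f"
  shows "reg (\<lambda>f u. K_functional X0 X1 u f)"
proof (rule regI)
  show "ennreal (exp 1) < top" by simp
  fix f and s t :: real assume st: "0 < s" "0 < t" "\<bar>ln s - ln t\<bar> \<le> 1"
  have "ln s \<le> ln (exp 1 * t)" using st by (simp add: ln_mult)
  then have "s \<le> exp 1 * t" using st by (subst (asm) ln_le_cancel_iff) auto
  then have "K_functional X0 X1 s f \<le> K_functional X0 X1 (exp 1 * t) f"
    by (intro K_functional_mono nonneg)
  also have "\<dots> = ennreal (exp 1 * t) * (ennreal (1 / (exp 1 * t)) * K_functional X0 X1 (exp 1 * t) f)"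
    using st by (simp add: mult.assoc[symmetric] ennreal_mult[symmetric])
  also have "\<dots> \<le> ennreal (exp 1 * t) * (ennreal (1 / t) * K_functional X0 X1 t f)"
  proof (intro mult_left_mono K_functional_quot_mono nonneg)
    have "1 * t \<le> exp 1 * t" using st by (intro mult_right_mono) auto
    then show "t \<le> exp 1 * t" by simp
  qed (use st in auto)
  also have "\<dots> = ennreal (exp 1) * K_functional X0 X1 t f"
    using st by (simp add: mult.assoc[symmetric] ennreal_mult[symmetric])
  finally show "K_functional X0 X1 s f \<le> ennreal (exp 1) * K_functional X0 X1 t f" .
qed

text \<open>A decomposition within a factor 2 of the infimum is obvious unless the infimum is 0, and
  that case is settled here by the Hausdorff topology. A nonzero \<open>f\<close> has a
  neighbourhood disjoint from some neighbourhood of 0; but if \<open>K\<close> vanishes,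
  \<open>f\<close> is a sum of two arbitrarily small elements, and continuity of addition puts it
  into the latter.\<close>

lemma K_functional_eq_0:
  assumes c: "compatible_couple A0 A1" and n: "quasi_normed A0" "quasi_normed A1"
    and t: "0 < t" and K: "K_functional A0 A1 t f = 0"
  shows "f = 0"
proof (rule ccontr)
  assume f: "f \<noteq> 0"
  obtain T where T: "hausdorff_tvs T" "embeds_in_topology A0 T" "embeds_in_topology A1 T"
    using c unfolding compatible_couple_def by blast
  have top: "topspace T = UNIV" using T(1) by (simp add: hausdorff_tvs_def)
  obtain O0 O1 where O: "openin T O0" "openin T O1" "0 \<in> O0" "f \<in> O1" "disjnt O0 O1"
    using T(1) f top unfolding hausdorff_tvs_def Hausdorff_space_def by (metis UNIV_I)
  have cont: "continuous_map (prod_topology T T) T (\<lambda>(x, y). x + y)"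
    using T(1) by (simp add: hausdorff_tvs_def)
  define Z where "Z = {p \<in> topspace (prod_topology T T). (\<lambda>(x, y). x + y) p \<in> O0}"
  have "openin (prod_topology T T) Z"
    unfolding Z_def by (rule openin_continuous_map_preimage[OF cont O(1)])
  moreover have "(0, 0) \<in> Z" using O(3) top by (simp add: Z_def)
  ultimately obtain V W where VW: "openin T V" "openin T W" "0 \<in> V" "0 \<in> W" "V \<times> W \<subseteq> Z"
    unfolding openin_prod_topology_alt by meson
  have z: "0 \<in> carrier A0" "0 \<in> carrier A1"
    using n by (auto simp: quasi_normed_def subspace_0)
  obtain d0 where d0: "0 < d0" "\<And>y. y \<in> carrier A0 \<Longrightarrow> qnorm A0 y < d0 \<Longrightarrow> y \<in> V"
    using T(2) z(1) VW(1,3) unfolding embeds_in_topology_def by (metis diff_zero)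
  obtain d1 where d1: "0 < d1" "\<And>y. y \<in> carrier A1 \<Longrightarrow> qnorm A1 y < d1 \<Longrightarrow> y \<in> W"
    using T(3) z(2) VW(2,4) unfolding embeds_in_topology_def by (metis diff_zero)
  have "K_functional A0 A1 t f < ennreal (min d0 (t * d1))" using K d0 d1 t by simp
  then obtain f0 f1 where f01: "f0 \<in> carrier A0" "f1 \<in> carrier A1" "f = f0 + f1"
      "ennreal (qnorm A0 f0 + t * qnorm A1 f1) < ennreal (min d0 (t * d1))"
    unfolding K_functional_def Inf_less_iff by blast
  have nn: "0 \<le> qnorm A0 f0" "0 \<le> qnorm A1 f1" using n f01 by (auto simp: quasi_normed_def)
  have lt: "qnorm A0 f0 + t * qnorm A1 f1 < min d0 (t * d1)"
    using f01(4) nn t by (subst (asm) ennreal_less_iff) auto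
  have "0 \<le> t * qnorm A1 f1" using nn t by simp
  then have "qnorm A0 f0 < d0" "t * qnorm A1 f1 < t * d1" using lt nn by linarith+
  then have "f0 \<in> V" "f1 \<in> W" using d0 d1 f01 t by auto
  then have "f \<in> O0" using VW(5) f01(3) by (auto simp: Z_def)
  then show False using O by (auto simp: disjnt_iff)
qed

lemma K_functional_decompose:
  assumes c: "compatible_couple A0 A1" and n: "quasi_normed A0" "quasi_normed A1"
    and t: "0 < t" and K: "K_functional A0 A1 t f < top"
  obtains f0 f1 where "f0 \<in> carrier A0" "f1 \<in> carrier A1" "f = f0 + f1"
    "ennreal (qnorm A0 f0 + t * qnorm A1 f1) \<le> 2 * K_functional A0 A1 t f"
proof (cases "K_functional A0 A1 t f = 0")
  case True
  then have "f = 0" by (rule K_functional_eq_0[OF c n t])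
  moreover have "0 \<in> carrier A0" "0 \<in> carrier A1" "qnorm A0 0 = 0" "qnorm A1 0 = 0"
    using n by (auto simp: quasi_normed_def subspace_0)
  ultimately show ?thesis using that[of 0 0] by simp
next
  case False
  have "K_functional A0 A1 t f < 2 * K_functional A0 A1 t f"
  proof -
    obtain r where r: "K_functional A0 A1 t f = ennreal r" "0 \<le> r" using K by (cases "K_functional A0 A1 t f") auto
    then have "0 < r" using False by simp
    then show ?thesis unfolding r(1) ennreal_numeral[symmetric] using r
      by (simp only: ennreal_mult[symmetric] zero_le_numeral) (simp add: ennreal_less_iff)
  qed
  then obtain f0 f1 where "f0 \<in> carrier A0" "f1 \<in> carrier A1" "f = f0 + f1"
      "ennreal (qnorm A0 f0 + t * qnorm A1 f1) < 2 * K_functional A0 A1 t f"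
    unfolding K_functional_def[of A0 A1 t f] Inf_less_iff by blast
  then show ?thesis using that by (simp add: less_imp_le)
qed

lemma quasi_normed_triangle:
  assumes "quasi_normed Y"
  shows "\<exists>C. \<forall>x\<in>carrier Y. \<forall>y\<in>carrier Y. qnorm Y (x + y) \<le> C * (qnorm Y x + qnorm Y y)"
  using assms unfolding quasi_normed_def by (elim conjE)

lemma K_functional_add:
  assumes c: "compatible_couple A0 A1" and n: "quasi_normed A0" "quasi_normed A1"
  obtains C where "C < top"
    "\<And>t f g. 0 < t \<Longrightarrow> K_functional A0 A1 t (f + g) \<le> C * (K_functional A0 A1 t f + K_functional A0 A1 t g)"
proof -
  obtain C0 where C0: "\<And>x y. x \<in> carrier A0 \<Longrightarrow> y \<in> carrier A0 \<Longrightarrow> qnorm A0 (x + y) \<le> C0 * (qnorm A0 x + qnorm A0 y)"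
    using quasi_normed_triangle[OF n(1)] by auto
  obtain C1 where C1: "\<And>x y. x \<in> carrier A1 \<Longrightarrow> y \<in> carrier A1 \<Longrightarrow> qnorm A1 (x + y) \<le> C1 * (qnorm A1 x + qnorm A1 y)"
    using quasi_normed_triangle[OF n(2)] by auto
  \<comment> \<open>The 1 makes the constant positive, so that an infinite right-hand side stays
    infinite after multiplication.\<close>
  define M where "M = max 1 (max C0 C1)"
  have nn: "x \<in> carrier A0 \<Longrightarrow> 0 \<le> qnorm A0 x" "x \<in> carrier A1 \<Longrightarrow> 0 \<le> qnorm A1 x" for x
    using n by (auto simp: quasi_normed_def)
  have "K_functional A0 A1 t (f + g) \<le> ennreal (2 * M) * (K_functional A0 A1 t f + K_functional A0 A1 t g)"
    if t: "0 < t" for t f g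
  proof (cases "K_functional A0 A1 t f = top \<or> K_functional A0 A1 t g = top")
    case True
    then have "ennreal (2 * M) * (K_functional A0 A1 t f + K_functional A0 A1 t g) = top"
      using ennreal_mult_top[of "ennreal (2 * M)"] by (auto simp: M_def)
    then show ?thesis by simp
  next
    case False
    then have fin: "K_functional A0 A1 t f < top" "K_functional A0 A1 t g < top" by (auto simp: less_top)
    obtain f0 f1 where f: "f0 \<in> carrier A0" "f1 \<in> carrier A1" "f = f0 + f1"
      "ennreal (qnorm A0 f0 + t * qnorm A1 f1) \<le> 2 * K_functional A0 A1 t f"
      by (rule K_functional_decompose[OF c n t fin(1)])
    obtain g0 g1 where g: "g0 \<in> carrier A0" "g1 \<in> carrier A1" "g = g0 + g1"
      "ennreal (qnorm A0 g0 + t * qnorm A1 g1) \<le> 2 * K_functional A0 A1 t g"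
      by (rule K_functional_decompose[OF c n t fin(2)])
    have sub: "subspace (carrier A0)" "subspace (carrier A1)" using n by (auto simp: quasi_normed_def)
    have fg: "f + g = (f0 + g0) + (f1 + g1)" using f g by simp
    have "K_functional A0 A1 t (f + g) \<le> ennreal (qnorm A0 (f0 + g0) + t * qnorm A1 (f1 + g1))"
      unfolding fg by (intro K_functional_le subspace_add sub f g)
    also have "\<dots> \<le> ennreal (M * ((qnorm A0 f0 + t * qnorm A1 f1) + (qnorm A0 g0 + t * qnorm A1 g1)))"
    proof (rule ennreal_leI)
      have "qnorm A0 (f0 + g0) \<le> M * (qnorm A0 f0 + qnorm A0 g0)"
        by (rule order_trans[OF C0[OF f(1) g(1)]]) (use nn f g in \<open>auto simp: M_def intro!: mult_right_mono\<close>)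
      moreover have "qnorm A1 (f1 + g1) \<le> M * (qnorm A1 f1 + qnorm A1 g1)"
        by (rule order_trans[OF C1[OF f(2) g(2)]]) (use nn f g in \<open>auto simp: M_def intro!: mult_right_mono\<close>)
      then have "t * qnorm A1 (f1 + g1) \<le> t * (M * (qnorm A1 f1 + qnorm A1 g1))"
        using t by (intro mult_left_mono) auto
      ultimately show "qnorm A0 (f0 + g0) + t * qnorm A1 (f1 + g1)
          \<le> M * ((qnorm A0 f0 + t * qnorm A1 f1) + (qnorm A0 g0 + t * qnorm A1 g1))"
        by (simp add: algebra_simps)
    qed
    also have "\<dots> = ennreal M * (ennreal (qnorm A0 f0 + t * qnorm A1 f1) + ennreal (qnorm A0 g0 + t * qnorm A1 g1))"
      using nn f g t by (simp add: M_def ennreal_mult ennreal_plus[symmetric] del: ennreal_plus)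
    also have "\<dots> \<le> ennreal M * (2 * K_functional A0 A1 t f + 2 * K_functional A0 A1 t g)"
      by (intro mult_left_mono add_mono f g) auto
    also have "\<dots> = ennreal (2 * M) * (K_functional A0 A1 t f + K_functional A0 A1 t g)"
      by (simp add: M_def ennreal_mult distrib_left ac_simps)
    finally show ?thesis .
  qed
  then show thesis using that[of "ennreal (2 * M)"] by simp
qed

subsection \<open>The K-functional of the two limiting spaces\<close>

definition eqv :: "('p \<Rightarrow> 'k \<Rightarrow> ennreal) \<Rightarrow> ('p \<Rightarrow> 'k \<Rightarrow> ennreal) \<Rightarrow> bool" (infix "\<asymp>" 50) where
  "F \<asymp> G \<longleftrightarrow> F \<lessapprox> G \<and> G \<lessapprox> F"

lemma eqvI: "F \<lessapprox> G \<Longrightarrow> G \<lessapprox> F \<Longrightarrow> F \<asymp> G"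
  by (simp add: eqv_def)

lemma eqvD: "F \<asymp> G \<Longrightarrow> F \<lessapprox> G" "F \<asymp> G \<Longrightarrow> G \<lessapprox> F"
  by (simp_all add: eqv_def)

lemma eqv_refl: "F \<asymp> F"
  by (simp add: eqv_def)

lemma eqv_sym: "F \<asymp> G \<Longrightarrow> G \<asymp> F"
  by (simp add: eqv_def)

lemma eqv_trans [trans]: "F \<asymp> G \<Longrightarrow> G \<asymp> H \<Longrightarrow> F \<asymp> H"
  by (meson eqv_def les_trans)

lemma eqv_mult: "F \<asymp> G \<Longrightarrow> (\<lambda>p k. c p k * F p k) \<asymp> (\<lambda>p k. c p k * G p k)"
  by (simp add: eqv_def les_mult)

lemma eqv_lq: "F \<asymp> G \<Longrightarrow> 0 < q \<Longrightarrow> (\<lambda>p k. lq q (I p k) (F p)) \<asymp> (\<lambda>p k. lq q (I p k) (G p))"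
  by (simp add: eqv_def les_lq)

lemma eqv_add: "F \<asymp> F' \<Longrightarrow> G \<asymp> G' \<Longrightarrow> (\<lambda>p k. F p k + G p k) \<asymp> (\<lambda>p k. F' p k + G' p k)"
  by (simp add: eqv_def les_add_mono)

lemma eqv_max: "(\<lambda>p k. max (F p k) (G p k)) \<asymp> (\<lambda>p k. F p k + G p k)"
proof (rule eqvI)
  show "(\<lambda>p k. max (F p k) (G p k)) \<lessapprox> (\<lambda>p k. F p k + G p k)"
    by (rule les_mono) (simp add: max_def)
  show "(\<lambda>p k. F p k + G p k) \<lessapprox> (\<lambda>p k. max (F p k) (G p k))"
    by (intro les_add les_mono) auto
qed

lemma eqv_lq_add:
  assumes "0 < q"
  shows "(\<lambda>p k. lq q (I p k) (\<lambda>i. F p i + G p i)) \<asymp> (\<lambda>p k. lq q (I p k) (F p) + lq q (I p k) (G p))"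
proof (rule eqvI[OF les_lq_add[OF assms]])
  show "(\<lambda>p k. lq q (I p k) (F p) + lq q (I p k) (G p)) \<lessapprox> (\<lambda>p k. lq q (I p k) (\<lambda>i. F p i + G p i))"
    using assms by (intro les_add les_mono lq_mono) auto
qed

context
  fixes w :: "real \<Rightarrow> real" and \<kappa> :: real and q :: ennreal and F :: "'p \<Rightarrow> real \<Rightarrow> ennreal" and \<theta> :: real
  assumes w: "rv \<kappa> w" and q: "0 < q" and F: "reg F"
begin

lemma eqv_wnorm_UNIV: "(\<lambda>p (k::'k). wnorm \<theta> q w {0<..} (F p)) \<asymp> (\<lambda>p k. lq q UNIV (\<lambda>i. wt \<theta> w i * F p (ex i)))"
  by (intro eqvI wnorm_UNIV_les[OF w q F] les_wnorm_UNIV[OF w q F])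

lemma eqv_wnorm_L: "(\<lambda>p k. wnorm \<theta> q w {0<..<ex k} (F p)) \<asymp> (\<lambda>p k. lq q {..<k} (\<lambda>i. wt \<theta> w i * F p (ex i)))"
  using les_pre[OF wnorm_L_les[OF w q F, of \<theta>], where h="\<lambda>p k. p" and m="\<lambda>p k. real_of_int k"]
    les_pre[OF les_wnorm_L[OF w q F, of \<theta>], where h="\<lambda>p k. p" and m="\<lambda>p k. real_of_int k"]
  by (simp add: eqv_def)

lemma eqv_wnorm_R: "(\<lambda>p k. wnorm \<theta> q w {ex k<..} (F p)) \<asymp> (\<lambda>p k. lq q {k..} (\<lambda>i. wt \<theta> w i * F p (ex i)))"
  using les_pre[OF wnorm_R_les[OF w q F, of \<theta>], where h="\<lambda>p k. p" and m="\<lambda>p k. real_of_int k"]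
    les_pre[OF les_wnorm_R[OF w q F, of \<theta>], where h="\<lambda>p k. p" and m="\<lambda>p k. real_of_int k"]
  by (simp add: eqv_def)

end

lemma rv_1: "rv 0 (\<lambda>_. 1)"
  by (rule rvI) (auto intro!: exI[of _ 0])

lemma quasi_normed_minus:
  assumes "quasi_normed Y" "y \<in> carrier Y" shows "qnorm Y (- y) = qnorm Y y"
proof -
  have "\<forall>c. \<forall>x\<in>carrier Y. qnorm Y (c *\<^sub>R x) = \<bar>c\<bar> * qnorm Y x"
    using assms(1) unfolding quasi_normed_def by (elim conjE)
  from this[rule_format, OF assms(2), of "- 1"] show ?thesis by simp
qed

locale reiteration = weights +
  fixes A0 A1 :: "'v::real_vector qspace"
  assumes couple: "compatible_couple A0 A1" "quasi_normed A0" "quasi_normed A1"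
begin

definition F :: "'v \<Rightarrow> real \<Rightarrow> ennreal" where "F f u = K_functional A0 A1 u f"
definition x :: "'v \<Rightarrow> int \<Rightarrow> ennreal" where "x f i = F f (ex i)"
definition GL :: "'v \<Rightarrow> real \<Rightarrow> ennreal" where "GL f t = wnorm \<theta>0 q0 \<alpha>0 {0<..<t} (F f)"
definition GR :: "'v \<Rightarrow> real \<Rightarrow> ennreal" where "GR f t = wnorm 1 q1 \<alpha>1 {t<..} (F f)"
definition X0 :: "'v qspace" where "X0 = interp_L A0 A1 \<theta>0 r0 \<beta>0 q0 \<alpha>0"
definition X1 :: "'v qspace" where "X1 = interp_R A0 A1 1 r1 \<beta>1 q1 \<alpha>1"
text \<open>The norm of \<open>X0\<close> before \<open>enn2real\<close> is applied, defined on the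
  whole ambient space, so that estimates can be stated before membership is known. The same holds
  for \<open>n1\<close> and \<open>X1\<close>.\<close>

definition n0 :: "'v \<Rightarrow> ennreal" where "n0 f = wnorm 0 r0 \<beta>0 {0<..} (GL f)"
definition n1 :: "'v \<Rightarrow> ennreal" where "n1 f = wnorm 0 r1 \<beta>1 {0<..} (GR f)"

lemma nonneg: "f \<in> carrier A0 \<Longrightarrow> 0 \<le> qnorm A0 f" "f \<in> carrier A1 \<Longrightarrow> 0 \<le> qnorm A1 f"
  using couple(2,3) by (auto simp: quasi_normed_def)

lemma sub: "subspace (carrier A0)" "subspace (carrier A1)"
  using couple(2,3) by (auto simp: quasi_normed_def)

lemma regF: "reg F"
  using reg_K_functional[OF nonneg] by (simp add: F_def[abs_def])

lemma x_mono: "i \<le> j \<Longrightarrow> x f i \<le> x f j"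
  unfolding x_def F_def by (intro K_functional_mono nonneg) auto

lemma x_quot_mono: "i \<le> j \<Longrightarrow> sq (\<lambda>t. 1 / t) j * x f j \<le> sq (\<lambda>t. 1 / t) i * x f i"
  unfolding x_def F_def by (intro K_functional_quot_mono nonneg) auto

lemma x_step: "x f k \<le> ennreal (exp 1) * x f (k - 1)"
proof -
  have "x f k = sq (\<lambda>t. t) k * (sq (\<lambda>t. 1 / t) k * x f k)"
    by (simp add: mult.assoc[symmetric] ennreal_mult[symmetric])
  also have "\<dots> \<le> sq (\<lambda>t. t) k * (sq (\<lambda>t. 1 / t) (k - 1) * x f (k - 1))"
    by (intro mult_left_mono x_quot_mono) auto
  also have "\<dots> = ennreal (exp 1) * x f (k - 1)"
    by (simp add: mult.assoc[symmetric] ennreal_mult[symmetric] exp_diff[symmetric])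
  finally show ?thesis .
qed

lemma wt_g0: "wt \<theta>0 \<alpha>0 i = sq g0 i"
  by (simp add: g0_def powr_def)

lemma wt_g1: "wt 1 \<alpha>1 i = sq g1 i"
  by (simp add: g1_def powr_def)

lemma regGL: "reg GL"
  using reg_wnorm_L[OF rv(1) exponents(1) regF] by (simp add: GL_def[abs_def])

lemma regGR: "reg GR"
  using reg_wnorm_R[OF rv(3) exponents(3) regF] by (simp add: GR_def[abs_def])

lemma eqv_GL: "(\<lambda>f k. GL f (ex k)) \<asymp> (\<lambda>f. U (x f))"
  using eqv_wnorm_L[OF rv(1) exponents(1) regF, of \<theta>0] unfolding wt_g0
  by (simp add: GL_def U_def[abs_def] x_def)

lemma eqv_GR: "(\<lambda>f k. GR f (ex k)) \<asymp> (\<lambda>f. V (x f))"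
  using eqv_wnorm_R[OF rv(3) exponents(3) regF, of 1] unfolding wt_g1
  by (simp add: GR_def V_def[abs_def] x_def)

context
  fixes r :: ennreal and w :: "real \<Rightarrow> real" and \<kappa> :: real
  assumes r: "0 < r" and w: "rv \<kappa> w"
begin

lemma eqv_L: "(\<lambda>f (k::'k). wnorm 0 r w {0<..} (GL f)) \<asymp> (\<lambda>f k. lq r UNIV (\<lambda>i. sq w i * U (x f) i))"
proof -
  have "(\<lambda>f (k::'k). wnorm 0 r w {0<..} (GL f)) \<asymp> (\<lambda>f k. lq r UNIV (\<lambda>i. sq w i * GL f (ex i)))"
    using eqv_wnorm_UNIV[OF w r regGL, of 0] by simp
  also have "\<dots> \<asymp> (\<lambda>f k. lq r UNIV (\<lambda>i. sq w i * U (x f) i))"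
    by (rule eqv_lq[OF eqv_mult[OF eqv_GL] r])
  finally show ?thesis .
qed

lemma eqv_R: "(\<lambda>f (k::'k). wnorm 0 r w {0<..} (GR f)) \<asymp> (\<lambda>f k. lq r UNIV (\<lambda>i. sq w i * V (x f) i))"
proof -
  have "(\<lambda>f (k::'k). wnorm 0 r w {0<..} (GR f)) \<asymp> (\<lambda>f k. lq r UNIV (\<lambda>i. sq w i * GR f (ex i)))"
    using eqv_wnorm_UNIV[OF w r regGR, of 0] by simp
  also have "\<dots> \<asymp> (\<lambda>f k. lq r UNIV (\<lambda>i. sq w i * V (x f) i))"
    by (rule eqv_lq[OF eqv_mult[OF eqv_GR] r])
  finally show ?thesis .
qed

lemma eqv_LL: "(\<lambda>f (k::'k). wnorm 0 r w {0<..} (\<lambda>t. wnorm 0 r0 \<beta>0 {0<..<t} (GL f)))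
    \<asymp> (\<lambda>f k. lq r UNIV (\<lambda>i. sq w i * lq r0 {..<i} (\<lambda>j. sq \<beta>0 j * U (x f) j)))"
proof -
  have "(\<lambda>f (k::'k). wnorm 0 r w {0<..} (\<lambda>t. wnorm 0 r0 \<beta>0 {0<..<t} (GL f)))
      \<asymp> (\<lambda>f k. lq r UNIV (\<lambda>i. sq w i * wnorm 0 r0 \<beta>0 {0<..<ex i} (GL f)))"
    using eqv_wnorm_UNIV[OF w r reg_wnorm_L[OF rv(2) exponents(2) regGL, of 0], of 0] by simp
  also have "\<dots> \<asymp> (\<lambda>f k. lq r UNIV (\<lambda>i. sq w i * lq r0 {..<i} (\<lambda>j. sq \<beta>0 j * GL f (ex j))))"
    using eqv_lq[OF eqv_mult[OF eqv_wnorm_L[OF rv(2) exponents(2) regGL, of 0]] r] by simp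
  also have "\<dots> \<asymp> (\<lambda>f k. lq r UNIV (\<lambda>i. sq w i * lq r0 {..<i} (\<lambda>j. sq \<beta>0 j * U (x f) j)))"
    by (rule eqv_lq[OF eqv_mult[OF eqv_lq[OF eqv_mult[OF eqv_GL] exponents(2)]] r])
  finally show ?thesis .
qed

lemma eqv_RR: "(\<lambda>f (k::'k). wnorm 0 r w {0<..} (\<lambda>t. wnorm 0 r1 \<beta>1 {t<..} (GR f)))
    \<asymp> (\<lambda>f k. lq r UNIV (\<lambda>i. sq w i * lq r1 {i..} (\<lambda>j. sq \<beta>1 j * V (x f) j)))"
proof -
  have "(\<lambda>f (k::'k). wnorm 0 r w {0<..} (\<lambda>t. wnorm 0 r1 \<beta>1 {t<..} (GR f)))
      \<asymp> (\<lambda>f k. lq r UNIV (\<lambda>i. sq w i * wnorm 0 r1 \<beta>1 {ex i<..} (GR f)))"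
    using eqv_wnorm_UNIV[OF w r reg_wnorm_R[OF rv(4) exponents(4) regGR, of 0], of 0] by simp
  also have "\<dots> \<asymp> (\<lambda>f k. lq r UNIV (\<lambda>i. sq w i * lq r1 {i..} (\<lambda>j. sq \<beta>1 j * GR f (ex j))))"
    using eqv_lq[OF eqv_mult[OF eqv_wnorm_R[OF rv(4) exponents(4) regGR, of 0]] r] by simp
  also have "\<dots> \<asymp> (\<lambda>f k. lq r UNIV (\<lambda>i. sq w i * lq r1 {i..} (\<lambda>j. sq \<beta>1 j * V (x f) j)))"
    by (rule eqv_lq[OF eqv_mult[OF eqv_lq[OF eqv_mult[OF eqv_GR] exponents(4)]] r])
  finally show ?thesis .
qed

end

lemma carrier_X0: "carrier X0 = {f \<in> sum_carrier A0 A1. n0 f < top}"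
  and qnorm_X0: "qnorm X0 f = enn2real (n0 f)"
  by (simp_all add: X0_def interp_L_def finite_norm_space_def n0_def GL_def[abs_def] F_def[abs_def])

lemma carrier_X1: "carrier X1 = {f \<in> sum_carrier A0 A1. n1 f < top}"
  and qnorm_X1: "qnorm X1 f = enn2real (n1 f)"
  by (simp_all add: X1_def interp_R_def finite_norm_space_def n1_def GR_def[abs_def] F_def[abs_def])

lemma in_sum: "f \<in> carrier A0 \<Longrightarrow> f \<in> sum_carrier A0 A1" "f \<in> carrier A1 \<Longrightarrow> f \<in> sum_carrier A0 A1"
  unfolding sum_carrier_def using subspace_0[OF sub(1)] subspace_0[OF sub(2)] by force+

lemma K_functional_X_eq:
  assumes "f0 \<in> carrier X0" "f1 \<in> carrier X1"
  shows "ennreal (qnorm X0 f0 + R (ex k) * qnorm X1 f1) = n0 f0 + sq R k * n1 f1"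
proof -
  have "n0 f0 < top" "n1 f1 < top" using assms by (auto simp: carrier_X0 carrier_X1)
  then show ?thesis
    using rv_pos[OF rv_R, of "ex k"] by (simp add: qnorm_X0 qnorm_X1 ennreal_mult)
qed

text \<open>An element of \<open>A0\<close> has \<open>K\<close>-functional at most its norm, and
  one of \<open>A1\<close> at most a linear function; both follow from decompositions with one
  component 0. Negatives are included because each component will also be written as
  \<open>f\<close> minus the other one.\<close>

lemma K_split:
  assumes K: "x f k < top"
  obtains f0 f1 where "f0 \<in> carrier A0" "f1 \<in> carrier A1" "f = f0 + f1"
    "\<And>i. x f0 i \<le> 2 * x f k" "\<And>i. x (- f0) i \<le> 2 * x f k"
    "\<And>i. sq (\<lambda>t. 1 / t) i * x f1 i \<le> 2 * (sq (\<lambda>t. 1 / t) k * x f k)"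
    "\<And>i. sq (\<lambda>t. 1 / t) i * x (- f1) i \<le> 2 * (sq (\<lambda>t. 1 / t) k * x f k)"
proof -
  have K': "K_functional A0 A1 (ex k) f < top" using K by (simp add: x_def F_def)
  obtain f0 f1 where f': "f0 \<in> carrier A0" "f1 \<in> carrier A1" "f = f0 + f1"
    "ennreal (qnorm A0 f0 + ex k * qnorm A1 f1) \<le> 2 * K_functional A0 A1 (ex k) f"
    by (rule K_functional_decompose[OF couple exp_gt_zero K'])
  note f = f'(1-3) f'(4)[folded F_def x_def]
  have nn: "0 \<le> qnorm A0 f0" "0 \<le> ex k * qnorm A1 f1" "0 \<le> qnorm A1 f1" using nonneg f by auto
  have neg: "qnorm A0 (- f0) = qnorm A0 f0" "qnorm A1 (- f1) = qnorm A1 f1"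
    using quasi_normed_minus couple f by blast+
  have z: "0 \<in> carrier A0" "0 \<in> carrier A1" "qnorm A0 0 = 0" "qnorm A1 0 = 0"
    using couple(2,3) by (auto simp: quasi_normed_def subspace_0)
  have x0: "x g i \<le> 2 * x f k" if "g \<in> carrier A0" "qnorm A0 g = qnorm A0 f0" for g i
  proof -
    have "x g i \<le> ennreal (qnorm A0 g)"
      using K_functional_le[OF that(1) z(2), of "ex i"] z by (simp add: x_def F_def)
    also have "\<dots> \<le> ennreal (qnorm A0 f0 + ex k * qnorm A1 f1)" using that nn by (intro ennreal_leI) simp
    also note f(4)
    finally show ?thesis .
  qed
  have x1: "sq (\<lambda>t. 1 / t) i * x g i \<le> 2 * (sq (\<lambda>t. 1 / t) k * x f k)"
    if "g \<in> carrier A1" "qnorm A1 g = qnorm A1 f1" for g i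
  proof -
    have "x g i \<le> ennreal (ex i * qnorm A1 g)"
      using K_functional_le[OF z(1) that(1), of "ex i"] z by (simp add: x_def F_def)
    then have "sq (\<lambda>t. 1 / t) i * x g i \<le> sq (\<lambda>t. 1 / t) i * ennreal (ex i * qnorm A1 g)"
      by (rule mult_left_mono) simp
    also have "\<dots> = ennreal (1 / ex k * (ex k * qnorm A1 f1))"
      using that nn by (subst ennreal_mult[symmetric]) auto
    also have "\<dots> \<le> ennreal (1 / ex k * (qnorm A0 f0 + ex k * qnorm A1 f1))"
      using nn by (intro ennreal_leI mult_left_mono) auto
    also have "\<dots> = sq (\<lambda>t. 1 / t) k * ennreal (qnorm A0 f0 + ex k * qnorm A1 f1)"
      using nn by (intro ennreal_mult) auto
    also have "\<dots> \<le> sq (\<lambda>t. 1 / t) k * (2 * x f k)" by (intro mult_left_mono f(4)) auto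
    finally show ?thesis by (simp only: mult.left_commute)
  qed
  show thesis
    by (rule that[OF f(1-3)]; intro x0 x1 subspace_neg sub f neg refl)
qed

text \<open>The balance behind \<open>R\<close>: the linear part left of \<open>k\<close>, measured
  in the second space and multiplied by \<open>R\<close>, costs exactly the pointwise quantity that
  \<open>P\<close> controls. Thus it needs no term of its own in Holmstedt's formula.\<close>

lemma RX_eq: "sq R k * (sq X k * (sq (\<lambda>t. 1 / t) k * y)) = sq B k * (sq g0 k * y)"
proof -
  have pos: "0 < g0 (ex k)" "0 < B (ex k)" "0 < X (ex k)"
    using rv_pos[OF rv_g0] rv_pos[OF rv(5)] rv_pos[OF rv(7)] by simp_all
  have "sq R k * sq X k * sq (\<lambda>t. 1 / t) k = sq B k * sq g0 k"
    using pos by (simp add: R_def ennreal_mult[symmetric])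
  then show ?thesis by (metis mult.assoc)
qed

lemma eqv_n0: "(\<lambda>f (k::unit). n0 f) \<asymp> (\<lambda>f k. N0 (x f))"
  using eqv_L[OF exponents(2) rv(2)] by (simp add: n0_def[abs_def] N0_def[abs_def])

lemma eqv_n1: "(\<lambda>f (k::unit). n1 f) \<asymp> (\<lambda>f k. N1 (x f))"
  using eqv_R[OF exponents(4) rv(4)] by (simp add: n1_def[abs_def] N1_def[abs_def])

text \<open>For \<open>i \<le> k\<close> the \<open>K\<close>-functional of \<open>f0\<close> is
  estimated through \<open>f - f1\<close>, and for \<open>i \<ge> k\<close> that of
  \<open>f1\<close> through \<open>f - f0\<close>: on these ranges the subtracted component is
  bounded by twice the \<open>K\<close>-functional of \<open>f\<close>.\<close>

lemma K_upper: "(\<lambda>f k. K_functional X0 X1 (R (ex k)) f) \<lessapprox> (\<lambda>f k. P (x f) k + sq R k * Q (x f) k)"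
proof -
  obtain c where c: "c < top" "\<And>t f g. 0 < t \<Longrightarrow> K_functional A0 A1 t (f + g) \<le> c * (K_functional A0 A1 t f + K_functional A0 A1 t g)"
    by (rule K_functional_add[OF couple]) (rule that; assumption)
  \<comment> \<open>The quasi-triangle constant \<open>c\<close> meets \<open>y + 2 * y\<close>,
    whence \<open>c * 3\<close>; the summand 3 covers the factor 2 of the decomposition and the
    doubling factor \<open>exp 1\<close>.\<close>
  define M where "M = c * 3 + 3"
  have M: "M < top" using c(1) by (simp add: M_def ennreal_mult_less_top)
  have M3: "3 \<le> M" "2 \<le> M" "c * 3 \<le> M" "ennreal (exp 1) \<le> M"
  proof -
    have "ennreal (exp 1) \<le> ennreal 3" by (intro ennreal_leI exp_le)
    then show "ennreal (exp 1) \<le> M" unfolding M_def by (simp add: add_increasing)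
    have "(2::ennreal) \<le> 3" by simp
    also have "3 \<le> M" by (simp add: M_def)
    finally show "2 \<le> M" .
  qed (simp_all add: M_def)
  obtain E0 where E0: "E0 < top" "\<And>x y k. (\<And>i. y i \<le> M * x (min i k)) \<Longrightarrow> x k \<le> M * x (k - 1) \<Longrightarrow> N0 y \<le> E0 * P x k"
    using N0_truncate[OF M] by metis
  obtain E1 where E1: "E1 < top" "\<And>x y k. (\<And>i. k \<le> i \<Longrightarrow> y i \<le> M * x i) \<Longrightarrow>
    (\<And>i. i \<le> k \<Longrightarrow> sq (\<lambda>t. 1 / t) i * y i \<le> M * (sq (\<lambda>t. 1 / t) k * x k)) \<Longrightarrow>
    N1 y \<le> E1 * (Q x k + sq X k * (sq (\<lambda>t. 1 / t) k * x k))"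
    using N1_truncate[OF M] by metis
  obtain Ep where Ep: "Ep < top" "\<And>x k. x k \<le> M * x (k - 1) \<Longrightarrow> sq B k * (sq g0 k * x k) \<le> Ep * P x k"
    by (rule P_point[OF M]) (rule that; assumption)
  obtain C0 where C0: "C0 < top" "\<And>f. n0 f \<le> C0 * N0 (x f)"
    using eqvD(1)[OF eqv_n0] by (rule lesE) (rule that; blast)
  obtain C1 where C1: "C1 < top" "\<And>f. n1 f \<le> C1 * N1 (x f)"
    using eqvD(1)[OF eqv_n1] by (rule lesE) (rule that; blast)
  \<comment> \<open>The summand 1 ensures that \<open>L * top\<close> is infinite.\<close>
  define L where "L = C0 * E0 + C1 * E1 * Ep + C1 * E1 + 1"
  have "K_functional X0 X1 (R (ex k)) f \<le> L * (P (x f) k + sq R k * Q (x f) k)" for f k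
  proof (cases "P (x f) k + sq R k * Q (x f) k < top")
    case False
    then have "P (x f) k + sq R k * Q (x f) k = top" using top.not_eq_extremum by blast
    moreover have "L * top = top" by (simp add: L_def ennreal_mult_top)
    ultimately show ?thesis by (simp only: top_greatest)
  next
    case True
    have step: "x f k \<le> M * x f (k - 1)"
      using order_trans[OF x_step mult_right_mono[OF M3(4)]] by simp
    have pos: "0 < sq R k" "0 < sq B k" "0 < sq g0 k" "0 < sq X k"
      using rv_pos[OF rv_R] rv_pos[OF rv_g0] rv_pos[OF rv(5)] rv_pos[OF rv(7)] by simp_all
    have Pf: "P (x f) k < top" and "sq R k * Q (x f) k < top" using True by auto
    then have Qf: "Q (x f) k < top" using pos(1) by (auto simp: ennreal_mult_less_top)
    \<comment> \<open>Finiteness of \<open>P\<close> forces \<open>x f k\<close> to be finite, as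
      the decomposition at \<open>exp k\<close> requires.\<close>
    have "sq B k * (sq g0 k * x f k) \<le> Ep * P (x f) k" by (rule Ep(2)[OF step])
    also have "\<dots> < top" using Ep(1) Pf by (simp add: ennreal_mult_less_top)
    finally have "sq g0 k * x f k < top" using pos by (auto simp: ennreal_mult_less_top)
    then have xf: "x f k < top" using pos by (auto simp: ennreal_mult_less_top)
    obtain f0 f1 where f: "f0 \<in> carrier A0" "f1 \<in> carrier A1" "f = f0 + f1"
      "\<And>i. x f0 i \<le> 2 * x f k" "\<And>i. x (- f0) i \<le> 2 * x f k"
      "\<And>i. sq (\<lambda>t. 1 / t) i * x f1 i \<le> 2 * (sq (\<lambda>t. 1 / t) k * x f k)"
      "\<And>i. sq (\<lambda>t. 1 / t) i * x (- f1) i \<le> 2 * (sq (\<lambda>t. 1 / t) k * x f k)"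
      by (rule K_split[OF xf]) (rule that; assumption)
    have add: "x (g + h) i \<le> c * (x g i + x h i)" for g h i
      unfolding x_def F_def by (rule c(2)) simp
    have add3: "c * (y + 2 * y) \<le> M * y" for y
    proof -
      have "y + 2 * y = 3 * y" using distrib_right[of 1 2 y] by simp
      then have "c * (y + 2 * y) = c * 3 * y" by (simp add: mult.assoc)
      also have "\<dots> \<le> M * y" by (intro mult_right_mono M3) auto
      finally show ?thesis .
    qed
    have two: "2 * y \<le> M * y" for y by (intro mult_right_mono M3) auto
    have N0: "N0 (x f0) \<le> E0 * P (x f) k"
    proof (rule E0(2)[OF _ step])
      fix i
      show "x f0 i \<le> M * x f (min i k)"
      proof (cases "i \<le> k")
        case True
        have "x (- f1) i = sq (\<lambda>t. t) i * (sq (\<lambda>t. 1 / t) i * x (- f1) i)"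
          by (simp add: mult.assoc[symmetric] ennreal_mult[symmetric])
        also have "\<dots> \<le> sq (\<lambda>t. t) i * (2 * (sq (\<lambda>t. 1 / t) i * x f i))"
          using order_trans[OF f(7)[of i] mult_left_mono[OF x_quot_mono[OF True, of f], of 2]]
          by (intro mult_left_mono) auto
        also have "\<dots> = 2 * (sq (\<lambda>t. t) i * sq (\<lambda>t. 1 / t) i * x f i)" by (simp only: ac_simps)
        also have "\<dots> = 2 * x f i" by (simp add: ennreal_mult[symmetric])
        finally have "c * (x f i + x (- f1) i) \<le> c * (x f i + 2 * x f i)"
          by (intro mult_left_mono add_left_mono) auto
        with add[of f "- f1" i] have "x f0 i \<le> c * (x f i + 2 * x f i)" using f(3) by simp
        also have "\<dots> \<le> M * x f i" by (rule add3)
        finally show ?thesis using True by (simp add: min_def)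
      next
        case False
        then show ?thesis using order_trans[OF f(4)[of i] two] by (simp add: min_def)
      qed
    qed
    have N1: "N1 (x f1) \<le> E1 * (Q (x f) k + sq X k * (sq (\<lambda>t. 1 / t) k * x f k))"
    proof (rule E1(2))
      fix i assume "k \<le> i"
      have "c * (x f i + x (- f0) i) \<le> c * (x f i + 2 * x f i)"
        using order_trans[OF f(5)[of i] mult_left_mono[OF x_mono[OF \<open>k \<le> i\<close>, of f], of 2]]
        by (intro mult_left_mono add_left_mono) auto
      with add[of f "- f0" i] have "x f1 i \<le> c * (x f i + 2 * x f i)" using f(3) by simp
      also have "\<dots> \<le> M * x f i" by (rule add3)
      finally show "x f1 i \<le> M * x f i" .
    next
      fix i
      show "sq (\<lambda>t. 1 / t) i * x f1 i \<le> M * (sq (\<lambda>t. 1 / t) k * x f k)"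
        using order_trans[OF f(6)[of i] two] .
    qed
    have n0: "n0 f0 \<le> C0 * (E0 * P (x f) k)"
      using order_trans[OF C0(2) mult_left_mono[OF N0]] by simp
    have n1: "n1 f1 \<le> C1 * (E1 * (Q (x f) k + sq X k * (sq (\<lambda>t. 1 / t) k * x f k)))"
      using order_trans[OF C1(2) mult_left_mono[OF N1]] by simp
    have "n0 f0 < top"
      by (rule le_less_trans[OF n0]) (use C0 E0 Pf in \<open>auto simp: ennreal_mult_less_top\<close>)
    moreover have "n1 f1 < top"
      by (rule le_less_trans[OF n1]) (use C1 E1 Qf xf in \<open>auto simp: ennreal_mult_less_top\<close>)
    ultimately have car: "f0 \<in> carrier X0" "f1 \<in> carrier X1"
      using f in_sum by (auto simp: carrier_X0 carrier_X1)
    have "K_functional X0 X1 (R (ex k)) f \<le> n0 f0 + sq R k * n1 f1"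
      using K_functional_le[OF car, of "R (ex k)"] K_functional_X_eq[OF car, of k] f(3) by simp
    also have "\<dots> \<le> C0 * (E0 * P (x f) k) + sq R k * (C1 * (E1 * (Q (x f) k + sq X k * (sq (\<lambda>t. 1 / t) k * x f k))))"
      by (intro add_mono mult_left_mono n0 n1) auto
    also have "\<dots> = C0 * E0 * P (x f) k + (C1 * E1 * (sq R k * Q (x f) k) + C1 * E1 * (sq B k * (sq g0 k * x f k)))"
      unfolding RX_eq[symmetric] by (simp only: distrib_left ac_simps)
    also have "\<dots> \<le> C0 * E0 * P (x f) k + (C1 * E1 * (sq R k * Q (x f) k) + C1 * E1 * (Ep * P (x f) k))"
      by (intro add_mono mult_left_mono Ep step) auto
    also have "\<dots> = (C0 * E0 + C1 * E1 * Ep) * P (x f) k + C1 * E1 * (sq R k * Q (x f) k)"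
      by (simp only: distrib_right ac_simps)
    also have "\<dots> \<le> L * P (x f) k + L * (sq R k * Q (x f) k)"
      by (intro add_mono mult_right_mono) (auto simp: L_def add.assoc intro: add_increasing add_increasing2)
    finally show ?thesis by (simp add: distrib_left)
  qed
  moreover have "L < top" unfolding L_def using C0 C1 E0 E1 Ep by (simp add: ennreal_mult_less_top)
  ultimately show ?thesis by (intro lesI[of L])
qed

text \<open>By quasi-additivity \<open>P + R * Q\<close> is estimated on each component of a
  decomposition. For \<open>P\<close> on \<open>X0\<close> and \<open>Q\<close> on \<open>X1\<close>
  this is the bound by the norm; the crossed cases \<open>P1\<close> and \<open>Q0\<close> go
  through the pointwise control of \<open>K\<close> in the other space.\<close>

lemma K_lower: "(\<lambda>f k. P (x f) k + sq R k * Q (x f) k) \<lessapprox> (\<lambda>f k. K_functional X0 X1 (R (ex k)) f)"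
proof -
  obtain c where c: "c < top" "\<And>t f g. 0 < t \<Longrightarrow> K_functional A0 A1 t (f + g) \<le> c * (K_functional A0 A1 t f + K_functional A0 A1 t g)"
    by (rule K_functional_add[OF couple]) (rule that; assumption)
  obtain Pa where Pa: "Pa < top" "\<And>x y z k. (\<And>i. z i \<le> c * (x i + y i)) \<Longrightarrow> P z k \<le> Pa * (P x k + P y k)"
    using P_add[OF c(1)] by metis
  obtain Qa where Qa: "Qa < top" "\<And>x y z k. (\<And>i. z i \<le> c * (x i + y i)) \<Longrightarrow> Q z k \<le> Qa * (Q x k + Q y k)"
    using Q_add[OF c(1)] by metis
  obtain C0 where C0: "C0 < top" "\<And>f. N0 (x f) \<le> C0 * n0 f"
    using eqvD(2)[OF eqv_n0] by (rule lesE) (rule that; blast)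
  obtain C1 where C1: "C1 < top" "\<And>f. N1 (x f) \<le> C1 * n1 f"
    using eqvD(2)[OF eqv_n1] by (rule lesE) (rule that; blast)
  obtain P0 where P0: "P0 < top" "\<And>x k. P x k \<le> P0 * N0 x" by (rule P_le_N0) (rule that; assumption)
  obtain Q1 where Q1: "Q1 < top" "\<And>x k. Q x k \<le> Q1 * N1 x" by (rule Q_le_N1) (rule that; assumption)
  obtain Ep where Ep: "Ep < top" "\<And>x k. x k \<le> ennreal (exp 1) * x (k - 1) \<Longrightarrow> sq B k * (sq g0 k * x k) \<le> Ep * P x k"
    by (rule P_point[OF ennreal_less_top]) (rule that; assumption)
  obtain En where En: "En < top" "\<And>x k. (\<And>i. i \<le> k \<Longrightarrow> sq (\<lambda>t. 1 / t) k * x k \<le> sq (\<lambda>t. 1 / t) i * x i) \<Longrightarrow>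
    sq X k * (sq (\<lambda>t. 1 / t) k * x k) \<le> En * N1 x"
    using N1_point by metis
  \<comment> \<open>Chosen so that \<open>g0 = w * (X / t)\<close> and
    \<open>g1 = v * (B * g0)\<close>: the pointwise bounds from \<open>X1\<close> and
    \<open>X0\<close> then become the hypotheses of geometric summation for \<open>P\<close> and
    \<open>Q\<close>. The indices \<open>1 - \<theta>0\<close> and \<open>\<theta>0 - 1\<close> have
    the required signs.\<close>
  define w where "w = (\<lambda>t. t * g0 t / X t)"
  define v where "v = (\<lambda>t. g1 t / (B t * g0 t))"
  have rvw: "rv (1 - \<theta>0) w"
    using rv_divide[OF rv_mult[OF rv_id rv_g0] rv(7)] by (simp add: w_def)
  have rvv: "rv (\<theta>0 - 1) v"
    using rv_divide[OF rv_g1 rv_mult[OF rv(5) rv_g0]] by (simp add: v_def add.commute)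
  obtain Gp where Gp: "Gp < top" "\<And>x S k. slow 0 S \<Longrightarrow> (\<And>i. sq g0 i * x i \<le> sq w i * S i) \<Longrightarrow>
    P x k \<le> Gp * (sq (\<lambda>t. B t * w t) k * S k)"
    proof -
    have "0 < 1 - \<theta>0" using \<theta>0 by simp
    from P_geometric[OF rvw this this] that show thesis by metis
  qed
  obtain Gq where Gq: "Gq < top" "\<And>x S k. slow 0 S \<Longrightarrow> (\<And>i. sq g1 i * x i \<le> sq v i * S i) \<Longrightarrow>
    Q x k \<le> Gq * (sq (\<lambda>t. X t * v t / \<alpha>1 t) k * S k)"
    proof -
    have "\<theta>0 - 1 < 0" "0 < - (\<theta>0 - 1)" using \<theta>0 by simp_all
    from Q_geometric[OF rvv this] that show thesis by metis
  qed
  have pos: "0 < g0 t" "0 < B t" "0 < X t" "0 < g1 t" "0 < \<alpha>1 t" if "0 < t" for t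
    using that rv_pos[OF rv_g0] rv_pos[OF rv(5)] rv_pos[OF rv(7)] rv_pos[OF rv_g1] rv_pos[OF rv(3)] by auto
  have P1: "P (x f) k \<le> Gp * (sq R k * (En * N1 (x f)))" for f k
  proof -
    have "P (x f) k \<le> Gp * (sq (\<lambda>t. B t * w t) k * (En * N1 (x f)))"
    proof (rule Gp(2)[OF slow_const])
      fix i
      have "sq g0 i = sq w i * (sq X i * sq (\<lambda>t. 1 / t) i)"
        using pos[of "ex i"] by (simp add: w_def ennreal_mult[symmetric])
      then have "sq g0 i * x f i = sq w i * (sq X i * (sq (\<lambda>t. 1 / t) i * x f i))"
        by (simp only: mult.assoc)
      also have "\<dots> \<le> sq w i * (En * N1 (x f))"
        by (intro mult_left_mono En x_quot_mono) auto
      finally show "sq g0 i * x f i \<le> sq w i * (En * N1 (x f))" .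
    qed
    also have "sq (\<lambda>t. B t * w t) k = sq R k" by (simp add: w_def R_def mult.commute)
    finally show ?thesis .
  qed
  have Q0: "sq R k * Q (x f) k \<le> Gq * (Ep * (P0 * N0 (x f)))" for f k
  proof -
    have "Q (x f) k \<le> Gq * (sq (\<lambda>t. X t * v t / \<alpha>1 t) k * (Ep * (P0 * N0 (x f))))"
    proof (rule Gq(2)[OF slow_const])
      fix i
      have "sq g1 i = sq v i * (sq B i * sq g0 i)"
        using pos[of "ex i"] by (simp add: v_def ennreal_mult[symmetric])
      then have "sq g1 i * x f i = sq v i * (sq B i * (sq g0 i * x f i))"
        by (simp only: mult.assoc)
      also have "\<dots> \<le> sq v i * (Ep * (P0 * N0 (x f)))"
        by (intro mult_left_mono order_trans[OF Ep(2)[of "x f", OF x_step]] P0) auto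
      finally show "sq g1 i * x f i \<le> sq v i * (Ep * (P0 * N0 (x f)))" .
    qed
    then have "sq R k * Q (x f) k \<le> sq R k * (Gq * (sq (\<lambda>t. X t * v t / \<alpha>1 t) k * (Ep * (P0 * N0 (x f)))))"
      by (rule mult_left_mono) simp
    also have "\<dots> = sq R k * sq (\<lambda>t. X t * v t / \<alpha>1 t) k * (Gq * (Ep * (P0 * N0 (x f))))"
      by (simp only: ac_simps)
    also have "sq R k * sq (\<lambda>t. X t * v t / \<alpha>1 t) k = 1"
    proof -
      have "R (ex k) * (X (ex k) * v (ex k) / \<alpha>1 (ex k)) = 1"
        using pos[of "ex k"] by (simp add: R_def v_def) (simp add: g1_def powr_minus divide_inverse)
      then show ?thesis using pos[of "ex k"] rv_pos[OF rv_R, of "ex k"] rv_pos[OF rvv, of "ex k"]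
        by (subst ennreal_mult[symmetric]) auto
    qed
    finally show ?thesis by simp
  qed
  define L where "L = Pa * (P0 * C0 + Gp * (En * C1)) + Qa * (Gq * (Ep * (P0 * C0)) + Q1 * C1)"
  have L: "L < top"
    unfolding L_def using Pa Qa C0 C1 P0 Q1 Ep En Gp Gq by (simp add: ennreal_mult_less_top)
  have "P (x f) k + sq R k * Q (x f) k \<le> (L + 1) * K_functional X0 X1 (R (ex k)) f" for f k
    unfolding K_functional_def
  proof (rule ennreal_le_cmult_Inf[OF _ L])
    fix b assume "b \<in> {ennreal (qnorm X0 f0 + R (ex k) * qnorm X1 f1) |f0 f1. f0 \<in> carrier X0 \<and> f1 \<in> carrier X1 \<and> f = f0 + f1}"
    then obtain f0 f1 where f: "f0 \<in> carrier X0" "f1 \<in> carrier X1" "f = f0 + f1"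
        "b = ennreal (qnorm X0 f0 + R (ex k) * qnorm X1 f1)" by blast
    have b: "b = n0 f0 + sq R k * n1 f1" using K_functional_X_eq[OF f(1,2)] f(4) by simp
    have add: "x f i \<le> c * (x f0 i + x f1 i)" for i
      unfolding x_def F_def f(3) by (rule c(2)) simp
    have "P (x f) k \<le> Pa * (P (x f0) k + P (x f1) k)" by (rule Pa(2)[OF add])
    also have "\<dots> \<le> Pa * (P0 * (C0 * n0 f0) + Gp * (sq R k * (En * (C1 * n1 f1))))"
      by (intro mult_left_mono add_mono order_trans[OF P0(2)] order_trans[OF P1] C0 C1) auto
    also have "\<dots> = Pa * (P0 * C0 * n0 f0 + Gp * (En * C1) * (sq R k * n1 f1))"
      by (simp only: ac_simps)
    also have "\<dots> \<le> Pa * (P0 * C0 * b + Gp * (En * C1) * b)"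
      unfolding b by (intro mult_left_mono add_mono) auto
    finally have 1: "P (x f) k \<le> Pa * (P0 * C0 + Gp * (En * C1)) * b"
      by (simp only: distrib_right distrib_left mult.assoc)
    have "sq R k * Q (x f) k \<le> sq R k * (Qa * (Q (x f0) k + Q (x f1) k))"
      by (intro mult_left_mono Qa(2)[OF add]) auto
    also have "\<dots> = Qa * (sq R k * Q (x f0) k + sq R k * Q (x f1) k)"
      by (simp only: distrib_left ac_simps)
    also have "\<dots> \<le> Qa * (Gq * (Ep * (P0 * (C0 * n0 f0))) + sq R k * (Q1 * (C1 * n1 f1)))"
      by (intro mult_left_mono add_mono order_trans[OF Q0] order_trans[OF Q1(2)] C0 C1) auto
    also have "\<dots> = Qa * (Gq * (Ep * (P0 * C0)) * n0 f0 + Q1 * C1 * (sq R k * n1 f1))"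
      by (simp only: ac_simps)
    also have "\<dots> \<le> Qa * (Gq * (Ep * (P0 * C0)) * b + Q1 * C1 * b)"
      unfolding b by (intro mult_left_mono add_mono) auto
    finally have 2: "sq R k * Q (x f) k \<le> Qa * (Gq * (Ep * (P0 * C0)) + Q1 * C1) * b"
      by (simp only: distrib_right distrib_left mult.assoc)
    show "P (x f) k + sq R k * Q (x f) k \<le> L * b"
      using add_mono[OF 1 2] by (simp only: L_def distrib_right)
  qed
  then show ?thesis using L by (intro lesI[of "L + 1"]) simp_all
qed

lemma holmstedt: "(\<lambda>f k. K_functional X0 X1 (R (ex k)) f) \<asymp> (\<lambda>f k. P (x f) k + sq R k * Q (x f) k)"
  by (rule eqvI[OF K_upper K_lower])

end

text \<open>The least majorant of \<open>y\<close> that is \<open>slow \<sigma>\<close>. Geometric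
  summation needs a slow sequence, and passing to this majorant does not enlarge the norm by more
  than a constant.\<close>

definition envelope :: "real \<Rightarrow> (int \<Rightarrow> ennreal) \<Rightarrow> int \<Rightarrow> ennreal" where
  "envelope \<sigma> y k = (SUP i. ennreal (exp (- \<sigma> * \<bar>real_of_int (i - k)\<bar>)) * y i)"

lemma le_envelope: "y k \<le> envelope \<sigma> y k"
proof -
  have "ennreal (exp (- \<sigma> * \<bar>real_of_int (k - k)\<bar>)) * y k \<le> envelope \<sigma> y k"
    unfolding envelope_def by (rule SUP_upper) simp
  then show ?thesis by simp
qed

lemma slow_envelope:
  assumes "0 \<le> \<sigma>" shows "slow \<sigma> (envelope \<sigma> y)"
  unfolding slow_def
proof (intro allI)
  fix i j
  have "ennreal (exp (- \<sigma> * \<bar>real_of_int (l - i)\<bar>)) * y l \<le> ennreal (exp (\<sigma> * \<bar>real_of_int (i - j)\<bar>)) * envelope \<sigma> y j" for l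
  proof -
    have "\<bar>real_of_int (l - j)\<bar> \<le> \<bar>real_of_int (l - i)\<bar> + \<bar>real_of_int (i - j)\<bar>" by simp
    then have "\<sigma> * \<bar>real_of_int (l - j)\<bar> \<le> \<sigma> * (\<bar>real_of_int (l - i)\<bar> + \<bar>real_of_int (i - j)\<bar>)"
      using assms by (rule mult_left_mono)
    then have "- \<sigma> * \<bar>real_of_int (l - i)\<bar> \<le> \<sigma> * \<bar>real_of_int (i - j)\<bar> + - \<sigma> * \<bar>real_of_int (l - j)\<bar>"
      unfolding distrib_left by simp
    then have "ennreal (exp (- \<sigma> * \<bar>real_of_int (l - i)\<bar>)) \<le> ennreal (exp (\<sigma> * \<bar>real_of_int (i - j)\<bar>)) * ennreal (exp (- \<sigma> * \<bar>real_of_int (l - j)\<bar>))"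
      by (simp only: ennreal_mult[symmetric] exp_ge_zero exp_add[symmetric]) (rule ennreal_leI, simp only: exp_le_cancel_iff)
    then have "ennreal (exp (- \<sigma> * \<bar>real_of_int (l - i)\<bar>)) * y l
        \<le> ennreal (exp (\<sigma> * \<bar>real_of_int (i - j)\<bar>)) * (ennreal (exp (- \<sigma> * \<bar>real_of_int (l - j)\<bar>)) * y l)"
      unfolding mult.assoc[symmetric] by (rule mult_right_mono) simp
    also have "\<dots> \<le> ennreal (exp (\<sigma> * \<bar>real_of_int (i - j)\<bar>)) * envelope \<sigma> y j"
      unfolding envelope_def by (intro mult_left_mono SUP_upper) auto
    finally show ?thesis .
  qed
  then show "envelope \<sigma> y i \<le> ennreal (exp (\<sigma> * \<bar>real_of_int (i - j)\<bar>)) * envelope \<sigma> y j"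
    unfolding envelope_def[of \<sigma> y i] by (intro SUP_least)
qed

lemma lq_envelope:
  assumes "0 < q" "0 < \<sigma>"
  shows "(\<lambda>p (k::'k). lq q UNIV (envelope \<sigma> (y p))) \<lessapprox> (\<lambda>p k. lq q UNIV (y p))"
proof -
  obtain C where "C < top" "\<And>y. lq q UNIV (envelope \<sigma> y) \<le> C * lq q UNIV y"
    using lq_sup_hardy[OF assms] unfolding envelope_def by blast
  then show ?thesis by (intro lesI)
qed

subsection \<open>The interpolation norm\<close>

context reiteration
begin

context
  fixes r :: ennreal and a :: "real \<Rightarrow> real"
  assumes r: "0 < r" and a: "rv 0 a"
begin

text \<open>The weight \<open>u powr (- \<theta>) * a u\<close> of the interpolation norm after the
  substitution \<open>u = R t\<close>.\<close>

definition W :: "real \<Rightarrow> real \<Rightarrow> real" where "W \<theta> t = R t powr (- \<theta>) * a (R t)"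
text \<open>The pointwise lower bound for \<open>P\<close>, multiplied by \<open>W \<theta>\<close>.
  It is the discrete integrand of the norm with weight \<open>a_sharp \<theta>\<close> in the
  theorem.\<close>

definition \<xi> :: "real \<Rightarrow> 'v \<Rightarrow> int \<Rightarrow> ennreal" where
  "\<xi> \<theta> f i = sq (W \<theta>) i * (sq B i * (sq g0 i * x f i))"

lemma rv_W: "rv (- (\<theta> * (1 - \<theta>0))) (W \<theta>)"
  using rv_mult[OF rv_powr[OF rv_R, of "- \<theta>"] rv_comp[OF a rv_R]] by (simp add: W_def[abs_def] mult.commute)

lemma pos: "0 < t \<Longrightarrow> 0 < g0 t" "0 < t \<Longrightarrow> 0 < B t" "0 < t \<Longrightarrow> 0 < X t" "0 < t \<Longrightarrow> 0 < g1 t"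
  "0 < t \<Longrightarrow> 0 < \<alpha>1 t" "0 < t \<Longrightarrow> 0 < \<alpha>0 t" "0 < t \<Longrightarrow> 0 < R t" "0 < t \<Longrightarrow> 0 < D t"
  "0 < t \<Longrightarrow> 0 < a t"
  using rv_pos[OF rv_g0] rv_pos[OF rv(5)] rv_pos[OF rv(7)] rv_pos[OF rv_g1] rv_pos[OF rv(3)] rv_pos[OF rv(1)]
    rv_pos[OF rv_R] rv_pos[OF rv(6)] rv_pos[OF a] by auto

lemma W_pos: "0 < t \<Longrightarrow> 0 < W \<theta> t"
  by (rule rv_pos[OF rv_W])

lemma reg_H: "reg (\<lambda>f u. K_functional X0 X1 u f)"
  by (rule reg_K_functional) (auto simp: qnorm_X0 qnorm_X1)

text \<open>Holmstedt's formula is available at the points \<open>R (exp k)\<close>, not at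
  \<open>exp k\<close>. The substitution is therefore applied to the complete integrand, whose
  doubling follows from that of its factors.\<close>

lemma interp_eqv: "(\<lambda>f (k::'k). wnorm \<theta> r a {0<..} (\<lambda>u. K_functional X0 X1 u f))
    \<asymp> (\<lambda>f k. lq r UNIV (\<lambda>i. sq (W \<theta>) i * (P (x f) i + sq R i * Q (x f) i)))"
proof -
  let ?G = "\<lambda>f u. ennreal (u powr (- \<theta>) * a u) * K_functional X0 X1 u f"
  have regG: "reg ?G"
    by (rule reg_mult[OF reg_rv[OF rv_mult[OF rv_power a]] reg_H])
  have index: "0 < 1 - \<theta>0" using \<theta>0 by simp
  have "(\<lambda>f (k::'k). wnorm \<theta> r a {0<..} (\<lambda>u. K_functional X0 X1 u f))
      \<asymp> (\<lambda>f k. lq r UNIV (\<lambda>i. ?G f (ex i)))"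
    using eqv_wnorm_UNIV[OF a r reg_H, of \<theta>] by (simp add: powr_def)
  also have "\<dots> \<asymp> (\<lambda>f k. lq r UNIV (\<lambda>i. ?G f (R (ex i))))"
    by (intro eqvI lq_change_of_variable[OF rv_R index regG r])
  also have "\<dots> = (\<lambda>f (k::'k). lq r UNIV (\<lambda>i. sq (W \<theta>) i * K_functional X0 X1 (R (ex i)) f))"
    by (simp add: W_def)
  also have "\<dots> \<asymp> (\<lambda>f k. lq r UNIV (\<lambda>i. sq (W \<theta>) i * (P (x f) i + sq R i * Q (x f) i)))"
    by (rule eqv_lq[OF eqv_mult[OF holmstedt] r])
  finally show ?thesis .
qed

text \<open>Hardy's inequality for \<open>P\<close>. The function
  \<open>1 / (W \<theta> * B)\<close> has index \<open>\<theta> * (1 - \<theta>0)\<close>, which is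
  positive, and the envelope of \<open>\<xi>\<close> grows at most at half this rate.\<close>

lemma P_les_\<xi>:
  assumes "0 < \<theta>"
  shows "(\<lambda>f (k::'k). lq r UNIV (\<lambda>i. sq (W \<theta>) i * P (x f) i)) \<lessapprox> (\<lambda>f k. lq r UNIV (\<xi> \<theta> f))"
proof -
  define \<kappa> where "\<kappa> = \<theta> * (1 - \<theta>0)"
  define \<sigma> where "\<sigma> = \<kappa> / 2"
  have k: "0 < \<kappa>" using assms \<theta>0 by (simp add: \<kappa>_def)
  have s: "0 < \<sigma>" "\<sigma> < \<kappa>" using k by (auto simp: \<sigma>_def)
  define w where "w = (\<lambda>t. 1 / (W \<theta> t * B t))"
  have rvw: "rv \<kappa> w"
    using rv_divide[OF rv_1 rv_mult[OF rv_W rv(5)]] by (simp add: w_def \<kappa>_def)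
  obtain C where C: "C < top" "\<And>x S k. slow \<sigma> S \<Longrightarrow> (\<And>i. sq g0 i * x i \<le> sq w i * S i) \<Longrightarrow>
      P x k \<le> C * (sq (\<lambda>t. B t * w t) k * S k)"
    using P_geometric[OF rvw k s(2)] by metis
  have "sq (W \<theta>) i * P (x f) i \<le> C * envelope \<sigma> (\<xi> \<theta> f) i" for f i
  proof -
    have "P (x f) i \<le> C * (sq (\<lambda>t. B t * w t) i * envelope \<sigma> (\<xi> \<theta> f) i)"
    proof (rule C(2)[OF slow_envelope])
      fix j
      have "sq g0 j * x f j = sq w j * sq (W \<theta>) j * sq B j * (sq g0 j * x f j)"
        using pos[of "ex j"] W_pos[of "ex j" \<theta>] by (simp add: w_def ennreal_mult[symmetric])
      also have "\<dots> = sq w j * \<xi> \<theta> f j" by (simp only: \<xi>_def mult.assoc)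
      also have "\<dots> \<le> sq w j * envelope \<sigma> (\<xi> \<theta> f) j" by (intro mult_left_mono le_envelope) auto
      finally show "sq g0 j * x f j \<le> sq w j * envelope \<sigma> (\<xi> \<theta> f) j" .
    qed (use s in simp)
    then have "sq (W \<theta>) i * P (x f) i \<le> sq (W \<theta>) i * (C * (sq (\<lambda>t. B t * w t) i * envelope \<sigma> (\<xi> \<theta> f) i))"
      by (rule mult_left_mono) simp
    also have "\<dots> = (sq (W \<theta>) i * sq (\<lambda>t. B t * w t) i) * (C * envelope \<sigma> (\<xi> \<theta> f) i)" by (simp only: ac_simps)
    also have "sq (W \<theta>) i * sq (\<lambda>t. B t * w t) i = 1"
      using pos[of "ex i"] W_pos[of "ex i" \<theta>] by (simp add: w_def ennreal_mult[symmetric])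
    finally show ?thesis by simp
  qed
  then have "(\<lambda>f i. sq (W \<theta>) i * P (x f) i) \<lessapprox> (\<lambda>f. envelope \<sigma> (\<xi> \<theta> f))"
    using C(1) by (intro lesI)
  from les_lq[OF this r] have "(\<lambda>f (k::'k). lq r UNIV (\<lambda>i. sq (W \<theta>) i * P (x f) i)) \<lessapprox> (\<lambda>f k. lq r UNIV (envelope \<sigma> (\<xi> \<theta> f)))" .
  also have "\<dots> \<lessapprox> (\<lambda>f k. lq r UNIV (\<xi> \<theta> f))" by (rule lq_envelope[OF r s(1)])
  finally show ?thesis .
qed

text \<open>Hardy's inequality for \<open>Q\<close>. The quotient of \<open>g1\<close> and
  \<open>W \<theta> * B * g0\<close> has index \<open>- (1 - \<theta>) * (1 - \<theta>0)\<close>,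
  which is negative.\<close>

lemma Q_les_\<xi>:
  assumes "\<theta> < 1"
  shows "(\<lambda>f (k::'k). lq r UNIV (\<lambda>i. sq (W \<theta>) i * (sq R i * Q (x f) i))) \<lessapprox> (\<lambda>f k. lq r UNIV (\<xi> \<theta> f))"
proof -
  define \<kappa> where "\<kappa> = - ((1 - \<theta>) * (1 - \<theta>0))"
  define \<sigma> where "\<sigma> = - \<kappa> / 2"
  have k: "\<kappa> < 0" using assms \<theta>0 by (simp add: \<kappa>_def)
  have s: "0 < \<sigma>" "\<sigma> < - \<kappa>" using k by (auto simp: \<sigma>_def)
  define w where "w = (\<lambda>t. g1 t / (W \<theta> t * (B t * g0 t)))"
  have "rv (- 1 - (- (\<theta> * (1 - \<theta>0)) + (0 + - \<theta>0))) w"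
    using rv_divide[OF rv_g1 rv_mult[OF rv_W rv_mult[OF rv(5) rv_g0]]] by (simp add: w_def)
  moreover have "- 1 - (- (\<theta> * (1 - \<theta>0)) + (0 + - \<theta>0)) = \<kappa>" by (simp add: \<kappa>_def algebra_simps)
  ultimately have rvw: "rv \<kappa> w" by simp
  obtain C where C: "C < top" "\<And>x S k. slow \<sigma> S \<Longrightarrow> (\<And>i. sq g1 i * x i \<le> sq w i * S i) \<Longrightarrow>
      Q x k \<le> C * (sq (\<lambda>t. X t * w t / \<alpha>1 t) k * S k)"
    using Q_geometric[OF rvw k s(2)] by metis
  have "sq (W \<theta>) i * (sq R i * Q (x f) i) \<le> C * envelope \<sigma> (\<xi> \<theta> f) i" for f i
  proof -
    have "Q (x f) i \<le> C * (sq (\<lambda>t. X t * w t / \<alpha>1 t) i * envelope \<sigma> (\<xi> \<theta> f) i)"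
    proof (rule C(2)[OF slow_envelope])
      fix j
      have "sq g1 j = sq w j * (sq (W \<theta>) j * (sq B j * sq g0 j))"
        using pos[of "ex j"] W_pos[of "ex j" \<theta>] by (simp add: w_def ennreal_mult[symmetric])
      then have "sq g1 j * x f j = sq w j * \<xi> \<theta> f j" by (simp only: \<xi>_def mult.assoc)
      also have "\<dots> \<le> sq w j * envelope \<sigma> (\<xi> \<theta> f) j" by (intro mult_left_mono le_envelope) auto
      finally show "sq g1 j * x f j \<le> sq w j * envelope \<sigma> (\<xi> \<theta> f) j" .
    qed (use s in simp)
    then have "sq (W \<theta>) i * (sq R i * Q (x f) i)
        \<le> sq (W \<theta>) i * (sq R i * (C * (sq (\<lambda>t. X t * w t / \<alpha>1 t) i * envelope \<sigma> (\<xi> \<theta> f) i)))"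
      by (intro mult_left_mono) auto
    also have "\<dots> = (sq (W \<theta>) i * (sq R i * sq (\<lambda>t. X t * w t / \<alpha>1 t) i)) * (C * envelope \<sigma> (\<xi> \<theta> f) i)"
      by (simp only: ac_simps)
    also have "sq (W \<theta>) i * (sq R i * sq (\<lambda>t. X t * w t / \<alpha>1 t) i) = 1"
    proof -
      have "W \<theta> (ex i) * (R (ex i) * (X (ex i) * w (ex i) / \<alpha>1 (ex i))) = 1"
        using pos[of "ex i"] W_pos[of "ex i" \<theta>] by (simp add: R_def w_def) (simp add: g1_def powr_minus divide_inverse)
      then show ?thesis using pos[of "ex i"] W_pos[of "ex i" \<theta>] rv_pos[OF rvw, of "ex i"]
        by (subst ennreal_mult[symmetric], simp, simp, subst ennreal_mult[symmetric]) auto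
    qed
    finally show ?thesis by simp
  qed
  then have "(\<lambda>f i. sq (W \<theta>) i * (sq R i * Q (x f) i)) \<lessapprox> (\<lambda>f. envelope \<sigma> (\<xi> \<theta> f))"
    using C(1) by (intro lesI)
  from les_lq[OF this r] have "(\<lambda>f (k::'k). lq r UNIV (\<lambda>i. sq (W \<theta>) i * (sq R i * Q (x f) i))) \<lessapprox> (\<lambda>f k. lq r UNIV (envelope \<sigma> (\<xi> \<theta> f)))" .
  also have "\<dots> \<lessapprox> (\<lambda>f k. lq r UNIV (\<xi> \<theta> f))" by (rule lq_envelope[OF r s(1)])
  finally show ?thesis .
qed

text \<open>Holds pointwise and for every \<open>\<theta>\<close>. Together with Hardy's inequality
  for \<open>Q\<close> it lets the \<open>P\<close> term absorb the \<open>Q\<close> term at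
  \<open>\<theta> = 0\<close>.\<close>

lemma \<xi>_les_P: "(\<lambda>f (k::'k). lq r UNIV (\<xi> \<theta> f)) \<lessapprox> (\<lambda>f k. lq r UNIV (\<lambda>i. sq (W \<theta>) i * P (x f) i))"
proof -
  obtain C where C: "C < top" "\<And>x k. x k \<le> ennreal (exp 1) * x (k - 1) \<Longrightarrow> sq B k * (sq g0 k * x k) \<le> C * P x k"
    by (rule P_point[OF ennreal_less_top]) (rule that; assumption)
  have "(\<lambda>f k. sq B k * (sq g0 k * x f k)) \<lessapprox> (\<lambda>f. P (x f))"
    by (intro lesI[OF C(1)] C(2) x_step)
  from les_lq[OF les_mult[OF this] r] show ?thesis unfolding \<xi>_def .
qed

lemma split_eqv:
  "(\<lambda>f (k::'k). lq r UNIV (\<lambda>i. sq (W \<theta>) i * (P (x f) i + sq R i * Q (x f) i)))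
   \<asymp> (\<lambda>f k. lq r UNIV (\<lambda>i. sq (W \<theta>) i * P (x f) i) + lq r UNIV (\<lambda>i. sq (W \<theta>) i * (sq R i * Q (x f) i)))"
  using eqv_lq_add[OF r] unfolding distrib_left .

lemma interp_mid:
  assumes "0 < \<theta>" "\<theta> < 1"
  shows "(\<lambda>f (k::'k). wnorm \<theta> r a {0<..} (\<lambda>u. K_functional X0 X1 u f)) \<asymp> (\<lambda>f k. lq r UNIV (\<xi> \<theta> f))"
proof (rule eqv_trans[OF eqv_trans[OF interp_eqv split_eqv]], rule eqvI)
  show "(\<lambda>f (k::'k). lq r UNIV (\<lambda>i. sq (W \<theta>) i * P (x f) i) + lq r UNIV (\<lambda>i. sq (W \<theta>) i * (sq R i * Q (x f) i)))
      \<lessapprox> (\<lambda>f k. lq r UNIV (\<xi> \<theta> f))"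
    by (intro les_add P_les_\<xi> Q_les_\<xi> assms)
  show "(\<lambda>f (k::'k). lq r UNIV (\<xi> \<theta> f))
      \<lessapprox> (\<lambda>f k. lq r UNIV (\<lambda>i. sq (W \<theta>) i * P (x f) i) + lq r UNIV (\<lambda>i. sq (W \<theta>) i * (sq R i * Q (x f) i)))"
    by (rule les_le_trans[OF \<xi>_les_P]) simp
qed

text \<open>Hardy's inequality for \<open>P\<close> has no gain at \<open>\<theta> = 0\<close>, so
  \<open>P\<close> is kept whole, while \<open>Q\<close> is bounded by \<open>\<xi>\<close> and
  thereby by \<open>P\<close>.\<close>

lemma interp_left:
  "(\<lambda>f (k::'k). wnorm 0 r a {0<..} (\<lambda>u. K_functional X0 X1 u f)) \<asymp> (\<lambda>f k. lq r UNIV (\<lambda>i. sq (W 0) i * P (x f) i))"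
proof (rule eqv_trans[OF eqv_trans[OF interp_eqv split_eqv]], rule eqvI)
  have "(\<lambda>f (k::'k). lq r UNIV (\<lambda>i. sq (W 0) i * (sq R i * Q (x f) i))) \<lessapprox> (\<lambda>f k. lq r UNIV (\<lambda>i. sq (W 0) i * P (x f) i))"
    by (rule les_trans[OF Q_les_\<xi> \<xi>_les_P]) simp
  then show "(\<lambda>f (k::'k). lq r UNIV (\<lambda>i. sq (W 0) i * P (x f) i) + lq r UNIV (\<lambda>i. sq (W 0) i * (sq R i * Q (x f) i)))
      \<lessapprox> (\<lambda>f k. lq r UNIV (\<lambda>i. sq (W 0) i * P (x f) i))"
    by (intro les_add les_refl)
qed (rule les_mono, simp)

text \<open>At \<open>\<theta> = 1\<close> it is \<open>P\<close> that reduces to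
  \<open>\<xi>\<close>. The term with \<open>\<xi>\<close> is kept beside the two summands of
  \<open>Q\<close>, which gives the three spaces of this case.\<close>

lemma interp_right:
  "(\<lambda>f (k::'k). wnorm 1 r a {0<..} (\<lambda>u. K_functional X0 X1 u f))
    \<asymp> (\<lambda>f k. lq r UNIV (\<xi> 1 f) + lq r UNIV (\<lambda>i. sq (W 1) i * (sq R i * Q (x f) i)))"
proof (rule eqv_trans[OF eqv_trans[OF interp_eqv split_eqv]], rule eqv_add[OF _ eqv_refl])
  show "(\<lambda>f (k::'k). lq r UNIV (\<lambda>i. sq (W 1) i * P (x f) i)) \<asymp> (\<lambda>f k. lq r UNIV (\<xi> 1 f))"
    by (intro eqvI P_les_\<xi> \<xi>_les_P) simp
qed

text \<open>Written out, \<open>R powr (- \<theta>) * B * g0\<close> is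
  \<open>(\<alpha>0 * B) powr (1 - \<theta>) * X powr \<theta>\<close> times the power of
  \<open>t\<close> with exponent \<open>- ((1 - \<theta>) * \<theta>0 + \<theta>)\<close>; the
  identity is checked on logarithms.\<close>

lemma \<xi>_eqv:
  assumes ws: "\<And>t. 0 < t \<Longrightarrow> ws t = (\<alpha>0 t * B t) powr (1 - \<theta>) * X t powr \<theta> * a (R t)"
  shows "(\<lambda>f (k::'k). wnorm ((1 - \<theta>) * \<theta>0 + \<theta>) r ws {0<..} (F f)) \<asymp> (\<lambda>f k. lq r UNIV (\<xi> \<theta> f))"
proof -
  have "rv 0 (\<lambda>t. (\<alpha>0 t * B t) powr (1 - \<theta>) * X t powr \<theta> * a (R t))"
    using rv_mult[OF rv_mult[OF rv_powr[OF rv_mult[OF rv(1) rv(5)], of "1 - \<theta>"] rv_powr[OF rv(7), of \<theta>]] rv_comp[OF a rv_R]]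
    by simp
  then have "rv 0 ws" by (rule rv_cong) (rule ws)
  from eqv_wnorm_UNIV[OF this r regF, of "(1 - \<theta>) * \<theta>0 + \<theta>"]
  have "(\<lambda>f (k::'k). wnorm ((1 - \<theta>) * \<theta>0 + \<theta>) r ws {0<..} (F f))
    \<asymp> (\<lambda>f k. lq r UNIV (\<lambda>i. wt ((1 - \<theta>) * \<theta>0 + \<theta>) ws i * x f i))"
    by (simp add: x_def)
  moreover have "wt ((1 - \<theta>) * \<theta>0 + \<theta>) ws i * x f i = \<xi> \<theta> f i" for f i
  proof -
    let ?t = "ex i"
    have "exp (- ((1 - \<theta>) * \<theta>0 + \<theta>) * real_of_int i) * ws ?t = W \<theta> ?t * (B ?t * g0 ?t)"
    proof -
      have "exp (- ((1 - \<theta>) * \<theta>0 + \<theta>) * real_of_int i) * ((\<alpha>0 ?t * B ?t) powr (1 - \<theta>) * X ?t powr \<theta>)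
          = R ?t powr (- \<theta>) * (B ?t * g0 ?t)"
        (is "?l = ?r")
      proof -
        have "0 < ?l" "0 < ?r" using pos[of ?t] by simp_all
        moreover have "ln ?l = ln ?r"
          using pos[of ?t] by (simp add: ln_mult ln_powr R_def ln_div g0_def algebra_simps)
        ultimately show ?thesis by (metis exp_ln)
      qed
      then show ?thesis by (simp add: ws W_def mult.assoc mult.left_commute mult.commute)
    qed
    then have "wt ((1 - \<theta>) * \<theta>0 + \<theta>) ws i = sq (W \<theta>) i * (sq B i * sq g0 i)"
      using pos[of ?t] W_pos[of ?t \<theta>] by (simp add: ennreal_mult[symmetric])
    then show ?thesis by (simp only: \<xi>_def mult.assoc)
  qed
  ultimately show ?thesis by simp
qed

text \<open>The two summands of \<open>P\<close> are the two spaces of the intersection: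
  \<open>B * U\<close> gives the norm with weight \<open>wB\<close>, and the head sums of
  \<open>\<beta>0 * U\<close> give the iterated norm.\<close>

lemma P_eqv:
  assumes wB: "\<And>t. 0 < t \<Longrightarrow> wB t = B t * a (R t)" and wa: "\<And>t. 0 < t \<Longrightarrow> wa t = a (R t)"
  shows "(\<lambda>f (k::'k). max (wnorm 0 r wB {0<..} (GL f)) (wnorm 0 r wa {0<..} (\<lambda>t. wnorm 0 r0 \<beta>0 {0<..<t} (GL f))))
    \<asymp> (\<lambda>f k. lq r UNIV (\<lambda>i. sq (W 0) i * P (x f) i))"
proof -
  have rva: "rv 0 wa" by (rule rv_cong[OF rv_comp[OF a rv_R] wa])
  have rvB: "rv 0 wB" using rv_mult[OF rv(5) rv_comp[OF a rv_R]] wB by (intro rv_cong[of 0 _ wB]) simp_all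
  have sqa: "sq wa i = sq (W 0) i" for i using pos[of "ex i"] by (simp add: wa W_def)
  have sqB: "sq wB i = sq (W 0) i * sq B i" for i
    using pos[of "ex i"] pos(9)[of "R (ex i)"] by (simp add: wB W_def ennreal_mult mult.commute)
  have "(\<lambda>f (k::'k). max (wnorm 0 r wB {0<..} (GL f)) (wnorm 0 r wa {0<..} (\<lambda>t. wnorm 0 r0 \<beta>0 {0<..<t} (GL f))))
    \<asymp> (\<lambda>f k. wnorm 0 r wB {0<..} (GL f) + wnorm 0 r wa {0<..} (\<lambda>t. wnorm 0 r0 \<beta>0 {0<..<t} (GL f)))"
    by (rule eqv_max)
  also have "\<dots> \<asymp> (\<lambda>f k. lq r UNIV (\<lambda>i. sq wB i * U (x f) i)
      + lq r UNIV (\<lambda>i. sq wa i * lq r0 {..<i} (\<lambda>j. sq \<beta>0 j * U (x f) j)))"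
    by (rule eqv_add[OF eqv_L[OF r rvB] eqv_LL[OF r rva]])
  also have "\<dots> \<asymp> (\<lambda>f k. lq r UNIV (\<lambda>i. sq wB i * U (x f) i + sq wa i * lq r0 {..<i} (\<lambda>j. sq \<beta>0 j * U (x f) j)))"
    by (rule eqv_sym[OF eqv_lq_add[OF r]])
  also have "\<dots> = (\<lambda>f k. lq r UNIV (\<lambda>i. sq (W 0) i * P (x f) i))"
    by (simp only: sqa sqB P_def distrib_left mult.assoc add.commute)
  finally show ?thesis .
qed

text \<open>At \<open>\<theta> = 1\<close> the factor \<open>R\<close> cancels the power in
  \<open>W 1\<close>, so both summands of \<open>Q\<close> carry the plain weight
  \<open>a (R t)\<close>.\<close>

lemma Q_eqv:
  assumes wD: "\<And>t. 0 < t \<Longrightarrow> wD t = D t * a (R t)" and wa: "\<And>t. 0 < t \<Longrightarrow> wa t = a (R t)"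
  shows "(\<lambda>f (k::'k). max (wnorm 0 r wD {0<..} (GR f)) (wnorm 0 r wa {0<..} (\<lambda>t. wnorm 0 r1 \<beta>1 {t<..} (GR f))))
    \<asymp> (\<lambda>f k. lq r UNIV (\<lambda>i. sq (W 1) i * (sq R i * Q (x f) i)))"
proof -
  have rva: "rv 0 wa" by (rule rv_cong[OF rv_comp[OF a rv_R] wa])
  have rvD: "rv 0 wD" using rv_mult[OF rv(6) rv_comp[OF a rv_R]] wD by (intro rv_cong[of 0 _ wD]) simp_all
  have sqa: "sq wa i = sq (W 1) i * sq R i" for i
    using pos[of "ex i"] pos(9)[of "R (ex i)"] by (simp add: wa W_def ennreal_mult[symmetric] powr_minus)
  have sqD: "sq wD i = sq (W 1) i * sq R i * sq D i" for i
    using pos[of "ex i"] pos(9)[of "R (ex i)"] by (simp add: wD W_def ennreal_mult[symmetric] powr_minus)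
  have "(\<lambda>f (k::'k). max (wnorm 0 r wD {0<..} (GR f)) (wnorm 0 r wa {0<..} (\<lambda>t. wnorm 0 r1 \<beta>1 {t<..} (GR f))))
    \<asymp> (\<lambda>f k. wnorm 0 r wD {0<..} (GR f) + wnorm 0 r wa {0<..} (\<lambda>t. wnorm 0 r1 \<beta>1 {t<..} (GR f)))"
    by (rule eqv_max)
  also have "\<dots> \<asymp> (\<lambda>f k. lq r UNIV (\<lambda>i. sq wD i * V (x f) i)
      + lq r UNIV (\<lambda>i. sq wa i * lq r1 {i..} (\<lambda>j. sq \<beta>1 j * V (x f) j)))"
    by (rule eqv_add[OF eqv_R[OF r rvD] eqv_RR[OF r rva]])
  also have "\<dots> \<asymp> (\<lambda>f k. lq r UNIV (\<lambda>i. sq wD i * V (x f) i + sq wa i * lq r1 {i..} (\<lambda>j. sq \<beta>1 j * V (x f) j)))"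
    by (rule eqv_sym[OF eqv_lq_add[OF r]])
  also have "\<dots> = (\<lambda>f k. lq r UNIV (\<lambda>i. sq (W 1) i * (sq R i * Q (x f) i)))"
    by (simp only: sqa sqD Q_def distrib_left mult.assoc)
  finally show ?thesis .
qed

text \<open>Outside \<open>X0 + X1\<close> the \<open>K\<close>-functional is an empty infimum and
  hence infinite at every point. Membership in the sum thus follows from finiteness of the
  norm.\<close>

lemma finite_interp:
  assumes "wnorm \<theta> r a {0<..} (\<lambda>u. K_functional X0 X1 u f) < top"
  shows "f \<in> sum_carrier X0 X1"
proof (rule ccontr)
  assume f: "f \<notin> sum_carrier X0 X1"
  have "(\<lambda>f (k::unit). lq r UNIV (\<lambda>i. wt \<theta> a i * K_functional X0 X1 (ex i) f))
      \<lessapprox> (\<lambda>f k. wnorm \<theta> r a {0<..} (\<lambda>u. K_functional X0 X1 u f))"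
    by (rule eqvD(2)[OF eqv_wnorm_UNIV[OF a r reg_H, of \<theta>]])
  then obtain C where C: "C < top" "\<And>f. lq r UNIV (\<lambda>i. wt \<theta> a i * K_functional X0 X1 (ex i) f)
      \<le> C * wnorm \<theta> r a {0<..} (\<lambda>u. K_functional X0 X1 u f)"
    by (rule lesE) (rule that)
  have "wt \<theta> a 0 * top \<le> lq r UNIV (\<lambda>i. wt \<theta> a i * K_functional X0 X1 (ex i) f)"
    using lq_single[of 0 UNIV r "\<lambda>i. wt \<theta> a i * K_functional X0 X1 (ex i) f"] r
    by (simp add: K_functional_top[OF f])
  also have "\<dots> \<le> C * wnorm \<theta> r a {0<..} (\<lambda>u. K_functional X0 X1 u f)" by (rule C(2))
  also have "\<dots> < top" using C(1) assms by (simp add: ennreal_mult_less_top)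
  finally show False using pos(9)[of 1] by (simp add: ennreal_mult_top)
qed

end

text \<open>The two sides of the theorem are cut out of different ambient sums, which have to be
  compared.\<close>

lemma sum_carrier_X: "sum_carrier X0 X1 \<subseteq> sum_carrier A0 A1"
proof
  fix f assume "f \<in> sum_carrier X0 X1"
  then obtain f0 f1 where "f0 \<in> carrier X0" "f1 \<in> carrier X1" and f3: "f = f0 + f1"
    unfolding sum_carrier_def by blast
  then have f: "f0 \<in> sum_carrier A0 A1" "f1 \<in> sum_carrier A0 A1" "f = f0 + f1"
    by (simp_all only: carrier_X0 carrier_X1 mem_Collect_eq)
  obtain a b c d where "f0 = a + b" "f1 = c + d" "a \<in> carrier A0" "b \<in> carrier A1" "c \<in> carrier A0" "d \<in> carrier A1"
    using f(1,2) unfolding sum_carrier_def by blast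
  then have "f = (a + c) + (b + d)" "a + c \<in> carrier A0" "b + d \<in> carrier A1"
    using f(3) sub by (auto simp: subspace_add)
  then show "f \<in> sum_carrier A0 A1" unfolding sum_carrier_def by blast
qed

end

section \<open>From equivalent norms to equal spaces\<close>

definition represents :: "'v qspace \<Rightarrow> 'v set \<Rightarrow> ('v \<Rightarrow> ennreal) \<Rightarrow> bool" where
  "represents Y S N \<longleftrightarrow> carrier Y = {f \<in> S. N f < top} \<and> (\<forall>f\<in>carrier Y. qnorm Y f = enn2real (N f))"

lemma represents_finite_norm_space: "represents (finite_norm_space A0 A1 N) (sum_carrier A0 A1) N"
  by (simp add: represents_def finite_norm_space_def)

lemma represents_inter:
  assumes "represents Y S N" "represents Y' S N'"
  shows "represents (inter_space Y Y') S (\<lambda>f. max (N f) (N' f))"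
proof -
  have "max (enn2real u) (enn2real v) = enn2real (max u v)" if "u < top" "v < top" for u v
    using that enn2real_mono[of u v] enn2real_mono[of v u] by (auto simp: max_def less_top[symmetric])
  then show ?thesis using assms by (auto simp: represents_def inter_space_def)
qed

lemma enn2real_le_mult: "u \<le> C * v \<Longrightarrow> C < top \<Longrightarrow> v < top \<Longrightarrow> enn2real u \<le> enn2real C * enn2real v"
  using enn2real_mono[of u "C * v"] by (simp add: enn2real_mult ennreal_mult_less_top)

text \<open>Equivalence makes finiteness of \<open>N\<close> and of \<open>N'\<close> the same
  condition, and finiteness puts an element into \<open>S\<close> and so into \<open>S'\<close>.
  Hence both carriers are described by finiteness alone, and on them \<open>enn2real\<close>
  preserves the estimates.\<close>

lemma same_space_eqv:
  assumes N: "(\<lambda>f (k::unit). N f) \<asymp> (\<lambda>f k. N' f)"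
    and Y: "represents Y S N" and Y': "represents Y' S' N'"
    and S: "S \<subseteq> S'" "\<And>f. N f < top \<Longrightarrow> f \<in> S"
  shows "same_space Y Y'"
proof -
  obtain C where C: "C < top" "\<And>f. N f \<le> C * N' f" using eqvD(1)[OF N] by (rule lesE) (rule that; blast)
  obtain D where D: "D < top" "\<And>f. N' f \<le> D * N f" using eqvD(2)[OF N] by (rule lesE) (rule that; blast)
  have fin: "N f < top \<longleftrightarrow> N' f < top" for f
    using le_less_trans[OF C(2)[of f]] le_less_trans[OF D(2)[of f]] C(1) D(1)
    by (auto simp: ennreal_mult_less_top)
  have car: "carrier Y = {f. N f < top}" "carrier Y' = {f. N f < top}"
    using Y Y' S fin by (auto simp: represents_def)
  have "qnorm Y' f \<le> enn2real D * qnorm Y f" "qnorm Y f \<le> enn2real C * qnorm Y' f" if "N f < top" for f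
  proof -
    have "f \<in> carrier Y" "f \<in> carrier Y'" using that car by auto
    then have "qnorm Y f = enn2real (N f)" "qnorm Y' f = enn2real (N' f)"
      using Y Y' by (auto simp: represents_def)
    then show "qnorm Y' f \<le> enn2real D * qnorm Y f" "qnorm Y f \<le> enn2real C * qnorm Y' f"
      using that fin[of f] enn2real_le_mult[OF C(2)[of f] C(1)] enn2real_le_mult[OF D(2)[of f] D(1)] by auto
  qed
  then show ?thesis unfolding same_space_def cont_embedded_def car by blast
qed

theorem theorem48:
  fixes A0 A1 X0 X1 :: "'v::real_vector qspace"
    and q0 r0 q1 r1 r :: ennreal
    and a0 b0 a1 b1 a :: "real \<Rightarrow> real"
    and \<theta>0 :: real
    and \<chi>0 \<chi>1 \<rho> B0 B1 :: "real \<Rightarrow> real"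
    and a_sharp :: "real \<Rightarrow> real \<Rightarrow> real"
    and \<eta> :: "real \<Rightarrow> real"
  assumes A: "quasi_banach A0" "quasi_banach A1" "compatible_couple A0 A1"
    and nontrivial: "carrier A0 \<inter> carrier A1 \<noteq> {0}"
    and exponents: "0 < q1" "0 < r1" "0 < r" "0 < r0" "0 < q0"
    and \<theta>0: "0 < \<theta>0" "\<theta>0 < 1"
    and SV: "slowly_varying a1" "slowly_varying b1"
      "slowly_varying a" "slowly_varying a0" "slowly_varying b0"
    and fin1: "wnorm 0 r1 b1 {0<..<1} (\<lambda>s. wnorm 0 q1 a1 {s<..<1} (\<lambda>_. 1)) < top"
    and fin0: "wnorm 0 r0 b0 {1<..} (\<lambda>_. 1) < top"
    and \<chi>1: "\<chi>1 = (\<lambda>t. enn2real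
        (wnorm 0 r1 b1 {0<..<t} (\<lambda>s. wnorm 0 q1 a1 {s<..<t} (\<lambda>_. 1))))"
    and \<chi>0: "\<chi>0 = (\<lambda>t. a0 t * enn2real (wnorm 0 r0 b0 {t<..} (\<lambda>_. 1)))"
    and \<rho>: "\<rho> = (\<lambda>t. t powr (1 - \<theta>0) * (\<chi>0 t / \<chi>1 t))"
    and a_sharp: "a_sharp = (\<lambda>\<theta> t. \<chi>0 t powr (1 - \<theta>) * \<chi>1 t powr \<theta> * a (\<rho> t))"
    and \<eta>: "\<eta> = (\<lambda>\<theta>. (1 - \<theta>) * \<theta>0 + \<theta>)"
    and B0: "B0 = (\<lambda>t. enn2real (wnorm 0 r0 b0 {t<..} (\<lambda>_. 1)) * a (\<rho> t))"
    and B1: "B1 = (\<lambda>t. enn2real (wnorm 0 r1 b1 {0<..<t} (\<lambda>_. 1)) * a (\<rho> t))"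
    and X0: "X0 = interp_L A0 A1 \<theta>0 r0 b0 q0 a0"
    and X1: "X1 = interp_R A0 A1 1 r1 b1 q1 a1"
  shows
    "(\<forall>\<theta>. 0 < \<theta> \<and> \<theta> < 1 \<longrightarrow>
        same_space (interp X0 X1 \<theta> r a) (interp A0 A1 (\<eta> \<theta>) r (a_sharp \<theta>))) \<and>
     (wnorm 0 r a {1<..} (\<lambda>_. 1) < top \<longrightarrow>
        same_space (interp X0 X1 0 r a)
          (inter_space (interp_L A0 A1 \<theta>0 r B0 q0 a0)
                       (interp_LL A0 A1 \<theta>0 r (a \<circ> \<rho>) r0 b0 q0 a0))) \<and>
     (wnorm 0 r a {0<..<1} (\<lambda>_. 1) < top \<longrightarrow>
        same_space (interp X0 X1 1 r a)
          (inter_space (interp A0 A1 1 r (a_sharp 1))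
             (inter_space (interp_R A0 A1 1 r B1 q1 a1)
                          (interp_RR A0 A1 1 r (a \<circ> \<rho>) r1 b1 q1 a1))))"
proof -
  have rvs: "rv 0 a1" "rv 0 b1" "rv 0 a" "rv 0 a0" "rv 0 b0"
    using SV by (simp_all add: slowly_varying_rv)
  define B where "B = (\<lambda>t. enn2real (wnorm 0 r0 b0 {t<..} (\<lambda>_. 1)))"
  define D where "D = (\<lambda>t. enn2real (wnorm 0 r1 b1 {0<..<t} (\<lambda>_. 1)))"
  have B: "rv 0 B" "(\<lambda>(p::unit) k. sq B k) \<lessapprox> (\<lambda>p k. lq r0 {k..} (sq b0))"
      "(\<lambda>(p::unit) k. lq r0 {k..} (sq b0)) \<lessapprox> (\<lambda>p k. sq B k)"
    unfolding B_def by (rule rv_tail[OF rvs(5) exponents(4) fin0])+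
  note head = rv_iterated_head[OF rvs(1,2) exponents(1,2) fin1]
  have X: "rv 0 \<chi>1"
      "(\<lambda>(p::unit) k. sq \<chi>1 k) \<lessapprox> (\<lambda>p k. lq r1 {..<k} (\<lambda>j. sq b1 j * lq q1 {j..<k} (sq a1)))"
      "(\<lambda>(p::unit) k. lq r1 {..<k} (\<lambda>j. sq b1 j * lq q1 {j..<k} (sq a1))) \<lessapprox> (\<lambda>p k. sq \<chi>1 k)"
    unfolding \<chi>1 by (rule head(1-3))+
  \<comment> \<open>Finiteness of the head norm of \<open>b1\<close> on \<open>(0, 1)\<close> is
    extracted from that of the iterated norm.\<close>
  have D: "rv 0 D" "(\<lambda>(p::unit) k. sq D k) \<lessapprox> (\<lambda>p k. lq r1 {..<k} (sq b1))"
      "(\<lambda>(p::unit) k. lq r1 {..<k} (sq b1)) \<lessapprox> (\<lambda>p k. sq D k)"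
    unfolding D_def by (rule rv_head[OF rvs(2) exponents(2) head(4)])+
  have weight_eqs: "\<chi>0 t = a0 t * B t" "B0 t = B t * a (\<rho> t)" "B1 t = D t * a (\<rho> t)" for t
    by (simp_all only: \<chi>0 B0 B1 B_def D_def)
  have qn: "quasi_normed A0" "quasi_normed A1" using A by (simp_all add: quasi_banach_def)
  interpret T: reiteration \<theta>0 q0 r0 q1 r1 a0 b0 a1 b1 B D \<chi>1 A0 A1
    by unfold_locales (intro exponents \<theta>0 rvs B D X A(3) qn)+
  have XT: "X0 = T.X0" "X1 = T.X1"
    by (simp_all add: X0 X1 T.X0_def T.X1_def)
  have \<rho>R: "\<rho> t = T.R t" if "0 < t" for t
    using that by (simp add: \<rho> weight_eqs(1) T.R_def T.g0_def powr_diff powr_minus divide_inverse ac_simps)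
  have F: "T.F = (\<lambda>f u. K_functional A0 A1 u f)"
    by (simp add: T.F_def[abs_def])
  have GL: "T.GL = (\<lambda>f t. wnorm \<theta>0 q0 a0 {0<..<t} (\<lambda>u. K_functional A0 A1 u f))"
    by (simp add: T.GL_def[abs_def] F)
  have GR: "T.GR = (\<lambda>f t. wnorm 1 q1 a1 {t<..} (\<lambda>u. K_functional A0 A1 u f))"
    by (simp add: T.GR_def[abs_def] F)
  \<comment> \<open>The interpolation side is the same in all three parts; what remains for each is
    an equivalence of norms and a description of the other space.\<close>
  note same = same_space_eqv[OF _ represents_finite_norm_space _ T.sum_carrier_X
      T.finite_interp[OF exponents(3) rvs(3)]]
  have sharp: "(\<lambda>f (k::unit). wnorm (\<eta> \<theta>) r (a_sharp \<theta>) {0<..} (T.F f)) \<asymp> (\<lambda>f k. lq r UNIV (T.\<xi> a \<theta> f))" for \<theta>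
    unfolding \<eta> by (rule T.\<xi>_eqv[OF exponents(3) rvs(3)]) (simp add: a_sharp weight_eqs(1) \<rho>R)
  have mid: "same_space (interp X0 X1 \<theta> r a) (interp A0 A1 (\<eta> \<theta>) r (a_sharp \<theta>))" if "0 < \<theta>" "\<theta> < 1" for \<theta>
    unfolding interp_def XT
    by (rule same[OF eqv_trans[OF T.interp_mid[OF exponents(3) rvs(3) that] eqv_sym[OF sharp[unfolded F]]]])
       (rule represents_finite_norm_space)
  have left: "same_space (interp X0 X1 0 r a)
      (inter_space (interp_L A0 A1 \<theta>0 r B0 q0 a0) (interp_LL A0 A1 \<theta>0 r (a \<circ> \<rho>) r0 b0 q0 a0))"
    unfolding interp_def interp_L_def interp_LL_def XT
  proof (rule same[OF eqv_trans[OF T.interp_left[OF exponents(3) rvs(3)] eqv_sym[OF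
        T.P_eqv[OF exponents(3) rvs(3), of B0 "a \<circ> \<rho>", unfolded GL]]]])
    show "B0 t = B t * a (T.R t)" if "0 < t" for t using that by (simp add: weight_eqs(2) \<rho>R)
    show "(a \<circ> \<rho>) t = a (T.R t)" if "0 < t" for t using that by (simp add: \<rho>R)
  qed (intro represents_inter represents_finite_norm_space)
  have right: "same_space (interp X0 X1 1 r a)
      (inter_space (interp A0 A1 1 r (a_sharp 1))
        (inter_space (interp_R A0 A1 1 r B1 q1 a1) (interp_RR A0 A1 1 r (a \<circ> \<rho>) r1 b1 q1 a1)))"
    unfolding interp_def interp_R_def interp_RR_def XT
  proof (rule same)
    \<comment> \<open>Intersections carry the maximum, here nested: the outer one separates
      \<open>a_sharp 1\<close>, the inner one is equivalent to the norm of \<open>Q\<close>.\<close>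
    have "(\<lambda>f (k::unit). max (wnorm 1 r (a_sharp 1) {0<..} (T.F f))
        (max (wnorm 0 r B1 {0<..} (T.GR f)) (wnorm 0 r (a \<circ> \<rho>) {0<..} (\<lambda>t. wnorm 0 r1 b1 {t<..} (T.GR f)))))
      \<asymp> (\<lambda>f k. wnorm 1 r (a_sharp 1) {0<..} (T.F f)
        + max (wnorm 0 r B1 {0<..} (T.GR f)) (wnorm 0 r (a \<circ> \<rho>) {0<..} (\<lambda>t. wnorm 0 r1 b1 {t<..} (T.GR f))))"
      by (rule eqv_max)
    also have "\<dots> \<asymp> (\<lambda>f k. lq r UNIV (T.\<xi> a 1 f) + lq r UNIV (\<lambda>i. sq (T.W a 1) i * (sq T.R i * T.Q (T.x f) i)))"
    proof (rule eqv_add)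
      show "(\<lambda>f (k::unit). wnorm 1 r (a_sharp 1) {0<..} (T.F f)) \<asymp> (\<lambda>f k. lq r UNIV (T.\<xi> a 1 f))"
        using sharp[of 1] by (simp add: \<eta>)
      show "(\<lambda>f (k::unit). max (wnorm 0 r B1 {0<..} (T.GR f)) (wnorm 0 r (a \<circ> \<rho>) {0<..} (\<lambda>t. wnorm 0 r1 b1 {t<..} (T.GR f))))
          \<asymp> (\<lambda>f k. lq r UNIV (\<lambda>i. sq (T.W a 1) i * (sq T.R i * T.Q (T.x f) i)))"
        by (rule T.Q_eqv[OF exponents(3) rvs(3)]) (simp_all add: weight_eqs(3) \<rho>R)
    qed
    finally show "(\<lambda>f (k::unit). wnorm 1 r a {0<..} (\<lambda>u. K_functional T.X0 T.X1 u f))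
      \<asymp> (\<lambda>f k. max (wnorm 1 r (a_sharp 1) {0<..} (\<lambda>u. K_functional A0 A1 u f))
        (max (wnorm 0 r B1 {0<..} (\<lambda>t. wnorm 1 q1 a1 {t<..} (\<lambda>u. K_functional A0 A1 u f)))
          (wnorm 0 r (a \<circ> \<rho>) {0<..} (\<lambda>t. wnorm 0 r1 b1 {t<..}
            (\<lambda>u. wnorm 1 q1 a1 {u<..} (\<lambda>v. K_functional A0 A1 v f))))))"
      unfolding F GR by (rule eqv_trans[OF T.interp_right[OF exponents(3) rvs(3)] eqv_sym])
  qed (intro represents_inter represents_finite_norm_space)
  from mid left right show ?thesis by blast
qed

end
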